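(* Let $F(x,y,z)=a(z)xy+b(z)x^2g(y)+h(y,z)\in\mathbb{Z}[x,y,z]$, where $a(z),b(z)$ are any non-zero polynomials, $g(y)$ is any polynomial of degree at least two and $h(y,z)$ is an arbitrary polynomial. Let $L_1\le L_2$ be positive real numbers, let $\alpha\in(0,1)$, let $p$ be a prime and let $A,B,C$ be subsets of $\mathbb{F}_p$ with cardinalities satisfying $L_1p^\alpha\le|A|,|B|,|C|\le L_2p^\alpha$. For $r\in\mathbb{F}_p$ denote $$S_r=\sum_{(x,y,z)\in A\times B\times C} e_r\big(F(x,y,z)\big).$$ Then there exists $\gamma=\gamma(\alpha)>0$ (depending only on $\alpha$) such that $$\max_{r\in\mathbb{F}_p\smallsetminus\{0\}}|S_r|\ll p^{((22-\gamma/2)\alpha+1)/8},$$ where the implied constant depends only on $F$, $L_1$ and $L_2$.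
   Context: $\mathbb{F}_p$ is the field with $p$ elements, and $F$ is evaluated on $\mathbb{F}_p^3$ by reduction modulo $p$. For $r,u\in\mathbb{F}_p$, $e_r(u)=\exp(2\pi i\, ru/p)$. *)

theory Defs
  imports "HOL-Number_Theory.Residues" "HOL-Computational_Algebra.Polynomial" Complex_Main
begin

text \<open>
  Elements of \<open>\<int>[x,y,z]\<close> are rendered as \<^typ>\<open>int poly poly poly\<close>: the outermost
  variable is \<open>x\<close>, the middle one \<open>y\<close>, the innermost one \<open>z\<close>.
  Accordingly \<^typ>\<open>int poly poly\<close> is \<open>\<int>[y,z]\<close>, again with \<open>y\<close> outermost.
\<close>

type_synonym zpoly3 = "int poly poly poly"

definition var_x :: zpoly3 where
  "var_x = [:0, 1:]"

definition var_y :: zpoly3 where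
  "var_y = [:[:0, 1:]:]"

definition in_y :: "int poly \<Rightarrow> zpoly3" where
  "in_y g = [:map_poly (\<lambda>c. [:c:]) g:]"

definition in_z :: "int poly \<Rightarrow> zpoly3" where
  "in_z a = [:[:a:]:]"

definition in_yz :: "int poly poly \<Rightarrow> zpoly3" where
  "in_yz h = [:h:]"

definition admissible :: "zpoly3 \<Rightarrow> bool" where
  "admissible F \<longleftrightarrow>
     (\<exists>(a :: int poly) (b :: int poly) (g :: int poly) (h :: int poly poly).
        a \<noteq> 0 \<and> b \<noteq> 0 \<and> 2 \<le> degree g \<and>
        F = in_z a * var_x * var_y + in_z b * var_x ^ 2 * in_y g + in_yz h)"

definition eval3 :: "zpoly3 \<Rightarrow> int \<Rightarrow> int \<Rightarrow> int \<Rightarrow> int" where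
  "eval3 F x y z = poly (poly (poly F [:[:x:]:]) [:y:]) z"

text \<open>
  The field \<open>\<bbbF>\<^sub>p\<close> is the ring \<^const>\<open>residue_ring\<close>, whose elements are the
  representatives \<open>0, \<dots>, p - 1\<close>.  A type of residues is not usable here, since
  constants have to be uniform in \<open>p\<close>.
\<close>

abbreviation Fp :: "nat \<Rightarrow> int set" where
  "Fp p \<equiv> carrier (residue_ring (int p))"

definition eval3_mod :: "nat \<Rightarrow> zpoly3 \<Rightarrow> int \<Rightarrow> int \<Rightarrow> int \<Rightarrow> int" where
  "eval3_mod p F x y z = eval3 F x y z mod int p"

definition add_char :: "nat \<Rightarrow> int \<Rightarrow> int \<Rightarrow> complex" where
  "add_char p r u = exp (2 * of_real pi * \<i> * of_int (r * u) / of_nat p)"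

definition char_sum ::
    "nat \<Rightarrow> zpoly3 \<Rightarrow> int set \<Rightarrow> int set \<Rightarrow> int set \<Rightarrow> int \<Rightarrow> complex" where
  "char_sum p F A B C r =
     (\<Sum>(x, y, z) \<in> A \<times> B \<times> C. add_char p r (eval3_mod p F x y z))"

lemma eval3_admissible_form:
  "eval3 (in_z a * var_x * var_y + in_z b * var_x ^ 2 * in_y g + in_yz h) x y z =
     poly a z * x * y + poly b z * x ^ 2 * poly g y + poly (poly h [:y:]) z"
proof -
  have "poly (poly (map_poly (\<lambda>c. [:c:]) g) [:y:]) z = poly g y"
    by (induction g) (simp_all add: map_poly_pCons)
  then show ?thesis
    by (simp add: eval3_def in_z_def var_x_def var_y_def in_y_def in_yz_def)
qed

end

theory Submission imports Defs "HOL-Analysis.Convex"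
begin

text \<open>
  For fixed \<open>z\<close> the sum over \<open>x\<close> and \<open>y\<close> alone has the required cancellation. Unless \<open>a(z)\<close> or \<open>b(z)\<close> vanishes
  modulo \<open>p\<close>, which happens for boundedly many \<open>z\<close>, it is a bilinear sum
  \<open>\<Sum>\<^sub>y c\<^sub>y \<Sum>\<^sub>x e(a'xy + b'x\<^sup>2g(y))\<close> with unimodular weights \<open>c\<^sub>y\<close> and nonzero \<open>a'\<close>, \<open>b'\<close>: it pairs the points
  \<open>(x, x\<^sup>2)\<close> of a parabola with the points of the curve \<open>(y, g(y))\<close>. Hoelder's inequality with exponent 3 and
  two applications of Cauchy-Schwarz bound its twelfth power by a constant times
  \<open>|A|\<^sup>6 |B|\<^sup>1\<^sup>0 p\<^sup>2 J(A)\<close> (lemma \<open>parabola_curve_sum_bound\<close>). Here the additive energy of the curve is of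
  the optimal order \<open>|B|\<^sup>2\<close> because \<open>g\<close> has degree at least two, and \<open>J(A)\<close> is the third additive energy of
  the points of the parabola over \<open>A\<close>, which is trivially at most \<open>2|A|\<^sup>4\<close>.

  Put together, the trivial bound for \<open>J(A)\<close> gives the exponent \<open>(16\<alpha> + 1)/6\<close> for the triple sum, while the trivial
  bound for the triple sum gives \<open>3\<alpha>\<close>. The first is smaller than \<open>(22\<alpha> + 1)/8\<close> for \<open>\<alpha> > 1/2\<close>, the second for
  \<open>\<alpha> < 1/2\<close>, so in both ranges \<open>\<gamma>(\<alpha>)\<close> can be read off. At \<open>\<alpha> = 1/2\<close> all three exponents are \<open>3/2\<close>, and a power
  saving in \<open>J(A)\<close> for \<open>|A|\<close> of order \<open>\<surd>p\<close> is needed (lemma \<open>large_parabola_energy\<close>). It would fail if there were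
  a subfield of that size, hence it must rest on the sum-product phenomenon.

  For this saving, write a point \<open>(u, v)\<close> as \<open>P(y) + P(z) - P(x)\<close> with \<open>P(x) = (x, x\<^sup>2)\<close>. Then
  \<open>2(x - y)(u - y) = v - u\<^sup>2\<close>, so \<open>(y, 1/(x - y))\<close> is on a line determined by \<open>(u, v)\<close>. If \<open>J(A) \<ge> |A|\<^sup>4/K\<close>,
  many of these lines pass through many of the points. After two columns \<open>t0\<close>, \<open>t1\<close> have been fixed, lines are
  pairs of heights, and passing through a third column \<open>t\<close> means that
  \<open>(t1 - t) z0 + (t - t0) z1\<close> lies in a set of size \<open>|A|\<close>. The theorem of Balog, Szemeredi and Gowers replaces the
  graph of these pairs by a product set for every \<open>t\<close>, and Ruzsa's inequalities then produce one set \<open>D\<close> of about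
  \<open>\<surd>p\<close> residues and about \<open>\<surd>p\<close> many \<open>\<xi>\<close> such that \<open>D - \<xi>D\<close> is not much larger than \<open>D\<close>, up to powers of \<open>K\<close>
  (lemma \<open>few_rich_dilates\<close>). By covering and by Pluennecke's inequality, bounded rational expressions in these \<open>\<xi>\<close>
  have the same property, and there are about \<open>p\<close> values of such expressions. On the other hand, a count of
  solutions of \<open>x + \<xi>y = x' + \<xi>y'\<close> permits only about \<open>\<surd>p\<close> such dilations (lemma \<open>sum_product_phenomenon\<close>).
  Therefore \<open>K\<close> is at least a fixed power of \<open>p\<close>.
\<close>

section \<open>Counting and averaging\<close>

lemma sum_power2_le:
  fixes f :: "'b \<Rightarrow> real"
  shows "(\<Sum>i\<in>I. f i)\<^sup>2 \<le> real (card I) * (\<Sum>i\<in>I. (f i)\<^sup>2)"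
  using Cauchy_Schwarz_ineq_sum[of "\<lambda>_. 1" f I] by simp

lemma power2_sum_power2_le:
  fixes r :: "'b \<Rightarrow> real"
  assumes "\<And>i. i \<in> I \<Longrightarrow> 0 \<le> r i"
  shows "(\<Sum>i\<in>I. (r i)\<^sup>2)\<^sup>2 \<le> (\<Sum>i\<in>I. r i) * (\<Sum>i\<in>I. (r i) ^ 3)"
proof -
  have "(\<Sum>i\<in>I. sqrt (r i) * (r i * sqrt (r i)))\<^sup>2 \<le> (\<Sum>i\<in>I. (sqrt (r i))\<^sup>2) * (\<Sum>i\<in>I. (r i * sqrt (r i))\<^sup>2)"
    by (rule Cauchy_Schwarz_ineq_sum)
  moreover have "(\<Sum>i\<in>I. sqrt (r i) * (r i * sqrt (r i))) = (\<Sum>i\<in>I. (r i)\<^sup>2)"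
    using assms by (intro sum.cong refl) (simp add: power2_eq_square mult.left_commute)
  moreover have "(\<Sum>i\<in>I. (sqrt (r i))\<^sup>2) = (\<Sum>i\<in>I. r i)" using assms by (intro sum.cong refl) simp
  moreover have "(\<Sum>i\<in>I. (r i * sqrt (r i))\<^sup>2) = (\<Sum>i\<in>I. (r i) ^ 3)"
    using assms by (intro sum.cong refl) (simp add: power_mult_distrib eval_nat_numeral)
  ultimately show ?thesis by simp
qed

text \<open>
  The power mean inequality with exponent 3. It follows from two applications of Cauchy-Schwarz,
  which bound the fourth power of the sum by the sum itself times the sum of cubes.
\<close>

lemma sum_power3_le:
  fixes r :: "'b \<Rightarrow> real"
  assumes r: "\<And>i. i \<in> I \<Longrightarrow> 0 \<le> r i"
  shows "(\<Sum>i\<in>I. r i) ^ 3 \<le> (real (card I))\<^sup>2 * (\<Sum>i\<in>I. (r i) ^ 3)"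
proof -
  define s t where "s = (\<Sum>i\<in>I. r i)" and "t = (\<Sum>i\<in>I. (r i)\<^sup>2)"
  define c where "c = (\<Sum>i\<in>I. (r i) ^ 3)"
  have s0: "0 \<le> s" and c0: "0 \<le> c" using r by (auto simp: s_def c_def intro!: sum_nonneg)
  have "(s\<^sup>2)\<^sup>2 \<le> (real (card I) * t)\<^sup>2" unfolding s_def t_def by (intro power_mono sum_power2_le) auto
  also have "\<dots> \<le> (real (card I))\<^sup>2 * (s * c)"
    unfolding power_mult_distrib t_def s_def c_def using r by (intro mult_left_mono power2_sum_power2_le) auto
  finally have *: "s * s ^ 3 \<le> s * ((real (card I))\<^sup>2 * c)" by (simp add: eval_nat_numeral mult_ac)
  show ?thesis
  proof (cases "s = 0")
    case True
    then show ?thesis using c0 by (simp add: s_def[symmetric] c_def[symmetric])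
  next
    case False
    then have "s ^ 3 \<le> (real (card I))\<^sup>2 * c" using * s0 by (intro mult_left_le_imp_le[OF *]) auto
    then show ?thesis by (simp add: s_def c_def)
  qed
qed

lemma ex_ge_average:
  fixes f g :: "'b \<Rightarrow> real"
  assumes "finite I" "I \<noteq> {}" "sum g I \<le> sum f I"
  obtains i where "i \<in> I" "g i \<le> f i"
  using assms by (metis linorder_not_less sum_strict_mono)

lemma card_filter_eq_sum:
  "finite I \<Longrightarrow> real (card {i \<in> I. P i}) = (\<Sum>i\<in>I. of_bool (P i))"
  by (simp add: sum_of_bool_eq Int_def)

lemma double_count:
  assumes "finite I" "finite J"
  shows "(\<Sum>i\<in>I. real (card {j \<in> J. P i j})) = (\<Sum>j\<in>J. real (card {i \<in> I. P i j}))"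
  unfolding card_filter_eq_sum[OF assms(1)] card_filter_eq_sum[OF assms(2)] by (rule sum.swap)

lemma card_eq_sum_fibres:
  assumes "G \<subseteq> A \<times> B" "finite A" "finite B"
  shows "real (card G) = (\<Sum>a\<in>A. real (card {b \<in> B. (a, b) \<in> G}))"
proof -
  have "G = (SIGMA a:A. {b \<in> B. (a, b) \<in> G})" using assms(1) by auto
  then have "card G = card (SIGMA a:A. {b \<in> B. (a, b) \<in> G})" by simp
  also have "\<dots> = (\<Sum>a\<in>A. card {b \<in> B. (a, b) \<in> G})" using assms by (intro card_SigmaI) auto
  finally show ?thesis by simp
qed

text \<open>
  For finite \<open>X\<close> this is the second moment of the fibre sizes of \<open>f\<close>. All additive energies below are
  collision counts.
\<close>

definition collisions :: "('a \<Rightarrow> 'b) \<Rightarrow> 'a set \<Rightarrow> nat" where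
  "collisions f X = card {(x, x'). x \<in> X \<and> x' \<in> X \<and> f x = f x'}"

definition fibre_card :: "('a \<Rightarrow> 'b) \<Rightarrow> 'a set \<Rightarrow> 'b \<Rightarrow> real" where
  "fibre_card f X y = real (card {x \<in> X. f x = y})"

lemma sum_fibre_card:
  assumes "finite X"
  shows "(\<Sum>y\<in>f ` X. fibre_card f X y) = real (card X)"
  using sum.image_gen[OF assms, of "\<lambda>_. 1::real" f] by (simp add: fibre_card_def)

lemma sum_fibre_card_power2:
  assumes "finite X"
  shows "(\<Sum>y\<in>f ` X. (fibre_card f X y)\<^sup>2) = real (collisions f X)"
proof -
  have "(\<Sum>y\<in>f ` X. (fibre_card f X y)\<^sup>2) = (\<Sum>x\<in>X. real (card {x' \<in> X. f x' = f x}))"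
    unfolding sum.image_gen[OF assms, of "\<lambda>x. real (card {x' \<in> X. f x' = f x})" f] fibre_card_def
    by (intro sum.cong refl) (simp add: power2_eq_square)
  also have "\<dots> = real (card (SIGMA x:X. {x' \<in> X. f x' = f x}))" using assms by simp
  also have "(SIGMA x:X. {x' \<in> X. f x' = f x}) = {(x, x'). x \<in> X \<and> x' \<in> X \<and> f x = f x'}" by auto
  finally show ?thesis by (simp add: collisions_def)
qed

lemma sum_power2_fibres_le:
  assumes "finite X" "Y \<subseteq> f ` X" and M: "\<And>y. y \<in> Y \<Longrightarrow> fibre_card f X y \<le> M" and M0: "0 \<le> M"
  shows "(\<Sum>y\<in>Y. (fibre_card f X y)\<^sup>2) \<le> M * real (card {x \<in> X. f x \<in> Y})"
proof -
  have finY: "finite Y" using assms finite_subset by blast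
  have "(\<Sum>y\<in>Y. (fibre_card f X y)\<^sup>2) \<le> (\<Sum>y\<in>Y. M * fibre_card f X y)"
    unfolding power2_eq_square using M by (intro sum_mono mult_right_mono) (auto simp: fibre_card_def)
  also have "\<dots> = M * (\<Sum>y\<in>Y. fibre_card f X y)" by (simp add: sum_distrib_left)
  also have "(\<Sum>y\<in>Y. fibre_card f X y) = real (card {x \<in> X. f x \<in> Y})"
  proof -
    have fin: "finite {x \<in> X. f x \<in> Y}" using assms by simp
    have im: "f ` {x \<in> X. f x \<in> Y} = Y" using assms(2) by auto
    have "(\<Sum>y\<in>Y. fibre_card f {x \<in> X. f x \<in> Y} y) = real (card {x \<in> X. f x \<in> Y})"
      using sum_fibre_card[OF fin, of f] unfolding im .
    moreover have "fibre_card f {x \<in> X. f x \<in> Y} y = fibre_card f X y" if "y \<in> Y" for y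
      using that unfolding fibre_card_def by (intro arg_cong[where f = "\<lambda>S. real (card S)"]) auto
    ultimately show ?thesis by simp
  qed
  finally show ?thesis .
qed

lemma card_power2_le_collisions:
  assumes "finite X"
  shows "(card X)\<^sup>2 \<le> card (f ` X) * collisions f X"
proof -
  have "(real (card X))\<^sup>2 = (\<Sum>y\<in>f ` X. fibre_card f X y)\<^sup>2" using sum_fibre_card[OF assms, of f] by simp
  also have "\<dots> \<le> real (card (f ` X)) * (\<Sum>y\<in>f ` X. (fibre_card f X y)\<^sup>2)" by (rule sum_power2_le)
  also have "\<dots> = real (card (f ` X) * collisions f X)" by (simp add: sum_fibre_card_power2[OF assms])
  finally show ?thesis by (simp only: of_nat_power[symmetric] of_nat_le_iff)
qed

definition distinct_triples :: "'a set \<Rightarrow> (('a \<times> 'a) \<times> 'a) set" where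
  "distinct_triples C = {((a, b), c). a \<in> C \<and> b \<in> C \<and> c \<in> C \<and> a \<noteq> b \<and> a \<noteq> c \<and> b \<noteq> c}"

text \<open>
  Three different columns are needed below, and their number is the cube of the number of columns, up to the
  trivial contribution of lines with few columns.
\<close>

lemma power3_card_le_distinct_triples:
  assumes "finite C"
  shows "real (card C) ^ 3 \<le> 2 * real (card (distinct_triples C)) + 216"
proof -
  define c where "c = real (card C)"
  define D where "D = (\<lambda>(x, y). ((x, x), y)) ` (C \<times> C) \<union> (\<lambda>(x, y). ((x, y), x)) ` (C \<times> C) \<union> (\<lambda>(x, y). ((x, y), y)) ` (C \<times> C)"
  have sub: "distinct_triples C \<subseteq> (C \<times> C) \<times> C" by (auto simp: distinct_triples_def)
  have fin: "finite (distinct_triples C)" using finite_subset[OF sub] assms by simp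
  have "(C \<times> C) \<times> C \<subseteq> distinct_triples C \<union> D"
  proof
    fix z assume z: "z \<in> (C \<times> C) \<times> C"
    obtain u v w where "z = ((u, v), w)" by (metis surj_pair)
    with z show "z \<in> distinct_triples C \<union> D"
      by (cases "u = v"; cases "u = w"; cases "v = w") (auto simp: distinct_triples_def D_def image_iff)
  qed
  then have "card ((C \<times> C) \<times> C) \<le> card (distinct_triples C \<union> D)"
    using fin assms by (intro card_mono) (auto simp: D_def)
  also have "\<dots> \<le> card (distinct_triples C) + card D" by (rule card_Un_le)
  also have "card D \<le> card (C \<times> C) + card (C \<times> C) + card (C \<times> C)"
    unfolding D_def using assms
    by (intro order_trans[OF card_Un_le] add_mono order_trans[OF card_image_le]) auto
  finally have "card ((C \<times> C) \<times> C) \<le> card (distinct_triples C) + 3 * card (C \<times> C)" by simp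
  then have "real (card ((C \<times> C) \<times> C)) \<le> real (card (distinct_triples C) + 3 * card (C \<times> C))" by (simp only: of_nat_le_iff)
  then have 1: "c ^ 3 \<le> real (card (distinct_triples C)) + 3 * c\<^sup>2"
    by (simp add: c_def card_cartesian_product power2_eq_square power3_eq_cube mult.assoc)
  \<comment> \<open>216 is \<open>6\<^sup>3\<close>; from \<open>c = 6\<close> on, the at most \<open>3c\<^sup>2\<close> degenerate triples are at most half of all triples.\<close>
  show ?thesis
  proof (cases "6 \<le> c")
    case True
    then have "6 * c\<^sup>2 \<le> c * c\<^sup>2" by (intro mult_right_mono) auto
    then have "6 * c\<^sup>2 \<le> c ^ 3" by (simp add: power3_eq_cube power2_eq_square)
    then show ?thesis using 1 by (simp add: c_def)
  next
    case False
    then have "c ^ 3 \<le> 6 ^ 3" by (intro power_mono) (auto simp: c_def)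
    then show ?thesis by (simp add: c_def)
  qed
qed

section \<open>Sumset inequalities\<close>

lemma sumset_eq_image: "(A::'a::plus set) + B = (\<lambda>(a, b). a + b) ` (A \<times> B)"
  by (auto simp: set_plus_def)

lemma finite_sumset [simp]: "finite A \<Longrightarrow> finite B \<Longrightarrow> finite ((A::'a::plus set) + B)"
  by (rule finite_set_plus)

lemma card_sumset_le: "finite A \<Longrightarrow> finite B \<Longrightarrow> card ((A::'a::plus set) + B) \<le> card A * card B"
  unfolding sumset_eq_image by (metis card_cartesian_product card_image_le finite_cartesian_product)

lemma card_sumset_mono: "A \<subseteq> A' \<Longrightarrow> B \<subseteq> B' \<Longrightarrow> finite A' \<Longrightarrow> finite B' \<Longrightarrow> real (card (A + B)) \<le> real (card (A' + (B' :: 'a::ab_group_add set)))"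
  by (simp add: card_mono set_plus_mono2)

lemma uminus_sumset: "uminus ` ((A::'a::ab_group_add set) + B) = uminus ` A + uminus ` B"
proof (intro Set.set_eqI iffI)
  fix x assume "x \<in> uminus ` (A + B)"
  then obtain a b where ab: "a \<in> A" "b \<in> B" "x = - (a + b)" by (auto elim!: set_plus_elim)
  have "x = - a + - b" using ab(3) by simp
  then show "x \<in> uminus ` A + uminus ` B" using ab(1,2) by (simp only:) (intro set_plus_intro imageI)
next
  fix x assume "x \<in> uminus ` A + uminus ` B"
  then obtain a b where ab: "a \<in> A" "b \<in> B" "x = - a + - b" by (auto elim!: set_plus_elim)
  have "x = - (a + b)" using ab(3) by simp
  then show "x \<in> uminus ` (A + B)" using ab(1,2) by (simp only:) (intro set_plus_intro imageI)
qed

lemma card_uminus [simp]: "card (uminus ` (A::'a::ab_group_add set)) = card A"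
  by (intro card_image) (auto simp: inj_on_def)

lemma uminus_uminus_image: "uminus ` uminus ` (A::'a::ab_group_add set) = A"
  by (simp add: image_image)

lemma uminus_difference_set: "uminus ` (B + uminus ` B) = B + uminus ` (B :: 'a::ab_group_add set)"
  by (simp add: uminus_sumset uminus_uminus_image add.commute)

text \<open>
  A difference \<open>x - y\<close> and an element \<open>z\<close> are recovered from the pair \<open>(x + z, y + z)\<close>, once a
  representation of every difference has been chosen.
\<close>

lemma ruzsa_triangle:
  fixes X Y Z :: "'a::ab_group_add set"
  assumes fin: "finite X" "finite Y" "finite Z"
  shows "card Z * card (X + uminus ` Y) \<le> card (X + Z) * card (Y + Z)"
proof -
  have "\<forall>d\<in>X + uminus ` Y. \<exists>q. fst q \<in> X \<and> snd q \<in> Y \<and> d = fst q - snd q"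
    by (force simp: set_plus_def)
  then obtain q where q: "\<And>d. d \<in> X + uminus ` Y \<Longrightarrow> fst (q d) \<in> X \<and> snd (q d) \<in> Y \<and> d = fst (q d) - snd (q d)"
    by metis
  define f where "f = (\<lambda>(z, d). (fst (q d) + z, snd (q d) + z))"
  have "inj_on f (Z \<times> (X + uminus ` Y))"
  proof (rule inj_onI; clarify)
    fix z d z' d'
    assume d: "d \<in> X + uminus ` Y" and d': "d' \<in> X + uminus ` Y" and eq: "f (z, d) = f (z', d')"
    have e: "fst (q d) + z = fst (q d') + z'" "snd (q d) + z = snd (q d') + z'"
      using eq by (auto simp: f_def)
    have "d = (fst (q d) + z) - (snd (q d) + z)" using q[OF d] by simp
    also have "\<dots> = (fst (q d') + z') - (snd (q d') + z')" using e by simp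
    also have "\<dots> = d'" using q[OF d'] by simp
    finally have "d = d'" .
    then show "z = z' \<and> d = d'" using e by simp
  qed
  moreover have "f ` (Z \<times> (X + uminus ` Y)) \<subseteq> (X + Z) \<times> (Y + Z)"
    using q by (auto simp: f_def intro!: set_plus_intro)
  ultimately have "card (Z \<times> (X + uminus ` Y)) \<le> card ((X + Z) \<times> (Y + Z))"
    using fin by (intro card_inj_on_le[of f]) auto
  then show ?thesis by (simp add: card_cartesian_product)
qed

lemma ruzsa_triangle_real:
  fixes X Y Z :: "'a::ab_group_add set"
  assumes fin: "finite X" "finite Y" "finite Z" and N: "0 < N"
    and XZ: "real (card (X + Z)) \<le> k * N" and YZ: "real (card (Y + Z)) \<le> l * N"
    and Z: "N \<le> j * real (card Z)" and nonneg: "0 \<le> k" "0 \<le> j"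
  shows "real (card (X + uminus ` Y)) \<le> (j * k * l) * N"
proof -
  define s where "s = real (card (X + uminus ` Y))"
  have "N * s \<le> j * (real (card Z) * s)" using Z by (simp add: s_def mult_right_mono mult.assoc[symmetric])
  also have "\<dots> \<le> j * ((k * N) * (l * N))"
  proof (rule mult_left_mono)
    have "real (card Z) * s \<le> real (card (X + Z)) * real (card (Y + Z))"
      unfolding s_def of_nat_mult[symmetric] of_nat_le_iff by (rule ruzsa_triangle[OF fin])
    also have "\<dots> \<le> (k * N) * (l * N)" using XZ YZ nonneg N by (intro mult_mono) auto
    finally show "real (card Z) * s \<le> (k * N) * (l * N)" .
  qed (rule nonneg)
  finally have "N * s \<le> j * ((k * N) * (l * N))" .
  then have "N * s \<le> N * (j * k * l * N)" by (simp add: mult_ac)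
  then have "s \<le> j * k * l * N" by (rule mult_left_le_imp_le) (rule N)
  then show ?thesis by (simp add: s_def)
qed

text \<open>
  \<open>F\<close> is a maximal subset of \<open>B\<close> whose translates of \<open>A\<close> are disjoint; every further translate
  must meet one of them.
\<close>

lemma ruzsa_covering:
  fixes A B :: "'a::ab_group_add set"
  assumes fin: "finite A" "finite B" and ne: "A \<noteq> {}"
  obtains F where "finite F" "card F * card A \<le> card (A + B)" "B \<subseteq> F + (A + uminus ` A)"
proof -
  define P where "P = (\<lambda>F. F \<subseteq> B \<and> inj_on (\<lambda>(f, a). f + a) (F \<times> A))"
  have "P {}" by (simp add: P_def)
  moreover have "\<forall>F. P F \<longrightarrow> card F < Suc (card B)" using fin by (auto simp: P_def less_Suc_eq_le intro: card_mono)
  ultimately have "\<exists>F. P F \<and> (\<forall>G. P G \<longrightarrow> card G \<le> card F)"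
    by (rule ex_has_greatest_nat)
  then obtain F where F: "P F" and max: "\<And>G. P G \<Longrightarrow> card G \<le> card F"
    by auto
  have finF: "finite F" using F fin by (auto simp: P_def intro: finite_subset)
  have "card F * card A = card ((\<lambda>(f, a). f + a) ` (F \<times> A))"
    using F by (subst card_image) (auto simp: P_def card_cartesian_product)
  also have "\<dots> \<le> card (A + B)"
    using F fin by (intro card_mono) (auto simp: P_def add.commute[of _ "_::'a"], metis add.commute set_plus_intro subsetD)
  finally have 1: "card F * card A \<le> card (A + B)" .
  have "B \<subseteq> F + (A + uminus ` A)"
  proof
    fix b assume b: "b \<in> B"
    show "b \<in> F + (A + uminus ` A)"
    proof (rule ccontr)
      assume nb: "b \<notin> F + (A + uminus ` A)"
      have disj: "b + a \<noteq> f + a'" if "a \<in> A" "a' \<in> A" "f \<in> F" for a a' f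
      proof
        assume "b + a = f + a'"
        then have "b = f + (a' + - a)" by (simp add: algebra_simps eq_diff_eq)
        with that have "b \<in> F + (A + uminus ` A)" by (simp only:) (intro set_plus_intro imageI)
        with nb show False ..
      qed
      have bF: "b \<notin> F" using disj ne by blast
      have "P (insert b F)" unfolding P_def
      proof
        show "insert b F \<subseteq> B" using F b by (auto simp: P_def)
        show "inj_on (\<lambda>(f, a). f + a) (insert b F \<times> A)"
        proof (rule inj_onI; clarify)
          fix f a f' a' assume "f \<in> insert b F" "f' \<in> insert b F" and a: "a \<in> A" "a' \<in> A" and e: "f + a = f' + a'"
          then consider "f = b" "f' = b" | "f = b" "f' \<in> F" | "f' = b" "f \<in> F" | "f \<in> F" "f' \<in> F" by blast
          then show "f = f' \<and> a = a'"
          proof cases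
            case 4 then show ?thesis using F a e by (auto simp: P_def inj_on_def)
          next
            case 3 then show ?thesis using disj[OF a(2,1), of f] e by simp
          qed (use disj a e in auto)
        qed
      qed
      from max[OF this] bF finF show False by simp
    qed
  qed
  with 1 finF that show ?thesis by blast
qed

text \<open>
  Petridis' induction. The set \<open>X\<close> minimises the growth ratio \<open>|X + B| / |X|\<close> among its subsets;
  adding one element \<open>c\<close> to \<open>C\<close> enlarges \<open>X + B + C\<close> by at most \<open>|X + B| - |Y + B|\<close>, where \<open>Y\<close> consists of the
  \<open>x\<close> whose sums were present already, and minimality compares this with the growth of \<open>X + C\<close>.
\<close>

lemma petridis:
  fixes X B C :: "'a::ab_group_add set"
  assumes fin: "finite X" "finite B" "finite C"
    and min: "\<And>Y. Y \<subseteq> X \<Longrightarrow> card (X + B) * card Y \<le> card (Y + B) * card X"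
  shows "card (X + B + C) * card X \<le> card (X + B) * card (X + C)"
  using fin(3)
proof (induction C rule: finite_induct)
  case empty
  have "X + B + {} = {}" "X + {} = {}" by (auto simp: set_plus_def)
  then show ?case by (simp only: card.empty)
next
  case (insert c C)
  \<comment> \<open>the \<open>x\<close> for which \<open>x + B + c\<close> contributes nothing new to \<open>X + B + C\<close>\<close>
  define Y where "Y = {x \<in> X. \<forall>b\<in>B. x + b + c \<in> X + B + C}"
  define T where "T = (\<lambda>S::'a set. (\<lambda>s. s + c) ` S)"
  have cT: "card (T S) = card S" for S by (simp add: T_def card_image inj_on_def)
  have finT: "finite (T S)" if "finite S" for S using that by (simp add: T_def)
  have Y: "Y \<subseteq> X" by (auto simp: Y_def)
  have finY: "finite Y" using Y fin finite_subset by blast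
  have split: "S + insert c C = (S + C) \<union> T S" for S :: "'a set"
    by (auto simp: set_plus_def T_def)
  have TY: "T (Y + B) \<subseteq> X + B + C" by (auto simp: T_def Y_def set_plus_def)
  have TYs: "T (Y + B) \<subseteq> T (X + B)" using Y by (auto simp: T_def set_plus_def)
  have "X + B + insert c C \<subseteq> (X + B + C) \<union> (T (X + B) - T (Y + B))"
    unfolding split[of "X + B"] using TY by auto
  then have "card (X + B + insert c C) \<le> card ((X + B + C) \<union> (T (X + B) - T (Y + B)))"
    using fin insert by (intro card_mono) (auto intro!: finT)
  also have "\<dots> \<le> card (X + B + C) + card (T (X + B) - T (Y + B))" by (rule card_Un_le)
  also have "card (T (X + B) - T (Y + B)) = card (X + B) - card (Y + B)"
    using TYs fin finY by (subst card_Diff_subset) (auto intro!: finT simp: cT)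
  finally have 1: "card (X + B + insert c C) \<le> card (X + B + C) + (card (X + B) - card (Y + B))" .
  have YB: "card (Y + B) \<le> card (X + B)" using TYs fin cT by (metis card_mono finT finite_sumset)
  have "T X \<inter> (X + C) \<subseteq> T Y"
  proof
    fix w assume w: "w \<in> T X \<inter> (X + C)"
    then obtain x where x: "x \<in> X" "w = x + c" by (auto simp: T_def)
    obtain x' c' where x': "x' \<in> X" "c' \<in> C" "w = x' + c'" using w by (auto simp: set_plus_def)
    have "x + b + c \<in> X + B + C" if "b \<in> B" for b
    proof -
      have "x + b + c = x + c + b" by (simp add: ac_simps)
      also have "\<dots> = x' + c' + b" using x x' by simp
      also have "\<dots> = x' + b + c'" by (simp add: ac_simps)
      finally show ?thesis using x'(1,2) that by (simp only:) (intro set_plus_intro)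
    qed
    then have "x \<in> Y" using x(1) unfolding Y_def by simp
    then show "w \<in> T Y" using x(2) unfolding T_def by simp
  qed
  then have "card (T X \<inter> (X + C)) \<le> card Y" using cT[of Y] finT[OF finY] by (metis card_mono)
  moreover have "card (X + insert c C) + card (T X \<inter> (X + C)) = card (X + C) + card X"
    unfolding split using fin insert card_Un_Int[of "X + C" "T X"] finT[of X] cT[of X]
    by (simp add: Int_commute)
  ultimately have 2: "card (X + C) + card X \<le> card (X + insert c C) + card Y" by linarith
  have 3: "card (X + B) * card Y \<le> card (Y + B) * card X" by (rule min[OF Y])
  have "card (X + B + insert c C) * card X + card (Y + B) * card X
      \<le> card (X + B + C) * card X + card (X + B) * card X"
  proof -
    have "card (X + B + insert c C) + card (Y + B) \<le> card (X + B + C) + card (X + B)"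
      using 1 YB by linarith
    then have "(card (X + B + insert c C) + card (Y + B)) * card X \<le> (card (X + B + C) + card (X + B)) * card X"
      by (rule mult_right_mono) simp
    then show ?thesis by (simp add: algebra_simps)
  qed
  moreover have "card (X + B) * (card (X + C) + card X) \<le> card (X + B) * (card (X + insert c C) + card Y)"
    using 2 by (rule mult_left_mono) simp
  ultimately show ?case using insert.IH 3 by (simp add: algebra_simps)
qed

primrec nfold :: "nat \<Rightarrow> 'a::ab_group_add set \<Rightarrow> 'a set" where
  "nfold 0 A = {0}"
| "nfold (Suc n) A = A + nfold n A"

lemma finite_nfold [simp]: "finite A \<Longrightarrow> finite (nfold n A)"
  by (induction n) auto

lemma nfold_add: "nfold (m + n) A = nfold m A + nfold n A"
proof (induction m)
  case 0
  then show ?case by (simp add: set_plus_def)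
next
  case (Suc m)
  then show ?case by (simp add: add.assoc)
qed

lemma nfold_sumset: "nfold n (A + B) = nfold n A + nfold n B"
proof (induction n)
  case 0
  then show ?case by (simp add: set_plus_def)
next
  case (Suc n)
  then show ?case by (simp add: ac_simps)
qed

lemma nfold_uminus: "nfold n (uminus ` A) = uminus ` nfold n A"
  by (induction n) (auto simp: uminus_sumset)

lemma nfold_mono: "A \<subseteq> B \<Longrightarrow> nfold n A \<subseteq> nfold n B"
proof (induction n)
  case (Suc n)
  then show ?case unfolding nfold.simps by (intro set_plus_mono2) auto
qed simp

lemma card_nfold_le: "finite A \<Longrightarrow> card (nfold n A) \<le> card A ^ n"
proof (induction n)
  case (Suc n)
  have "card (A + nfold n A) \<le> card A * card (nfold n A)" using Suc by (intro card_sumset_le) auto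
  also have "\<dots> \<le> card A * card A ^ n" using Suc by (intro mult_left_mono) auto
  finally show ?case by simp
qed simp

lemma pluennecke_subset:
  fixes A B :: "'a::ab_group_add set"
  assumes fin: "finite A" "finite B" and ne: "A \<noteq> {}"
    and K: "real (card (A + B)) \<le> K * real (card A)"
  obtains X where "X \<subseteq> A" "X \<noteq> {}" "\<And>m. real (card (X + nfold m B)) \<le> K ^ m * real (card X)"
proof -
  have K0: "0 \<le> K"
  proof (rule ccontr)
    assume "\<not> 0 \<le> K"
    moreover have "0 < card A" using fin ne by (simp add: card_gt_0_iff)
    ultimately have "K * real (card A) < 0" by (simp add: mult_neg_pos)
    with K show False by linarith
  qed
  define r where "r = (\<lambda>Y::'a set. real (card (Y + B)) / real (card Y))"
  have "finite (Pow A - {{}})" "Pow A - {{}} \<noteq> {}" using fin ne by auto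
  then obtain X where X: "X \<in> Pow A - {{}}" and rX: "\<And>Y. Y \<in> Pow A - {{}} \<Longrightarrow> r X \<le> r Y"
    using arg_min_if_finite[of "Pow A - {{}}" r] by (metis linorder_not_less)
  have finX: "finite X" using X fin by (auto intro: finite_subset)
  have cX: "0 < card X" using X finX by (auto simp: card_gt_0_iff)
  have cA: "0 < card A" using fin ne by (simp add: card_gt_0_iff)
  have "r X \<le> r A" using rX ne by auto
  also have "\<dots> \<le> K" using K cA by (simp add: r_def divide_le_eq)
  finally have XK: "real (card (X + B)) \<le> K * real (card X)" using cX by (simp add: r_def divide_le_eq)
  have min: "card (X + B) * card Y \<le> card (Y + B) * card X" if "Y \<subseteq> X" for Y
  proof (cases "Y = {}")
    case False
    have "finite Y" using that finX finite_subset by blast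
    then have cY: "0 < card Y" using False by (simp add: card_gt_0_iff)
    have "r X \<le> r Y" using rX[of Y] that X False by auto
    then have "real (card (X + B)) * real (card Y) \<le> real (card (Y + B)) * real (card X)"
      using cX cY by (simp add: r_def field_simps)
    then show ?thesis by (metis of_nat_le_iff of_nat_mult)
  qed auto
  have "real (card (X + nfold m B)) \<le> K ^ m * real (card X)" for m
  proof (induction m)
    case 0
    then show ?case by (simp add: set_plus_def)
  next
    case (Suc m)
    have "card (X + B + nfold m B) * card X \<le> card (X + B) * card (X + nfold m B)"
      using fin finX by (intro petridis min) auto
    then have "real (card (X + nfold (Suc m) B)) * real (card X)
        \<le> real (card (X + B)) * real (card (X + nfold m B))"
      by (simp add: add.assoc flip: of_nat_mult)
    also have "\<dots> \<le> (K * real (card X)) * (K ^ m * real (card X))"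
      using XK Suc K0 by (intro mult_mono) auto
    finally show ?case using cX by simp
  qed
  with X that show ?thesis by blast
qed

text \<open>
  Iterating Petridis' inequality bounds \<open>|X + mB|\<close> for the minimising \<open>X\<close>; the triangle inequality through \<open>X\<close>
  then gives the mixed sums and differences.
\<close>

lemma pluennecke:
  fixes A B :: "'a::ab_group_add set"
  assumes fin: "finite A" "finite B" and ne: "A \<noteq> {}"
    and K: "real (card (A + B)) \<le> K * real (card A)"
  shows "real (card (nfold m B + uminus ` nfold n B)) \<le> K ^ (m + n) * real (card A)"
proof -
  obtain X where X: "X \<subseteq> A" "X \<noteq> {}" and P: "\<And>m. real (card (X + nfold m B)) \<le> K ^ m * real (card X)"
    using pluennecke_subset[OF fin ne K] by metis
  have finX: "finite X" using X fin finite_subset by blast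
  then have cX: "0 < card X" using X by (simp add: card_gt_0_iff)
  have K0: "0 \<le> K ^ m" for m
  proof -
    have "0 \<le> K ^ m * real (card X)" using P[of m] by (meson of_nat_0_le_iff order_trans)
    then show ?thesis using cX by (simp add: zero_le_mult_iff)
  qed
  have "card X * card (nfold m B + uminus ` nfold n B) \<le> card (nfold m B + X) * card (nfold n B + X)"
    using fin finX by (intro ruzsa_triangle) auto
  then have "real (card X) * real (card (nfold m B + uminus ` nfold n B))
      \<le> real (card (X + nfold m B)) * real (card (X + nfold n B))"
    by (simp add: add.commute flip: of_nat_mult)
  also have "\<dots> \<le> (K ^ m * real (card X)) * (K ^ n * real (card X))"
    using P K0 by (intro mult_mono) auto
  finally have "real (card (nfold m B + uminus ` nfold n B)) \<le> K ^ (m + n) * real (card X)"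
    using cX by (simp add: power_add field_simps)
  also have "\<dots> \<le> K ^ (m + n) * real (card A)"
    using K0 X fin by (intro mult_left_mono) (auto intro: card_mono)
  finally show ?thesis .
qed

section \<open>Small sumsets from dense graphs\<close>

text \<open>
  The graph form. If the sums along a dense bipartite graph \<open>G\<close> lie in a small set \<open>S\<close>, then large
  parts \<open>A'\<close>, \<open>B'\<close> have a small full sumset: every pair in \<open>A' \<times> B'\<close> is joined by many paths of length three,
  and each path writes the sum as an alternating sum of three elements of \<open>S\<close>.
\<close>

lemma balog_szemeredi_gowers:
  fixes A B S :: "'a::ab_group_add set" and K :: real
  assumes fin: "finite A" "finite B" "finite S" and ne: "A \<noteq> {}" "B \<noteq> {}" and K: "1 \<le> K"
    and G: "G \<subseteq> A \<times> B" "real (card A) * real (card B) \<le> K * real (card G)"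
    and S: "\<And>a b. (a, b) \<in> G \<Longrightarrow> a + b \<in> S"
  obtains A' B' where "A' \<subseteq> A" "B' \<subseteq> B" "real (card A) \<le> 6 * K * real (card A')"
    "real (card B) \<le> 4 * K * real (card B')"
    "real (card (A' + B')) * (real (card A) * real (card B)) \<le> 3072 * K ^ 5 * real (card S) ^ 3"
proof -
  define \<alpha> \<beta> where "\<alpha> = real (card A)" and "\<beta> = real (card B)"
  have pos: "0 < \<alpha>" "0 < \<beta>" using fin ne by (auto simp: \<alpha>_def \<beta>_def card_gt_0_iff)
  define \<epsilon> \<delta> where "\<epsilon> = 1 / (16 * K)" and "\<delta> = 1 / (128 * K ^ 3)"
  have \<epsilon>\<delta>: "0 < \<epsilon>" "0 < \<delta>" "\<delta> / \<epsilon> = 1 / (8 * K\<^sup>2)"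
    using K by (auto simp: \<epsilon>_def \<delta>_def field_simps power3_eq_cube power2_eq_square)
  define deg where "deg = (\<lambda>a. real (card {b \<in> B. (a, b) \<in> G}))"
  \<comment> \<open>Vertices of small degree carry at most half of the edges, so they may be discarded.\<close>
  define A1 where "A1 = {a \<in> A. \<beta> / (2 * K) \<le> deg a}"
  define N where "N = (\<lambda>b. {a \<in> A1. (a, b) \<in> G})"
  define codeg where "codeg = (\<lambda>a a'. real (card {b \<in> B. (a, b) \<in> G \<and> (a', b) \<in> G}))"
  define Bad where "Bad = {(a, a') \<in> A1 \<times> A1. codeg a a' < \<delta> * \<beta>}"
  define bad where "bad = (\<lambda>b. real (card {q \<in> Bad. fst q \<in> N b \<and> snd q \<in> N b}))"
  have A1: "A1 \<subseteq> A" "finite A1" using fin by (auto simp: A1_def)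
  have finN: "finite (N b)" for b using A1 by (simp add: N_def)
  have Bad: "Bad \<subseteq> A1 \<times> A1" by (auto simp: Bad_def)
  have finBad: "finite Bad" using A1 Bad finite_subset by blast
  have "(\<Sum>a\<in>A. deg a) = real (card G)" unfolding deg_def using card_eq_sum_fibres[OF G(1) fin(1,2)] by simp
  also have "\<dots> \<ge> \<alpha> * \<beta> / K" using G(2) K by (simp add: \<alpha>_def \<beta>_def field_simps)
  finally have degA: "\<alpha> * \<beta> / K \<le> (\<Sum>a\<in>A. deg a)" .
  have "(\<Sum>a\<in>A - A1. deg a) \<le> (\<Sum>a\<in>A - A1. \<beta> / (2 * K))"
    by (intro sum_mono) (auto simp: A1_def)
  also have "\<dots> \<le> \<alpha> * (\<beta> / (2 * K))"
    using fin pos K by (simp add: \<alpha>_def, intro divide_right_mono mult_right_mono) (auto intro: card_mono)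
  finally have "(\<Sum>a\<in>A - A1. deg a) \<le> \<alpha> * \<beta> / (2 * K)" by simp
  moreover have "(\<Sum>a\<in>A. deg a) = (\<Sum>a\<in>A - A1. deg a) + (\<Sum>a\<in>A1. deg a)"
    using A1 fin by (intro sum.subset_diff) auto
  moreover have "\<alpha> * \<beta> / K = \<alpha> * \<beta> / (2 * K) + \<alpha> * \<beta> / (2 * K)" using K by (simp add: field_simps)
  ultimately have degA1: "\<alpha> * \<beta> / (2 * K) \<le> (\<Sum>a\<in>A1. deg a)" using degA by linarith
  have sumN: "(\<Sum>b\<in>B. real (card (N b))) = (\<Sum>a\<in>A1. deg a)"
    unfolding N_def deg_def using double_count[OF fin(2) A1(2), of "\<lambda>b a. (a, b) \<in> G"] .
  have "(\<alpha> * \<beta> / (2 * K))\<^sup>2 \<le> (\<Sum>b\<in>B. real (card (N b)))\<^sup>2"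
    using degA1 pos K unfolding sumN by (intro power_mono) auto
  also have "\<dots> \<le> \<beta> * (\<Sum>b\<in>B. (real (card (N b)))\<^sup>2)" unfolding \<beta>_def by (rule sum_power2_le)
  finally have "\<beta> * (\<alpha>\<^sup>2 * \<beta> / (4 * K\<^sup>2)) \<le> \<beta> * (\<Sum>b\<in>B. (real (card (N b)))\<^sup>2)"
    by (simp add: power_divide power_mult_distrib power2_eq_square mult_ac)
  then have N2: "\<alpha>\<^sup>2 * \<beta> / (4 * K\<^sup>2) \<le> (\<Sum>b\<in>B. (real (card (N b)))\<^sup>2)"
    by (rule mult_left_le_imp_le) (rule pos(2))
  have "(\<Sum>b\<in>B. bad b) = (\<Sum>q\<in>Bad. real (card {b \<in> B. fst q \<in> N b \<and> snd q \<in> N b}))"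
    unfolding bad_def using double_count[OF fin(2) finBad, of "\<lambda>b q. fst q \<in> N b \<and> snd q \<in> N b"] .
  also have "\<dots> = (\<Sum>q\<in>Bad. codeg (fst q) (snd q))"
    unfolding codeg_def N_def using Bad by (intro sum.cong arg_cong[where f="\<lambda>X. real (card X)"]) auto
  also have "\<dots> \<le> (\<Sum>q\<in>Bad. \<delta> * \<beta>)" by (intro sum_mono) (auto simp: Bad_def)
  also have "\<dots> \<le> \<alpha>\<^sup>2 * (\<delta> * \<beta>)"
  proof -
    have "card Bad \<le> card (A \<times> A)" using Bad A1 fin by (intro card_mono) auto
    then have "real (card Bad) \<le> \<alpha>\<^sup>2"
      by (simp add: card_cartesian_product \<alpha>_def power2_eq_square flip: of_nat_mult)
    then show ?thesis using pos \<epsilon>\<delta> by (simp add: mult_right_mono)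
  qed
  finally have sumbad: "(\<Sum>b\<in>B. bad b) \<le> \<alpha>\<^sup>2 * (\<delta> * \<beta>)" .
  \<comment> \<open>Dependent random choice by averaging: some neighbourhood \<open>N b0\<close> is large, and only a
    proportion \<open>\<epsilon>\<close> of the pairs in it have few common neighbours.\<close>
  have "(\<Sum>b\<in>B. \<alpha>\<^sup>2 / (8 * K\<^sup>2) + bad b / \<epsilon>) \<le> (\<Sum>b\<in>B. (real (card (N b)))\<^sup>2)"
  proof -
    have "(\<Sum>b\<in>B. \<alpha>\<^sup>2 / (8 * K\<^sup>2) + bad b / \<epsilon>) = \<beta> * (\<alpha>\<^sup>2 / (8 * K\<^sup>2)) + (\<Sum>b\<in>B. bad b) / \<epsilon>"
      by (simp add: sum.distrib \<beta>_def flip: sum_divide_distrib)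
    also have "\<dots> \<le> \<beta> * (\<alpha>\<^sup>2 / (8 * K\<^sup>2)) + \<alpha>\<^sup>2 * (\<delta> * \<beta>) / \<epsilon>"
      using sumbad \<epsilon>\<delta> by (intro add_left_mono divide_right_mono) auto
    also have "\<alpha>\<^sup>2 * (\<delta> * \<beta>) / \<epsilon> = \<alpha>\<^sup>2 * \<beta> * (\<delta> / \<epsilon>)" by simp
    also have "\<beta> * (\<alpha>\<^sup>2 / (8 * K\<^sup>2)) + \<alpha>\<^sup>2 * \<beta> * (\<delta> / \<epsilon>) = \<alpha>\<^sup>2 * \<beta> / (4 * K\<^sup>2)"
      unfolding \<epsilon>\<delta>(3) using K by (simp add: field_simps)
    finally show ?thesis using N2 by linarith
  qed
  then obtain b0 where b0: "b0 \<in> B" "\<alpha>\<^sup>2 / (8 * K\<^sup>2) + bad b0 / \<epsilon> \<le> (real (card (N b0)))\<^sup>2"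
    using ex_ge_average[OF fin(2) ne(2)] by blast
  define A2 where "A2 = N b0"
  define n where "n = real (card A2)"
  have A2: "A2 \<subseteq> A1" "finite A2" using finN by (auto simp: A2_def N_def)
  have n2: "\<alpha>\<^sup>2 / (8 * K\<^sup>2) + bad b0 / \<epsilon> \<le> n\<^sup>2" using b0 by (simp add: n_def A2_def)
  have bad0: "0 \<le> bad b0 / \<epsilon>" "0 \<le> \<alpha>\<^sup>2 / (8 * K\<^sup>2)" using \<epsilon>\<delta> by (auto simp: bad_def)
  have "(\<alpha> / (3 * K))\<^sup>2 \<le> n\<^sup>2"
  proof -
    have "(\<alpha> / (3 * K))\<^sup>2 \<le> \<alpha>\<^sup>2 / (8 * K\<^sup>2)"
      using K by (simp add: power_divide power_mult_distrib field_simps)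
    then show ?thesis using n2 bad0 by linarith
  qed
  then have n: "\<alpha> / (3 * K) \<le> n" by (rule power2_le_imp_le) (simp add: n_def)
  have npos: "0 < n" using n pos K by (smt (verit) divide_pos_pos)
  have "bad b0 / \<epsilon> \<le> n\<^sup>2" using n2 bad0(2) by linarith
  then have badle: "bad b0 \<le> \<epsilon> * n\<^sup>2" using \<epsilon>\<delta>(1) by (simp add: divide_le_eq mult.commute)
  define nb where "nb = (\<lambda>a. real (card {a' \<in> A2. (a, a') \<in> Bad}))"
  have "bad b0 = (\<Sum>a\<in>A2. real (card {a' \<in> A2. (a, a') \<in> {q \<in> Bad. fst q \<in> N b0 \<and> snd q \<in> N b0}}))"
    unfolding bad_def by (intro card_eq_sum_fibres) (auto simp: A2_def finN)
  also have "\<dots> = (\<Sum>a\<in>A2. nb a)"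
    unfolding nb_def A2_def by (intro sum.cong arg_cong[where f="\<lambda>X. real (card X)"]) auto
  finally have badsum: "bad b0 = (\<Sum>a\<in>A2. nb a)" .
  define A3 where "A3 = {a \<in> A2. nb a \<le> 2 * \<epsilon> * n}"
  have A3: "A3 \<subseteq> A2" "finite A3" using A2 by (auto simp: A3_def)
  have "real (card (A2 - A3)) * (2 * \<epsilon> * n) = (\<Sum>a\<in>A2 - A3. 2 * \<epsilon> * n)" by simp
  also have "\<dots> \<le> (\<Sum>a\<in>A2 - A3. nb a)" by (intro sum_mono) (auto simp: A3_def)
  also have "\<dots> \<le> (\<Sum>a\<in>A2. nb a)" using A2 by (intro sum_mono2) (auto simp: nb_def)
  also have "\<dots> \<le> \<epsilon> * n\<^sup>2" using badle badsum by simp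
  finally have "(2 * \<epsilon> * n) * real (card (A2 - A3)) \<le> (2 * \<epsilon> * n) * (n / 2)"
    by (simp add: power2_eq_square mult_ac)
  then have "real (card (A2 - A3)) \<le> n / 2" using \<epsilon>\<delta> npos by (subst (asm) mult_le_cancel_left_pos) auto
  moreover have "real (card (A2 - A3)) = n - real (card A3)"
    unfolding n_def using A3 A2 by (simp add: card_Diff_subset card_mono of_nat_diff)
  ultimately have cA3: "n / 2 \<le> real (card A3)" by linarith
  define dg where "dg = (\<lambda>b. real (card {a \<in> A2. (a, b) \<in> G}))"
  define B' where "B' = {b \<in> B. n / (4 * K) \<le> dg b}"
  have B': "B' \<subseteq> B" "finite B'" using fin by (auto simp: B'_def)
  have "n * (\<beta> / (2 * K)) = (\<Sum>a\<in>A2. \<beta> / (2 * K))" by (simp add: n_def)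
  also have "\<dots> \<le> (\<Sum>a\<in>A2. deg a)" using A2 by (intro sum_mono) (auto simp: A1_def)
  also have "\<dots> = (\<Sum>b\<in>B. dg b)"
    unfolding deg_def dg_def using double_count[OF A2(2) fin(2), of "\<lambda>a b. (a, b) \<in> G"] .
  also have "\<dots> = (\<Sum>b\<in>B - B'. dg b) + (\<Sum>b\<in>B'. dg b)"
    using B' fin by (intro sum.subset_diff) auto
  also have "(\<Sum>b\<in>B'. dg b) \<le> (\<Sum>b\<in>B'. n)"
    using A2 by (intro sum_mono) (auto simp: dg_def n_def intro!: card_mono)
  also have "(\<Sum>b\<in>B - B'. dg b) \<le> (\<Sum>b\<in>B - B'. n / (4 * K))" by (intro sum_mono) (auto simp: B'_def)
  also have "\<dots> \<le> \<beta> * (n / (4 * K))"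
    using fin npos K by (simp add: \<beta>_def, intro divide_right_mono mult_right_mono) (auto intro: card_mono)
  finally have "n * (\<beta> / (4 * K)) \<le> n * real (card B')" using K by (simp add: field_simps)
  then have cB': "\<beta> / (4 * K) \<le> real (card B')" by (rule mult_left_le_imp_le) (rule npos)
  define c where "c = \<alpha> * \<beta> / (3072 * K ^ 5)"
  define Paths where "Paths = (\<lambda>a b. SIGMA a':{a' \<in> A2. (a', b) \<in> G \<and> (a, a') \<notin> Bad}. {b' \<in> B. (a, b') \<in> G \<and> (a', b') \<in> G})"
  \<comment> \<open>A path \<open>a - b' - a' - b\<close> in the graph writes \<open>a + b\<close> as \<open>(a + b') - (a' + b') + (a' + b)\<close>.\<close>
  have paths: "c \<le> real (card (Paths a b))" if a: "a \<in> A3" and b: "b \<in> B'" for a b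
  proof -
    define P where "P = {a' \<in> A2. (a', b) \<in> G \<and> (a, a') \<notin> Bad}"
    have finP: "finite P" using A2 by (simp add: P_def)
    have "{a' \<in> A2. (a', b) \<in> G} \<subseteq> P \<union> {a' \<in> A2. (a, a') \<in> Bad}" by (auto simp: P_def)
    then have "card {a' \<in> A2. (a', b) \<in> G} \<le> card (P \<union> {a' \<in> A2. (a, a') \<in> Bad})"
      using finP A2 by (intro card_mono) auto
    also have "\<dots> \<le> card P + card {a' \<in> A2. (a, a') \<in> Bad}" by (rule card_Un_le)
    finally have "dg b \<le> real (card P) + nb a" unfolding dg_def nb_def by linarith
    moreover have "n / (4 * K) \<le> dg b" using b by (simp add: B'_def)
    moreover have "nb a \<le> n / (8 * K)" using a K by (simp add: A3_def \<epsilon>_def)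
    moreover have "n / (4 * K) = n / (8 * K) + n / (8 * K)" using K by (simp add: field_simps)
    ultimately have cP: "n / (8 * K) \<le> real (card P)" by linarith
    have "c = \<alpha> / (3 * K) / (8 * K) * (\<delta> * \<beta>)"
      using K by (simp add: c_def \<delta>_def field_simps eval_nat_numeral)
    also have "\<dots> \<le> real (card P) * (\<delta> * \<beta>)"
    proof (rule mult_right_mono)
      have "\<alpha> / (3 * K) / (8 * K) \<le> n / (8 * K)" using n K by (intro divide_right_mono) auto
      then show "\<alpha> / (3 * K) / (8 * K) \<le> real (card P)" using cP by linarith
    qed (use \<epsilon>\<delta> pos in simp)
    also have "\<dots> = (\<Sum>a'\<in>P. \<delta> * \<beta>)" by simp
    also have "\<dots> \<le> (\<Sum>a'\<in>P. codeg a a')"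
      using a A3 A2 by (intro sum_mono) (auto simp: P_def Bad_def not_less)
    also have "\<dots> = real (card (Paths a b))"
      unfolding Paths_def P_def[symmetric] codeg_def using finP fin by (subst card_SigmaI) auto
    finally show ?thesis .
  qed
  have "\<forall>d\<in>A3 + B'. \<exists>q. fst q \<in> A3 \<and> snd q \<in> B' \<and> d = fst q + snd q"
    by (force simp: set_plus_def)
  then obtain q where q: "\<And>d. d \<in> A3 + B' \<Longrightarrow> fst (q d) \<in> A3 \<and> snd (q d) \<in> B' \<and> d = fst (q d) + snd (q d)"
    by metis
  define W where "W = (SIGMA d:A3 + B'. Paths (fst (q d)) (snd (q d)))"
  define f where "f = (\<lambda>(d, a', b'). (fst (q d) + b', a' + b', a' + snd (q d)))"
  \<comment> \<open>the three sums along a path recover the path, given the chosen representation \<open>q d\<close> of \<open>d\<close>\<close>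
  have "inj_on f W"
  proof (rule inj_onI)
    fix w w' assume W: "w \<in> W" "w' \<in> W" "f w = f w'"
    obtain d a b where w: "w = (d, a, b)" by (cases w)
    obtain d' a' b' where w': "w' = (d', a', b')" by (cases w')
    have 1: "(d, a, b) \<in> W" and 2: "(d', a', b') \<in> W" and eq: "f (d, a, b) = f (d', a', b')"
      using W w w' by auto
    have d: "d = fst (q d) + snd (q d)" "d' = fst (q d') + snd (q d')" using 1 2 q by (auto simp: W_def)
    have e: "fst (q d) + b = fst (q d') + b'" "a + b = a' + b'" "a + snd (q d) = a' + snd (q d')"
      using eq by (auto simp: f_def)
    have "d = (fst (q d) + b) - (a + b) + (a + snd (q d))" using d(1) by simp
    also have "\<dots> = (fst (q d') + b') - (a' + b') + (a' + snd (q d'))" using e by simp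
    also have "\<dots> = d'" using d(2) by simp
    finally have "d = d'" .
    then show "w = w'" using e w w' by simp
  qed
  moreover have "f ` W \<subseteq> S \<times> S \<times> S"
  proof
    fix s assume "s \<in> f ` W"
    then obtain d a b where w: "(d, a, b) \<in> W" "s = f (d, a, b)" by force
    have "(fst (q d), b) \<in> G" "(a, b) \<in> G" "(a, snd (q d)) \<in> G" using w(1) by (auto simp: W_def Paths_def)
    then show "s \<in> S \<times> S \<times> S" using w(2) S by (auto simp: f_def)
  qed
  ultimately have "card W \<le> card (S \<times> S \<times> S)" using fin by (intro card_inj_on_le[of f]) auto
  then have cW: "real (card W) \<le> real (card S) ^ 3"
    by (simp add: card_cartesian_product power3_eq_cube flip: of_nat_mult)
  have finPaths: "finite (Paths a b)" for a b using A2 fin by (auto simp: Paths_def)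
  have "real (card (A3 + B')) * c = (\<Sum>d\<in>A3 + B'. c)" by simp
  also have "\<dots> \<le> (\<Sum>d\<in>A3 + B'. real (card (Paths (fst (q d)) (snd (q d)))))"
    using q by (intro sum_mono paths) auto
  also have "\<dots> = real (card W)"
    unfolding W_def using A3 B' finPaths by (subst card_SigmaI) auto
  also note cW
  finally have "real (card (A3 + B')) * (\<alpha> * \<beta>) \<le> 3072 * K ^ 5 * real (card S) ^ 3"
    using K by (simp add: c_def field_simps)
  moreover have "\<alpha> \<le> 6 * K * real (card A3)"
  proof -
    have "\<alpha> \<le> 3 * K * n" using n K by (simp add: divide_le_eq mult_ac)
    also have "\<dots> \<le> 3 * K * (2 * real (card A3))" using cA3 K by (intro mult_left_mono) auto
    finally show ?thesis by simp
  qed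
  moreover have "\<beta> \<le> 4 * K * real (card B')" using cB' K by (simp add: divide_le_eq mult_ac)
  ultimately show ?thesis using A3 A2 A1 B' by (intro that[of A3 B']) (auto simp: \<alpha>_def \<beta>_def)
qed

section \<open>Residues inside the circle group\<close>

lemma residues_eqI:
  assumes "int p dvd a - b" "a \<in> {0..<int p}" "b \<in> {0..<int p}"
  shows "a = b"
  using assms by (metis atLeastLessThan_iff mod_eq_dvd_iff mod_pos_pos_trivial)

lemma prime_dvd_multD_int:
  "prime p \<Longrightarrow> int p dvd a * b \<Longrightarrow> \<not> int p dvd a \<Longrightarrow> int p dvd b"
  by (metis prime_dvd_mult_iff prime_nat_int_transfer)

lemma odd_prime_not_dvd_2: "prime p \<Longrightarrow> p \<noteq> 2 \<Longrightarrow> \<not> int p dvd 2"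
  by (metis int_dvd_int_iff of_nat_numeral primes_dvd_imp_eq two_is_prime_nat)

lemma solve_linear_congruence:
  assumes "prime p" "\<not> int p dvd a"
  obtains x where "x \<in> {0..<int p}" "int p dvd a * x - b"
proof -
  have "coprime a (int p)" using assms by (metis coprime_commute prime_imp_coprime prime_int_nat_transfer prime_nat_int_transfer)
  then obtain y where "[a * y = 1] (mod int p)" using cong_solve_coprime_int by blast
  then have "int p dvd a * y - 1" by (simp add: cong_iff_dvd_diff)
  then have 1: "int p dvd (a * y - 1) * b" by (rule dvd_mult2)
  have "int p dvd a * (y * b - (y * b) mod int p)" by (intro dvd_mult dvd_minus_mod)
  then have "int p dvd (a * y - 1) * b - a * (y * b - (y * b) mod int p)" using 1 by (rule dvd_diff[rotated])
  then have "int p dvd a * ((y * b) mod int p) - b" by (simp add: algebra_simps)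
  moreover have "(y * b) mod int p \<in> {0..<int p}" using assms(1) prime_gt_0_nat by simp
  ultimately show ?thesis using that by blast
qed

text \<open>
  The group \<open>\<rat>/\<int>\<close>. It contains a copy of \<open>\<int>/p\<close> for every \<open>p\<close>, so that sumsets modulo a varying prime
  live in one type of class \<^class>\<open>ab_group_add\<close>.
\<close>

quotient_type circle = rat / "\<lambda>x y. x - y \<in> \<int>"
proof (rule equivpI)
  show "reflp (\<lambda>x y :: rat. x - y \<in> \<int>)" by (simp add: reflp_def)
  show "symp (\<lambda>x y :: rat. x - y \<in> \<int>)" by (metis (mono_tags) Ints_minus minus_diff_eq sympI)
  show "transp (\<lambda>x y :: rat. x - y \<in> \<int>)"
  proof (rule transpI)
    fix x y z :: rat assume "x - y \<in> \<int>" "y - z \<in> \<int>"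
    then have "(x - y) + (y - z) \<in> \<int>" by (rule Ints_add)
    then show "x - z \<in> \<int>" by simp
  qed
qed

instantiation circle :: ab_group_add
begin

lift_definition zero_circle :: circle is 0 .

lift_definition plus_circle :: "circle \<Rightarrow> circle \<Rightarrow> circle" is "(+)"
  by (metis Ints_add add_diff_add)

lift_definition uminus_circle :: "circle \<Rightarrow> circle" is uminus
  by (metis Ints_minus minus_diff_minus)

lift_definition minus_circle :: "circle \<Rightarrow> circle \<Rightarrow> circle" is "(-)"
  by (metis Ints_diff diff_diff_eq2 diff_add_eq add_diff_eq diff_right_commute add.commute)

instance
  by standard (transfer; simp)+

end

lift_definition smul :: "int \<Rightarrow> circle \<Rightarrow> circle" is "\<lambda>n x. of_int n * x"
  by (metis Ints_mult Ints_of_int right_diff_distrib)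

text \<open>
  The homomorphism \<open>a \<mapsto> a/p\<close> with kernel \<open>p\<int>\<close>; its range is the copy of \<open>\<int>/p\<close>.
\<close>

lift_definition circ :: "nat \<Rightarrow> int \<Rightarrow> circle" is "\<lambda>p a. of_int a / of_nat p" .

lemma smul_add: "smul n (x + y) = smul n x + smul n y"
  by transfer (simp add: algebra_simps)

lemma smul_uminus: "smul n (- x) = - smul n x"
  by transfer simp

lemma smul_add_left: "smul (m + n) x = smul m x + smul n x"
  by transfer (simp add: algebra_simps)

lemma smul_uminus_left: "smul (- n) x = - smul n x"
  by transfer simp

lemma smul_smul: "smul m (smul n x) = smul (m * n) x"
  by transfer (simp add: algebra_simps)

lemma smul_0: "smul n 0 = 0"
  by transfer simp

lemma smul_circ: "smul n (circ p a) = circ p (n * a)"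
  by transfer (simp add: algebra_simps)

lemma circ_add: "circ p (a + b) = circ p a + circ p b"
  by transfer (simp add: add_divide_distrib)

lemma circ_diff: "circ p (a - b) = circ p a - circ p b"
  by transfer (simp add: diff_divide_distrib)

lemma circ_eq_iff:
  assumes "0 < p"
  shows "circ p a = circ p b \<longleftrightarrow> int p dvd a - b"
proof -
  have "(of_int a / of_nat p - of_int b / of_nat p :: rat) \<in> \<int> \<longleftrightarrow> int p dvd a - b"
  proof
    assume "(of_int a / of_nat p - of_int b / of_nat p :: rat) \<in> \<int>"
    then obtain k where "(of_int a / of_nat p - of_int b / of_nat p :: rat) = of_int k" by (auto elim: Ints_cases)
    then have "(of_int (a - b) :: rat) = of_int (int p * k)"
      using assms by (simp add: field_simps)
    then have "a - b = int p * k" by (simp only: of_int_eq_iff)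
    then show "int p dvd a - b" by simp
  next
    assume "int p dvd a - b"
    then obtain k where "a - b = int p * k" by auto
    then have "(of_int (a - b) :: rat) = of_int (int p * k)" by simp
    then have "(of_int a / of_nat p - of_int b / of_nat p :: rat) = of_int k"
      using assms by (simp add: field_simps)
    then show "(of_int a / of_nat p - of_int b / of_nat p :: rat) \<in> \<int>" by simp
  qed
  then show ?thesis by transfer
qed

lemma smul_cong:
  assumes "0 < p" "int p dvd m - n" "x \<in> range (circ p)"
  shows "smul m x = smul n x"
proof -
  obtain a where a: "x = circ p a" using assms by auto
  have "int p dvd m * a - n * a" using assms(2) by (simp add: dvd_mult2 flip: left_diff_distrib)
  then show ?thesis using circ_eq_iff[OF assms(1)] by (simp add: a smul_circ)
qed

lemma inj_on_smul:
  assumes "prime p" "\<not> int p dvd n"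
  shows "inj_on (smul n) (range (circ p))"
proof (rule inj_onI; clarify)
  fix a b assume "smul n (circ p a) = smul n (circ p b)"
  then have "int p dvd n * a - n * b"
    using circ_eq_iff[of p] assms prime_gt_0_nat by (simp add: smul_circ)
  then have "int p dvd n * (a - b)" by (simp add: right_diff_distrib)
  then have "int p dvd a - b" using assms by (metis prime_dvd_mult_iff prime_int_nat_transfer prime_nat_int_transfer)
  then show "circ p a = circ p b" using circ_eq_iff assms prime_gt_0_nat by blast
qed

lemma card_smul:
  assumes "prime p" "\<not> int p dvd n" "X \<subseteq> range (circ p)"
  shows "card (smul n ` X) = card X"
  using card_image[OF inj_on_subset[OF inj_on_smul[OF assms(1,2)] assms(3)]] .

lemma range_circ_add: "x \<in> range (circ p) \<Longrightarrow> y \<in> range (circ p) \<Longrightarrow> x + y \<in> range (circ p)"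
  by (auto simp: circ_add[symmetric])

lemma range_circ_diff: "x \<in> range (circ p) \<Longrightarrow> y \<in> range (circ p) \<Longrightarrow> x - y \<in> range (circ p)"
  by (auto simp: circ_diff[symmetric])

lemma range_circ_smul: "x \<in> range (circ p) \<Longrightarrow> smul n x \<in> range (circ p)"
  by (auto simp: smul_circ)

lemma smul_sumset: "smul n ` (A + B) = smul n ` A + smul n ` B"
proof (intro Set.set_eqI iffI)
  fix x assume "x \<in> smul n ` (A + B)"
  then obtain a b where ab: "a \<in> A" "b \<in> B" "x = smul n (a + b)" by (auto elim!: set_plus_elim)
  then show "x \<in> smul n ` A + smul n ` B" by (simp only: smul_add) (intro set_plus_intro imageI)
next
  fix x assume "x \<in> smul n ` A + smul n ` B"
  then obtain a b where ab: "a \<in> A" "b \<in> B" "x = smul n a + smul n b" by (auto elim!: set_plus_elim)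
  then show "x \<in> smul n ` (A + B)" by (simp only: smul_add[symmetric]) (intro set_plus_intro imageI)
qed

lemma smul_nfold: "smul n ` nfold m A = nfold m (smul n ` A)"
  by (induction m) (auto simp: smul_sumset smul_0)

lemma smul_uminus_image: "smul n ` uminus ` A = uminus ` smul n ` A"
  by (simp add: image_image smul_uminus)

section \<open>The sum-product phenomenon for dilates\<close>

text \<open>
  \<open>S\<close> lies in at most \<open>k\<close> translates of \<open>m(B - B)\<close>. For \<open>B\<close> of small doubling this is preserved by sums,
  negatives and by dilations that are themselves covered, with polynomial loss in \<open>k\<close>; this makes the set of
  such dilations behave like a ring.
\<close>

definition covered :: "'a::ab_group_add set \<Rightarrow> real \<Rightarrow> nat \<Rightarrow> 'a set \<Rightarrow> bool" where
  "covered B k m S \<longleftrightarrow> (\<exists>F. finite F \<and> real (card F) \<le> k \<and> S \<subseteq> F + nfold m (B + uminus ` B))"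

lemma covered_nonneg: "covered B k m S \<Longrightarrow> 0 \<le> k"
  unfolding covered_def by (meson of_nat_0_le_iff order_trans)

lemma covered_sumset:
  assumes "covered B k m S" "covered B k' m' S'"
  shows "covered B (k * k') (m + m') (S + S')"
proof -
  have k: "0 \<le> k" using assms covered_nonneg by blast
  obtain F F' where F: "finite F" "real (card F) \<le> k" "S \<subseteq> F + nfold m (B + uminus ` B)"
    and F': "finite F'" "real (card F') \<le> k'" "S' \<subseteq> F' + nfold m' (B + uminus ` B)"
    using assms by (auto simp: covered_def)
  have "S + S' \<subseteq> (F + nfold m (B + uminus ` B)) + (F' + nfold m' (B + uminus ` B))"
    using F F' by (intro set_plus_mono2)
  also have "\<dots> = (F + F') + nfold (m + m') (B + uminus ` B)" by (simp add: nfold_add ac_simps)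
  finally have 1: "S + S' \<subseteq> (F + F') + nfold (m + m') (B + uminus ` B)" .
  have "real (card (F + F')) \<le> real (card F * card F')"
    using card_sumset_le[OF F(1) F'(1)] by (simp only: of_nat_le_iff)
  also have "\<dots> \<le> k * k'" using F F' k by (simp add: mult_mono)
  finally show ?thesis using 1 F F' unfolding covered_def by (intro exI[of _ "F + F'"]) simp
qed

lemma covered_uminus:
  assumes "covered B k m S"
  shows "covered B k m (uminus ` S)"
proof -
  obtain F where F: "finite F" "real (card F) \<le> k" "S \<subseteq> F + nfold m (B + uminus ` B)"
    using assms by (auto simp: covered_def)
  have "uminus ` S \<subseteq> uminus ` (F + nfold m (B + uminus ` B))" using F by (intro image_mono)
  also have "\<dots> = uminus ` F + nfold m (B + uminus ` B)"
    by (simp only: uminus_sumset nfold_uminus[symmetric] uminus_difference_set[unfolded uminus_sumset])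
  finally show ?thesis using F unfolding covered_def by (intro exI[of _ "uminus ` F"]) simp
qed

lemma covered_mono: "S' \<subseteq> S \<Longrightarrow> covered B k m S \<Longrightarrow> covered B k m S'"
  unfolding covered_def by (meson order_trans)

text \<open>
  Dilating the cover of \<open>S\<close> gives translates of \<open>m(\<xi>B - \<xi>B)\<close>, and each copy of \<open>\<xi>B\<close> is covered by
  translates of \<open>B - B\<close>.
\<close>

lemma covered_smul:
  assumes "covered B k m S" "covered B k' 1 (smul \<xi> ` B)"
  shows "covered B (k * k' ^ (2 * m)) (2 * m) (smul \<xi> ` S)"
proof -
  have k: "0 \<le> k" using assms covered_nonneg by blast
  define D where "D = B + uminus ` B"
  obtain F where F: "finite F" "real (card F) \<le> k" "S \<subseteq> F + nfold m D"
    using assms by (auto simp: covered_def D_def)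
  have "covered B (k' * k') (1 + 1) (smul \<xi> ` B + uminus ` smul \<xi> ` B)"
    using assms(2) by (intro covered_sumset covered_uminus)
  then obtain F' where F': "finite F'" "real (card F') \<le> k' * k'" "smul \<xi> ` D \<subseteq> F' + nfold 2 D"
    by (auto simp: covered_def D_def smul_sumset smul_uminus_image numeral_2_eq_2)
  have "nfold m (nfold 2 D) = nfold (2 * m) D"
    by (induction m) (simp_all add: nfold_add numeral_2_eq_2 ac_simps)
  note nn = this
  have "smul \<xi> ` S \<subseteq> smul \<xi> ` (F + nfold m D)" using F by (intro image_mono)
  also have "\<dots> = smul \<xi> ` F + nfold m (smul \<xi> ` D)" by (simp add: smul_sumset smul_nfold)
  also have "\<dots> \<subseteq> smul \<xi> ` F + nfold m (F' + nfold 2 D)" using F' by (intro set_plus_mono2 nfold_mono) auto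
  also have "\<dots> = (smul \<xi> ` F + nfold m F') + nfold (2 * m) D" by (simp add: nfold_sumset nn ac_simps)
  finally have 1: "smul \<xi> ` S \<subseteq> (smul \<xi> ` F + nfold m F') + nfold (2 * m) D" .
  have "card (smul \<xi> ` F + nfold m F') \<le> card (smul \<xi> ` F) * card (nfold m F')"
    using F F' by (intro card_sumset_le) auto
  also have "\<dots> \<le> card F * card F' ^ m" using F F' by (intro mult_mono card_image_le card_nfold_le) auto
  finally have "real (card (smul \<xi> ` F + nfold m F')) \<le> real (card F) * real (card F') ^ m"
    by (simp flip: of_nat_mult of_nat_power)
  also have "\<dots> \<le> k * (k' * k') ^ m" using F F' k by (intro mult_mono power_mono) auto
  also have "\<dots> = k * k' ^ (2 * m)" by (simp add: power_mult power2_eq_square)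
  finally show ?thesis using 1 F F' unfolding covered_def D_def
    by (intro exI[of _ "smul \<xi> ` F + nfold m F'"]) simp
qed

lemma card_covered_le:
  fixes B :: "'a::ab_group_add set"
  assumes cov: "covered B k m S" and fin: "finite B" and ne: "B \<noteq> {}"
    and K: "real (card (B + uminus ` B)) \<le> K * real (card B)"
  shows "real (card S) \<le> k * K ^ (2 * m) * real (card B)"
proof -
  have k: "0 \<le> k" using cov covered_nonneg by blast
  obtain F where F: "finite F" "real (card F) \<le> k" "S \<subseteq> F + nfold m (B + uminus ` B)"
    using cov by (auto simp: covered_def)
  have "real (card (nfold m (uminus ` B) + uminus ` nfold m (uminus ` B))) \<le> K ^ (m + m) * real (card B)"
    using fin ne K by (intro pluennecke) auto
  also have "nfold m (uminus ` B) + uminus ` nfold m (uminus ` B) = nfold m (B + uminus ` B)"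
    by (simp add: nfold_uminus uminus_uminus_image nfold_sumset add.commute)
  finally have 1: "real (card (nfold m (B + uminus ` B))) \<le> K ^ (2 * m) * real (card B)" by (simp add: mult_2)
  have "card S \<le> card (F + nfold m (B + uminus ` B))" using F fin by (intro card_mono) auto
  also have "\<dots> \<le> card F * card (nfold m (B + uminus ` B))" using F fin by (intro card_sumset_le) auto
  finally have "real (card S) \<le> real (card F) * real (card (nfold m (B + uminus ` B)))"
    by (simp flip: of_nat_mult)
  also have "\<dots> \<le> k * (K ^ (2 * m) * real (card B))" using 1 F k by (intro mult_mono) auto
  finally show ?thesis by (simp add: mult.assoc)
qed

lemma covered_dilate:
  assumes B: "finite B" "B \<noteq> {}"
    and small: "real (card (B + uminus ` smul \<xi> ` B)) \<le> K * real (card B)"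
  shows "covered B K 1 (smul \<xi> ` B)"
proof -
  obtain F where F: "finite F" "card F * card B \<le> card (B + uminus ` smul \<xi> ` B)"
      "uminus ` smul \<xi> ` B \<subseteq> F + (B + uminus ` B)"
    using ruzsa_covering[of B "uminus ` smul \<xi> ` B"] B by auto
  have "real (card F) * real (card B) \<le> K * real (card B)"
    using F(2) small by (metis of_nat_le_iff of_nat_mult order_trans)
  then have "real (card F) \<le> K" using B by (simp add: card_gt_0_iff)
  then have "covered B K 1 (uminus ` smul \<xi> ` B)" using F unfolding covered_def by auto
  then have "covered B K 1 (uminus ` uminus ` smul \<xi> ` B)" by (rule covered_uminus)
  then show ?thesis by (simp add: uminus_uminus_image)
qed

text \<open>
  Every \<open>\<sigma>\<close> with \<open>B + \<sigma>B\<close> small contributes at least \<open>|B|\<^sup>3/K\<close> solutions of \<open>x + \<sigma>y = x' + \<sigma>y'\<close>,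
  whereas the number of solutions over all \<open>\<sigma>\<close> is at most \<open>|B|\<^sup>4 + p|B|\<^sup>2\<close>.
\<close>

lemma few_small_dilates:
  assumes p: "prime p" and B: "finite B" "B \<noteq> {}" "B \<subseteq> range (circ p)"
    and R: "R \<subseteq> {0..<int p}" and K: "0 \<le> K"
    and small: "\<And>\<sigma>. \<sigma> \<in> R \<Longrightarrow> real (card (B + smul \<sigma> ` B)) \<le> K * real (card B)"
  shows "real (card R) * real (card B) \<le> K * ((real (card B))\<^sup>2 + real p)"
proof -
  define b where "b = real (card B)"
  have b: "0 < b" using B by (simp add: b_def card_gt_0_iff)
  have finR: "finite R" using R finite_subset by blast
  have p0: "0 < p" using p prime_gt_0_nat by blast
  \<comment> \<open>Cauchy-Schwarz: a small sumset \<open>B + \<sigma>B\<close> forces many solutions of \<open>x + \<sigma>y = x' + \<sigma>y'\<close>.\<close>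
  define f where "f = (\<lambda>\<sigma> (x, y). x + smul \<sigma> y)"
  define Q where "Q = (B \<times> B) \<times> (B \<times> B)"
  have finQ: "finite Q" using B by (simp add: Q_def)
  define E where "E = (\<lambda>\<sigma>. real (card {q \<in> Q. f \<sigma> (fst q) = f \<sigma> (snd q)}))"
  define m where "m = (\<lambda>q. real (card {\<sigma> \<in> R. f \<sigma> (fst q) = f \<sigma> (snd q)}))"
  have E: "b ^ 3 \<le> K * E \<sigma>" if \<sigma>: "\<sigma> \<in> R" for \<sigma>
  proof -
    have im: "f \<sigma> ` (B \<times> B) = B + smul \<sigma> ` B"
      by (force simp: f_def set_plus_def image_iff)
    have set: "{(x, x'). x \<in> B \<times> B \<and> x' \<in> B \<times> B \<and> f \<sigma> x = f \<sigma> x'} = {q \<in> Q. f \<sigma> (fst q) = f \<sigma> (snd q)}"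
      by (auto simp: Q_def)
    have "(card (B \<times> B))\<^sup>2 \<le> card (B + smul \<sigma> ` B) * card {q \<in> Q. f \<sigma> (fst q) = f \<sigma> (snd q)}"
      using card_power2_le_collisions[of "B \<times> B" "f \<sigma>"] B unfolding im collisions_def set by simp
    then have "(b * b)\<^sup>2 \<le> real (card (B + smul \<sigma> ` B)) * E \<sigma>"
      by (simp add: E_def b_def card_cartesian_product flip: of_nat_mult of_nat_power)
    also have "\<dots> \<le> (K * b) * E \<sigma>" using small[OF \<sigma>] by (intro mult_right_mono) (auto simp: b_def E_def)
    finally have "b * b ^ 3 \<le> b * (K * E \<sigma>)" by (simp add: eval_nat_numeral mult_ac)
    then show ?thesis using b by simp
  qed
  define Q1 where "Q1 = {q \<in> Q. fst q = snd q}"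
  have m1: "m q \<le> real p" if "q \<in> Q1" for q
  proof -
    have "card {\<sigma> \<in> R. f \<sigma> (fst q) = f \<sigma> (snd q)} \<le> card {0..<int p}"
      using R by (intro card_mono) auto
    then show ?thesis by (simp add: m_def)
  qed
  \<comment> \<open>off the diagonal, a solution determines \<open>\<sigma>\<close> as a quotient of differences\<close>
  have m2: "m q \<le> 1" if "q \<in> Q - Q1" for q
  proof -
    obtain b1 b2 b3 b4 where q: "q = ((b1, b2), (b3, b4))" by (metis surj_pair)
    have "\<sigma> = \<sigma>'" if s: "\<sigma> \<in> R" "\<sigma>' \<in> R" "f \<sigma> (fst q) = f \<sigma> (snd q)" "f \<sigma>' (fst q) = f \<sigma>' (snd q)" for \<sigma> \<sigma>'
    proof (rule ccontr)
      assume ne: "\<sigma> \<noteq> \<sigma>'"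
      have e: "b1 + smul \<sigma> b2 = b3 + smul \<sigma> b4" "b1 + smul \<sigma>' b2 = b3 + smul \<sigma>' b4"
        using s by (auto simp: f_def q)
      have nd: "\<not> int p dvd \<sigma> - \<sigma>'" using ne s R residues_eqI by blast
      have "smul (\<sigma> - \<sigma>') b2 = (b1 + smul \<sigma> b2) - (b1 + smul \<sigma>' b2)"
        using smul_add_left[of \<sigma> "- \<sigma>'" b2] by (simp add: smul_uminus_left)
      also have "\<dots> = (b3 + smul \<sigma> b4) - (b3 + smul \<sigma>' b4)" using e by simp
      also have "\<dots> = smul (\<sigma> - \<sigma>') b4"
        using smul_add_left[of \<sigma> "- \<sigma>'" b4] by (simp add: smul_uminus_left)
      finally have "b2 = b4"
        by (rule inj_onD[OF inj_on_smul[OF p nd]]) (use \<open>q \<in> Q - Q1\<close> B in \<open>auto simp: Q_def q\<close>)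
      then show False using e \<open>q \<in> Q - Q1\<close> by (simp add: q Q1_def)
    qed
    then have "card {\<sigma> \<in> R. f \<sigma> (fst q) = f \<sigma> (snd q)} \<le> 1"
      using finR by (intro card_le_Suc0_iff_eq[THEN iffD2, simplified One_nat_def[symmetric]]) auto
    then show ?thesis by (simp add: m_def)
  qed
  have "Q1 = (\<lambda>x. (x, x)) ` (B \<times> B)" by (auto simp: Q1_def Q_def)
  then have cQ1: "real (card Q1) = b\<^sup>2"
    by (simp add: card_image inj_on_def card_cartesian_product b_def power2_eq_square)
  have cQ: "real (card Q) = b ^ 4" by (simp add: Q_def card_cartesian_product b_def eval_nat_numeral)
  have "real (card R) * b ^ 3 = (\<Sum>\<sigma>\<in>R. b ^ 3)" by simp
  also have "\<dots> \<le> (\<Sum>\<sigma>\<in>R. K * E \<sigma>)" by (intro sum_mono E)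
  also have "\<dots> = K * (\<Sum>q\<in>Q. m q)"
    unfolding E_def m_def sum_distrib_left[symmetric] double_count[OF finR finQ] ..
  finally have 1: "real (card R) * b ^ 3 \<le> K * (\<Sum>q\<in>Q. m q)" .
  have "(\<Sum>q\<in>Q. m q) = (\<Sum>q\<in>Q - Q1. m q) + (\<Sum>q\<in>Q1. m q)"
    using finQ by (intro sum.subset_diff) (auto simp: Q1_def)
  also have "\<dots> \<le> (\<Sum>q\<in>Q - Q1. 1) + (\<Sum>q\<in>Q1. real p)"
    using m1 m2 by (intro add_mono sum_mono) auto
  also have "\<dots> \<le> b ^ 4 + b\<^sup>2 * real p"
    using finQ cQ1 unfolding cQ[symmetric] by (auto intro: card_mono)
  finally have 2: "(\<Sum>q\<in>Q. m q) \<le> b\<^sup>2 * (b\<^sup>2 + real p)" by (simp add: algebra_simps power2_eq_square eval_nat_numeral)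
  have "real (card R) * b ^ 3 \<le> K * (b\<^sup>2 * (b\<^sup>2 + real p))"
    using 1 2 K by (meson mult_left_mono order_trans)
  then have "b\<^sup>2 * (real (card R) * b) \<le> b\<^sup>2 * (K * (b\<^sup>2 + real p))"
    by (simp add: eval_nat_numeral mult_ac)
  then have "real (card R) * b \<le> K * (b\<^sup>2 + real p)"
    by (rule mult_left_le_imp_le) (use b in simp)
  then show ?thesis by (simp add: b_def)
qed

text \<open>
  If \<open>\<Xi>\<close> consists of dilations that commensurate \<open>B\<close>, then so do bounded rational expressions in \<open>\<Xi>\<close>.
  Either the quotients \<open>(\<Xi> - \<Xi>) / (\<Xi> - \<Xi>)\<close> exhaust the field, or there is a quotient \<open>q\<close> such that \<open>q + 1\<close> is no
  quotient, and then \<open>\<Xi> + (q + 1)\<Xi>\<close> has \<open>|\<Xi>|\<^sup>2\<close> elements. In both cases there are more such dilations than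
  the preceding estimate permits, unless \<open>K\<close> is large. In the exponent 48, covering
  \<open>D(B + \<sigma>B)\<close> by translates of \<open>14(B - B)\<close> costs 20 and the size of \<open>14(B - B)\<close> costs 28, where \<open>D\<close> is the
  denominator of \<open>\<sigma>\<close>.
\<close>

lemma sum_product_phenomenon:
  assumes p: "prime p" and B: "finite B" "B \<noteq> {}" "B \<subseteq> range (circ p)" and K: "1 \<le> K"
    and dbl: "real (card (B + uminus ` B)) \<le> K * real (card B)"
    and \<Xi>: "\<Xi> \<subseteq> {0..<int p}" "2 \<le> card \<Xi>"
    and small: "\<And>\<xi>. \<xi> \<in> \<Xi> \<Longrightarrow> real (card (B + uminus ` smul \<xi> ` B)) \<le> K * real (card B)"
  shows "min ((real (card \<Xi>))\<^sup>2) (real p) * real (card B) \<le> K ^ 48 * ((real (card B))\<^sup>2 + real p)"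
proof -
  have fin\<Xi>: "finite \<Xi>" using \<Xi> finite_subset by blast
  have p0: "0 < p" using p prime_gt_0_nat by blast
  \<comment> \<open>the quotient set \<open>(\<Xi> - \<Xi>) / (\<Xi> - \<Xi>)\<close>\<close>
  define Q where "Q = {q \<in> {0..<int p}. \<exists>a\<in>\<Xi>. \<exists>b\<in>\<Xi>. \<exists>c\<in>\<Xi>. \<exists>d\<in>\<Xi>. c \<noteq> d \<and> int p dvd (c - d) * q - (a - b)}"
  have QI: "q \<in> Q" if "q \<in> {0..<int p}" "a \<in> \<Xi>" "b \<in> \<Xi>" "c \<in> \<Xi>" "d \<in> \<Xi>" "c \<noteq> d"
      "int p dvd (c - d) * q - (a - b)" for q a b c d
    unfolding Q_def using that by blast
  have QE: thesis if "q \<in> Q" "\<And>a b c d. \<lbrakk>a \<in> \<Xi>; b \<in> \<Xi>; c \<in> \<Xi>; d \<in> \<Xi>; c \<noteq> d;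
      int p dvd (c - d) * q - (a - b)\<rbrakk> \<Longrightarrow> thesis" for q thesis
    using that unfolding Q_def by blast
  have Qsub: "Q \<subseteq> {0..<int p}" unfolding Q_def by blast
  define R where "R = {\<sigma> \<in> {0..<int p}. real (card (B + smul \<sigma> ` B)) \<le> K ^ 48 * real (card B)}"
  have finR: "finite R" by (rule finite_subset[of _ "{0..<int p}"]) (auto simp: R_def)
  have cov: "covered B K 1 (smul \<xi> ` B)" if "\<xi> \<in> \<Xi>" for \<xi>
    using covered_dilate[OF B(1,2) small[OF that]] .
  have cov2: "covered B (K ^ 3) 2 (smul (\<xi> * \<eta>) ` B)" if "\<xi> \<in> \<Xi>" "\<eta> \<in> \<Xi>" for \<xi> \<eta>
  proof -
    have "covered B (K * K ^ (2 * 1)) (2 * 1) (smul \<xi> ` smul \<eta> ` B)"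
      using that by (intro covered_smul cov)
    then show ?thesis by (simp add: image_image smul_smul eval_nat_numeral mult_ac)
  qed
  \<comment> \<open>Multiplying by \<open>D\<close> clears the denominator of \<open>\<sigma>\<close>.\<close>
  have fromcov: "real (card (B + smul \<sigma> ` B)) \<le> K ^ 48 * real (card B)"
    if D: "\<not> int p dvd D" and c1: "covered B k m (smul D ` B)" and c2: "covered B k' m' (smul D ` smul \<sigma> ` B)"
      and k: "k * k' * K ^ (2 * (m + m')) \<le> K ^ 48" for D \<sigma> k m k' m'
  proof -
    have "card (B + smul \<sigma> ` B) = card (smul D ` (B + smul \<sigma> ` B))"
    proof (rule card_image[symmetric], rule inj_on_subset[OF inj_on_smul[OF p D]])
      show "B + smul \<sigma> ` B \<subseteq> range (circ p)"
      proof
        fix x assume "x \<in> B + smul \<sigma> ` B"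
        then obtain a b where "a \<in> B" "b \<in> B" "x = a + smul \<sigma> b" by (auto elim!: set_plus_elim)
        then show "x \<in> range (circ p)" using B by (auto intro!: range_circ_add range_circ_smul)
      qed
    qed
    also have "smul D ` (B + smul \<sigma> ` B) = smul D ` B + smul D ` smul \<sigma> ` B" by (rule smul_sumset)
    finally have "real (card (B + smul \<sigma> ` B)) = real (card (smul D ` B + smul D ` smul \<sigma> ` B))" by simp
    also have "\<dots> \<le> k * k' * K ^ (2 * (m + m')) * real (card B)"
      by (rule card_covered_le[OF covered_sumset[OF c1 c2] B(1,2) dbl])
    also have "\<dots> \<le> K ^ 48 * real (card B)" using k by (intro mult_right_mono) auto
    finally show ?thesis .
  qed
  have covdiff: "covered B (K ^ 2) 2 (smul (c - d) ` B)" if "c \<in> \<Xi>" "d \<in> \<Xi>" for c d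
  proof (rule covered_mono)
    show "covered B (K ^ 2) 2 (smul c ` B + uminus ` smul d ` B)"
      using covered_sumset[OF cov[OF that(1)] covered_uminus[OF cov[OF that(2)]]] by (simp add: numeral_2_eq_2 power2_eq_square)
    show "smul (c - d) ` B \<subseteq> smul c ` B + uminus ` smul d ` B"
    proof clarify
      fix x assume x: "x \<in> B"
      have "smul (c - d) x = smul c x + - smul d x"
        using smul_add_left[of c "- d" x] by (simp add: smul_uminus_left)
      then show "smul (c - d) x \<in> smul c ` B + uminus ` smul d ` B"
        using x by (simp only:) (intro set_plus_intro imageI)
    qed
  qed
  have covdiff2: "covered B (K ^ 6) 4 (smul ((c - d) * e) ` B)" if "c \<in> \<Xi>" "d \<in> \<Xi>" "e \<in> \<Xi>" for c d e
  proof (rule covered_mono)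
    have "covered B (K ^ 3 * K ^ 3) (2 + 2) (smul (c * e) ` B + uminus ` smul (d * e) ` B)"
      using that by (intro covered_sumset covered_uminus cov2)
    then show "covered B (K ^ 6) 4 (smul (c * e) ` B + uminus ` smul (d * e) ` B)"
      by (simp flip: power_add)
    show "smul ((c - d) * e) ` B \<subseteq> smul (c * e) ` B + uminus ` smul (d * e) ` B"
    proof clarify
      fix x assume x: "x \<in> B"
      have "smul ((c - d) * e) x = smul (c * e) x + - smul (d * e) x"
        using smul_add_left[of "c * e" "- (d * e)" x] by (simp add: smul_uminus_left left_diff_distrib)
      then show "smul ((c - d) * e) x \<in> smul (c * e) ` B + uminus ` smul (d * e) ` B"
        using x by (simp only:) (intro set_plus_intro imageI)
    qed
  qed
  have nd: "\<not> int p dvd c - d" if "c \<in> \<Xi>" "d \<in> \<Xi>" "c \<noteq> d" for c d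
    using that \<Xi> residues_eqI by blast
  have "min ((real (card \<Xi>))\<^sup>2) (real p) \<le> real (card R)"
  proof (cases "Q = {0..<int p}")
    case True
    have "{0..<int p} \<subseteq> R"
    proof
      fix q assume q: "q \<in> {0..<int p}"
      then obtain a b c d where abcd: "a \<in> \<Xi>" "b \<in> \<Xi>" "c \<in> \<Xi>" "d \<in> \<Xi>" "c \<noteq> d" "int p dvd (c - d) * q - (a - b)"
        using True by (metis QE)
      have eq: "smul (c - d) ` smul q ` B = smul (a - b) ` B"
        unfolding image_image smul_smul
        by (intro image_cong refl smul_cong[OF p0 abcd(6)]) (use B in auto)
      have "real (card (B + smul q ` B)) \<le> K ^ 48 * real (card B)"
      proof (rule fromcov[OF nd[OF abcd(3,4,5)] covdiff[OF abcd(3,4)]])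
        show "covered B (K ^ 2) 2 (smul (c - d) ` smul q ` B)" unfolding eq by (rule covdiff[OF abcd(1,2)])
        have "K ^ 2 * K ^ 2 * K ^ (2 * (2 + 2)) = K ^ 12" by (simp flip: power_add)
        also have "\<dots> \<le> K ^ 48" using K by (intro power_increasing) auto
        finally show "K ^ 2 * K ^ 2 * K ^ (2 * (2 + 2)) \<le> K ^ 48" .
      qed
      then show "q \<in> R" using q by (simp add: R_def)
    qed
    then have "card {0..<int p} \<le> card R" using finR by (rule card_mono[rotated])
    then show ?thesis by simp
  next
    case False
    \<comment> \<open>a set of residues that contains 0 and is closed under adding 1 is everything\<close>
    have "\<exists>q\<in>Q. (q + 1) mod int p \<notin> Q"
    proof (rule ccontr)
      assume "\<not> (\<exists>q\<in>Q. (q + 1) mod int p \<notin> Q)"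
      then have step: "(q + 1) mod int p \<in> Q" if "q \<in> Q" for q using that by blast
      have "\<not> card \<Xi> \<le> Suc 0" using \<Xi>(2) by simp
      then obtain a b where "a \<in> \<Xi>" "b \<in> \<Xi>" "a \<noteq> b"
        unfolding card_le_Suc0_iff_eq[OF fin\<Xi>] by blast
      then have "0 \<in> Q" using p0 by (intro QI[of 0 a a a b]) auto
      have "int n \<in> Q" if "n < p" for n
        using that
      proof (induction n)
        case (Suc n)
        then have "(int n + 1) mod int p \<in> Q" by (intro step) auto
        then show ?case using Suc by (simp add: add.commute)
      qed (use \<open>0 \<in> Q\<close> in simp)
      then have "{0..<int p} \<subseteq> Q"
        by (metis atLeastLessThan_iff subsetI zero_le_imp_eq_int of_nat_less_iff)
      with False Qsub show False by blast
    qed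
    then obtain q where q: "q \<in> Q" "(q + 1) mod int p \<notin> Q" by blast
    then obtain a b c d where abcd: "a \<in> \<Xi>" "b \<in> \<Xi>" "c \<in> \<Xi>" "d \<in> \<Xi>" "c \<noteq> d" "int p dvd (c - d) * q - (a - b)"
      by (metis QE)
    \<comment> \<open>\<open>q + 1\<close> is not a quotient of differences, so all sums \<open>x + (q + 1) y\<close> are distinct\<close>
    define f where "f = (\<lambda>(x, y). (x + (q + 1) * y) mod int p)"
    have "inj_on f (\<Xi> \<times> \<Xi>)"
    proof (rule inj_onI)
      fix u v assume u: "u \<in> \<Xi> \<times> \<Xi>" and v: "v \<in> \<Xi> \<times> \<Xi>" and eq: "f u = f v"
      obtain x y where xy: "u = (x, y)" by (cases u)
      obtain x' y' where xy': "v = (x', y')" by (cases v)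
      have in\<Xi>: "x \<in> \<Xi>" "y \<in> \<Xi>" "x' \<in> \<Xi>" "y' \<in> \<Xi>" using u v xy xy' by auto
      have dv: "int p dvd (x + (q + 1) * y) - (x' + (q + 1) * y')"
        using eq by (simp add: f_def xy xy' mod_eq_dvd_iff)
      have "y = y'"
      proof (rule ccontr)
        assume ne: "y \<noteq> y'"
        have "int p dvd (y - y') * (q + 1) - (x' - x)"
          using dv by (simp add: algebra_simps)
        then have "((y - y') * (q + 1)) mod int p = (x' - x) mod int p" by (simp add: mod_eq_dvd_iff)
        then have "((y - y') * ((q + 1) mod int p)) mod int p = (x' - x) mod int p" by (simp add: mod_mult_right_eq)
        then have "int p dvd (y - y') * ((q + 1) mod int p) - (x' - x)" by (simp add: mod_eq_dvd_iff)
        then have "(q + 1) mod int p \<in> Q" using ne in\<Xi> p0 by (intro QI[of _ x' x y y']) auto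
        with q show False by blast
      qed
      then have "int p dvd x - x'" using dv by simp
      then have "x = x'" by (rule residues_eqI) (use in\<Xi> \<Xi> in blast)+
      with \<open>y = y'\<close> show "u = v" by (simp add: xy xy')
    qed
    then have "card (\<Xi> \<times> \<Xi>) = card (f ` (\<Xi> \<times> \<Xi>))" by (simp add: card_image)
    also have "\<dots> \<le> card R"
    proof (rule card_mono[OF finR], rule image_subsetI)
      fix u assume u: "u \<in> \<Xi> \<times> \<Xi>"
      obtain x y where xy: "u = (x, y)" by (cases u)
      have in\<Xi>: "x \<in> \<Xi>" "y \<in> \<Xi>" using u xy by auto
      define \<sigma> where "\<sigma> = f u"
      have dv: "int p dvd (c - d) * \<sigma> - ((c - d) * x + ((a - b) * y + (c - d) * y))"
      proof -
        have "int p dvd (x + (q + 1) * y) - \<sigma>"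
          unfolding \<sigma>_def f_def xy prod.case by (rule dvd_minus_mod)
        then have "int p dvd \<sigma> - (x + (q + 1) * y)" by (subst dvd_diff_commute)
        then have "int p dvd (c - d) * (\<sigma> - (x + (q + 1) * y)) + ((c - d) * q - (a - b)) * y"
          using abcd(6) by (intro dvd_add) auto
        then show ?thesis by (simp add: algebra_simps)
      qed
      have "covered B (K ^ 6 * (K ^ 6 * K ^ 6)) (4 + (4 + 4)) (smul (c - d) ` smul \<sigma> ` B)"
      proof (rule covered_mono)
        show "covered B (K ^ 6 * (K ^ 6 * K ^ 6)) (4 + (4 + 4))
           (smul ((c - d) * x) ` B + (smul ((a - b) * y) ` B + smul ((c - d) * y) ` B))"
          using in\<Xi> abcd by (intro covered_sumset covdiff2)
        show "smul (c - d) ` smul \<sigma> ` B \<subseteq> smul ((c - d) * x) ` B + (smul ((a - b) * y) ` B + smul ((c - d) * y) ` B)"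
        proof clarify
          fix z assume z: "z \<in> B"
          have "smul (c - d) (smul \<sigma> z) = smul ((c - d) * x + ((a - b) * y + (c - d) * y)) z"
            unfolding smul_smul using z B by (intro smul_cong[OF p0 dv]) auto
          also have "\<dots> = smul ((c - d) * x) z + (smul ((a - b) * y) z + smul ((c - d) * y) z)"
            by (simp add: smul_add_left)
          also have "\<dots> \<in> smul ((c - d) * x) ` B + (smul ((a - b) * y) ` B + smul ((c - d) * y) ` B)"
            using z by (intro set_plus_intro imageI)
          finally show "smul (c - d) (smul \<sigma> z) \<in> smul ((c - d) * x) ` B + (smul ((a - b) * y) ` B + smul ((c - d) * y) ` B)" .
        qed
      qed
      moreover have "K ^ 2 * (K ^ 6 * (K ^ 6 * K ^ 6)) * K ^ (2 * (2 + (4 + (4 + 4)))) \<le> K ^ 48"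
        by (simp flip: power_add)
      ultimately have "real (card (B + smul \<sigma> ` B)) \<le> K ^ 48 * real (card B)"
        using fromcov[OF nd[OF abcd(3,4,5)] covdiff[OF abcd(3,4)]] by blast
      moreover have "\<sigma> \<in> {0..<int p}" using p0 by (simp add: \<sigma>_def f_def xy)
      ultimately show "f u \<in> R" by (simp add: R_def \<sigma>_def)
    qed
    finally have "card (\<Xi> \<times> \<Xi>) \<le> card R" .
    then have "(real (card \<Xi>))\<^sup>2 \<le> real (card R)"
      by (metis card_cartesian_product of_nat_le_iff of_nat_mult power2_eq_square)
    then show ?thesis by (rule min.coboundedI1)
  qed
  then have "min ((real (card \<Xi>))\<^sup>2) (real p) * real (card B) \<le> real (card R) * real (card B)"
    by (rule mult_right_mono) simp
  also have "\<dots> \<le> K ^ 48 * ((real (card B))\<^sup>2 + real p)"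
    by (rule few_small_dilates[OF p B]) (use K in \<open>auto simp: R_def\<close>)
  finally show ?thesis .
qed

section \<open>Rich families of dilates\<close>

text \<open>
  Rectangles of density \<open>\<delta>\<close> in a common box must intersect: by Cauchy-Schwarz the average pairwise intersection
  has density at least \<open>\<delta>\<^sup>2\<close>, so one rectangle meets a positive proportion of the others substantially.
\<close>

lemma popular_rectangle:
  fixes N \<delta> :: real
  assumes fin: "finite T" "finite X" "finite Y" and T: "T \<noteq> {}" and \<delta>: "0 < \<delta>" and N: "0 < N"
    and X: "real (card X) \<le> N" and Y: "real (card Y) \<le> N"
    and A: "\<And>t. t \<in> T \<Longrightarrow> A t \<subseteq> X" and B: "\<And>t. t \<in> T \<Longrightarrow> B t \<subseteq> Y"
    and AB: "\<And>t. t \<in> T \<Longrightarrow> \<delta> * N\<^sup>2 \<le> real (card (A t)) * real (card (B t))"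
  obtains s where "s \<in> T"
    "\<delta>\<^sup>2 / 2 * real (card T) \<le> real (card {t \<in> T. \<delta>\<^sup>2 * N\<^sup>2 / 2 \<le> real (card (A t \<inter> A s)) * real (card (B t \<inter> B s))})"
proof -
  define n where "n = real (card T)"
  have n: "0 < n" using fin T by (simp add: n_def card_gt_0_iff)
  define d where "d = (\<lambda>q. real (card {t \<in> T. q \<in> A t \<times> B t}))"
  define c where "c = (\<lambda>t s. real (card (A t \<inter> A s)) * real (card (B t \<inter> B s)))"
  have finXY: "finite (X \<times> Y)" using fin by simp
  have cXY: "real (card (X \<times> Y)) \<le> N\<^sup>2"
    using X Y N by (simp add: card_cartesian_product power2_eq_square mult_mono)
  have "n * (\<delta> * N\<^sup>2) = (\<Sum>t\<in>T. \<delta> * N\<^sup>2)" by (simp add: n_def)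
  also have "\<dots> \<le> (\<Sum>t\<in>T. real (card {q \<in> X \<times> Y. q \<in> A t \<times> B t}))"
  proof (rule sum_mono)
    fix t assume t: "t \<in> T"
    have "{q \<in> X \<times> Y. q \<in> A t \<times> B t} = A t \<times> B t" using A[OF t] B[OF t] by auto
    then show "\<delta> * N\<^sup>2 \<le> real (card {q \<in> X \<times> Y. q \<in> A t \<times> B t})"
      using AB[OF t] by (simp add: card_cartesian_product)
  qed
  also have "\<dots> = (\<Sum>q\<in>X \<times> Y. d q)" unfolding d_def by (rule double_count[OF fin(1) finXY])
  finally have 1: "n * (\<delta> * N\<^sup>2) \<le> (\<Sum>q\<in>X \<times> Y. d q)" .
  \<comment> \<open>the second moment of the covering multiplicity counts pairwise intersections\<close>
  have d2: "(d q)\<^sup>2 = (\<Sum>s\<in>T. \<Sum>t\<in>T. of_bool (q \<in> A t \<times> B t \<and> q \<in> A s \<times> B s))" for q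
    unfolding d_def card_filter_eq_sum[OF fin(1)] power2_eq_square sum_product
    by (intro sum.cong refl) auto
  have c: "(\<Sum>q\<in>X \<times> Y. of_bool (q \<in> A t \<times> B t \<and> q \<in> A s \<times> B s)) = c t s" if "t \<in> T" "s \<in> T" for t s
  proof -
    have "{q \<in> X \<times> Y. q \<in> A t \<times> B t \<and> q \<in> A s \<times> B s} = (A t \<inter> A s) \<times> (B t \<inter> B s)"
      using A[OF that(1)] B[OF that(1)] by auto
    then show ?thesis by (simp add: c_def card_cartesian_product flip: card_filter_eq_sum[OF finXY])
  qed
  have "(\<Sum>q\<in>X \<times> Y. (d q)\<^sup>2)
      = (\<Sum>s\<in>T. \<Sum>q\<in>X \<times> Y. \<Sum>t\<in>T. of_bool (q \<in> A t \<times> B t \<and> q \<in> A s \<times> B s))"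
    unfolding d2 by (rule sum.swap)
  also have "\<dots> = (\<Sum>s\<in>T. \<Sum>t\<in>T. \<Sum>q\<in>X \<times> Y. of_bool (q \<in> A t \<times> B t \<and> q \<in> A s \<times> B s))"
    by (intro sum.cong refl sum.swap)
  also have "\<dots> = (\<Sum>s\<in>T. \<Sum>t\<in>T. c t s)" using c by (intro sum.cong refl) auto
  finally have dc: "(\<Sum>q\<in>X \<times> Y. (d q)\<^sup>2) = (\<Sum>s\<in>T. \<Sum>t\<in>T. c t s)" .
  have "(n * (\<delta> * N\<^sup>2))\<^sup>2 \<le> (\<Sum>q\<in>X \<times> Y. d q)\<^sup>2" using 1 n \<delta> by (intro power_mono) auto
  also have "\<dots> \<le> real (card (X \<times> Y)) * (\<Sum>q\<in>X \<times> Y. (d q)\<^sup>2)" by (rule sum_power2_le)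
  also have "\<dots> \<le> N\<^sup>2 * (\<Sum>q\<in>X \<times> Y. (d q)\<^sup>2)" using cXY by (intro mult_right_mono sum_nonneg) auto
  finally have "N\<^sup>2 * (n * (n * \<delta>\<^sup>2 * N\<^sup>2)) \<le> N\<^sup>2 * (\<Sum>s\<in>T. \<Sum>t\<in>T. c t s)"
    unfolding dc by (simp add: power2_eq_square mult_ac)
  then have "n * (n * \<delta>\<^sup>2 * N\<^sup>2) \<le> (\<Sum>s\<in>T. \<Sum>t\<in>T. c t s)"
    by (rule mult_left_le_imp_le) (use N in simp)
  then have "(\<Sum>s\<in>T. n * \<delta>\<^sup>2 * N\<^sup>2) \<le> (\<Sum>s\<in>T. \<Sum>t\<in>T. c t s)" by (simp add: n_def)
  then obtain s where s: "s \<in> T" "n * \<delta>\<^sup>2 * N\<^sup>2 \<le> (\<Sum>t\<in>T. c t s)"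
    using ex_ge_average[OF fin(1) T] by blast
  define T' where "T' = {t \<in> T. \<delta>\<^sup>2 * N\<^sup>2 / 2 \<le> c t s}"
  have T': "T' \<subseteq> T" "finite T'" using fin by (auto simp: T'_def)
  have "(\<Sum>t\<in>T. c t s) = (\<Sum>t\<in>T - T'. c t s) + (\<Sum>t\<in>T'. c t s)"
    using fin T' by (intro sum.subset_diff) auto
  also have "(\<Sum>t\<in>T'. c t s) \<le> (\<Sum>t\<in>T'. N\<^sup>2)"
  proof (rule sum_mono)
    fix t assume "t \<in> T'"
    then have t: "t \<in> T" using T' by auto
    have "real (card (A t \<inter> A s)) \<le> real (card X)" "real (card (B t \<inter> B s)) \<le> real (card Y)"
      using A[OF t] B[OF t] fin by (auto intro!: card_mono)
    then show "c t s \<le> N\<^sup>2" unfolding c_def power2_eq_square using X Y N by (intro mult_mono) auto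
  qed
  also have "(\<Sum>t\<in>T - T'. c t s) \<le> (\<Sum>t\<in>T - T'. \<delta>\<^sup>2 * N\<^sup>2 / 2)"
    by (intro sum_mono) (auto simp: T'_def)
  also have "\<dots> \<le> (\<Sum>t\<in>T. \<delta>\<^sup>2 * N\<^sup>2 / 2)" using fin by (intro sum_mono2) auto
  finally have "N\<^sup>2 * (n * \<delta>\<^sup>2) \<le> N\<^sup>2 * (n * \<delta>\<^sup>2 / 2 + real (card T'))"
    using s(2) by (simp add: n_def algebra_simps)
  then have "n * \<delta>\<^sup>2 \<le> n * \<delta>\<^sup>2 / 2 + real (card T')"
    by (rule mult_left_le_imp_le) (use N in simp)
  then have "\<delta>\<^sup>2 / 2 * real (card T) \<le> real (card T')" by (simp add: n_def algebra_simps)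
  then show ?thesis using that[OF s(1)] by (simp add: T'_def c_def)
qed

text \<open>
  The theorem of Balog, Szemeredi and Gowers with its constants absorbed into powers of \<open>K\<close>,
  for which \<open>K\<close> is taken to be at least 4096.
\<close>

lemma bsg_dilates:
  fixes K N :: real
  assumes p: "prime p" and mn: "\<not> int p dvd m" "\<not> int p dvd n"
    and Z: "finite X" "finite Y" "X \<noteq> {}" "Y \<noteq> {}" "X \<subseteq> range (circ p)" "Y \<subseteq> range (circ p)"
    and K: "4096 \<le> K" and N: "0 < N"
    and cX: "N \<le> K * real (card X)" and cY: "N \<le> K * real (card Y)"
    and G: "G \<subseteq> X \<times> Y" "real (card X) * real (card Y) \<le> K * real (card G)"
    and S: "finite S" "real (card S) \<le> N" "\<And>x y. (x, y) \<in> G \<Longrightarrow> smul m x + smul n y \<in> S"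
  obtains A B where "A \<subseteq> X" "B \<subseteq> Y" "N \<le> K ^ 3 * real (card A)" "N \<le> K ^ 3 * real (card B)"
    "real (card (smul m ` A + smul n ` B)) \<le> K ^ 8 * N"
proof -
  have K1: "1 \<le> K" using K by simp
  have injX: "inj_on (smul m) X" and injY: "inj_on (smul n) Y"
    using inj_on_subset[OF inj_on_smul[OF p mn(1)] Z(5)] inj_on_subset[OF inj_on_smul[OF p mn(2)] Z(6)] .
  define f where "f = (\<lambda>(x, y). (smul m x, smul n y))"
  have "inj_on f (X \<times> Y)" using injX injY by (auto simp: f_def inj_on_def)
  then have cG: "card (f ` G) = card G" using G(1) by (intro card_image) (rule inj_on_subset)
  obtain A' B' where AB: "A' \<subseteq> smul m ` X" "B' \<subseteq> smul n ` Y"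
    "real (card (smul m ` X)) \<le> 6 * K * real (card A')"
    "real (card (smul n ` Y)) \<le> 4 * K * real (card B')"
    "real (card (A' + B')) * (real (card (smul m ` X)) * real (card (smul n ` Y))) \<le> 3072 * K ^ 5 * real (card S) ^ 3"
  proof (rule balog_szemeredi_gowers[of "smul m ` X" "smul n ` Y" S K "f ` G"])
    show "f ` G \<subseteq> smul m ` X \<times> smul n ` Y" using G(1) by (auto simp: f_def)
    show "real (card (smul m ` X)) * real (card (smul n ` Y)) \<le> K * real (card (f ` G))"
      using G(2) card_image[OF injX] card_image[OF injY] cG by simp
    show "a + b \<in> S" if ab: "(a, b) \<in> f ` G" for a b
    proof -
      obtain g where g: "g \<in> G" "(a, b) = f g" using ab by blast
      then show ?thesis using S(3)[of "fst g" "snd g"] by (simp add: f_def case_prod_beta)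
    qed
  qed (use Z S K1 in auto)
  have cX': "card (smul m ` X) = card X" and cY': "card (smul n ` Y) = card Y"
    using card_image[OF injX] card_image[OF injY] by auto
  obtain A where A: "A \<subseteq> X" "A' = smul m ` A" using AB(1) by (meson subset_imageE)
  obtain B where B: "B \<subseteq> Y" "B' = smul n ` B" using AB(2) by (meson subset_imageE)
  have cA: "card A' = card A" unfolding A(2) using inj_on_subset[OF injX A(1)] by (rule card_image)
  have cB: "card B' = card B" unfolding B(2) using inj_on_subset[OF injY B(1)] by (rule card_image)
  have K3: "6 * K\<^sup>2 \<le> K ^ 3" "4 * K\<^sup>2 \<le> K ^ 3" using K by (simp_all add: power2_eq_square power3_eq_cube)
  have "N \<le> K * real (card X)" by (rule cX)
  also have "\<dots> \<le> K * (6 * K * real (card A))" using AB(3) K unfolding cX' cA by (intro mult_left_mono) auto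
  also have "\<dots> = (6 * K\<^sup>2) * real (card A)" by (simp add: power2_eq_square)
  also have "\<dots> \<le> K ^ 3 * real (card A)" using K3 by (intro mult_right_mono) auto
  finally have 1: "N \<le> K ^ 3 * real (card A)" .
  have "N \<le> K * real (card Y)" by (rule cY)
  also have "\<dots> \<le> K * (4 * K * real (card B))" using AB(4) K unfolding cY' cB by (intro mult_left_mono) auto
  also have "\<dots> = (4 * K\<^sup>2) * real (card B)" by (simp add: power2_eq_square)
  also have "\<dots> \<le> K ^ 3 * real (card B)" using K3 by (intro mult_right_mono) auto
  finally have 2: "N \<le> K ^ 3 * real (card B)" .
  define s where "s = real (card (A' + B'))"
  have s0: "0 \<le> s" by (simp add: s_def)
  have "s * N\<^sup>2 \<le> s * ((K * real (card X)) * (K * real (card Y)))"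
    unfolding power2_eq_square using cX cY N s0 K by (intro mult_left_mono mult_mono) auto
  also have "\<dots> = K\<^sup>2 * (s * (real (card X) * real (card Y)))" by (simp add: power2_eq_square mult_ac)
  also have "\<dots> \<le> K\<^sup>2 * (3072 * K ^ 5 * real (card S) ^ 3)"
    using AB(5) unfolding cX' cY' s_def by (intro mult_left_mono) auto
  also have "\<dots> \<le> K\<^sup>2 * (K * K ^ 5 * N ^ 3)"
    using K S N by (intro mult_left_mono mult_mono power_mono mult_right_mono) auto
  also have "\<dots> = N\<^sup>2 * (K ^ 8 * N)" by (simp add: eval_nat_numeral mult_ac)
  finally have "N\<^sup>2 * s \<le> N\<^sup>2 * (K ^ 8 * N)" by (simp add: mult.commute)
  then have "s \<le> K ^ 8 * N" by (rule mult_left_le_imp_le) (use N in simp)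
  then show ?thesis using that[OF A(1) B(1) 1 2] by (simp add: s_def A B)
qed

text \<open>
  The sum \<open>mA + nB\<close> allows \<open>mA\<close> to be exchanged for \<open>nB\<close>. Applied to a second small sum \<open>m'A' + n'B'\<close> over
  large subsets, Ruzsa's triangle inequality eliminates \<open>A\<close> and leaves two dilates of \<open>B\<close> alone.
\<close>

lemma dilate_from_two_dilates:
  fixes K N :: real
  assumes p: "prime p" and K: "1 \<le> K" and N: "0 < N"
    and nd: "\<not> int p dvd m" "\<not> int p dvd n" "\<not> int p dvd m'" "\<not> int p dvd n'"
    and fin: "finite A" "finite B" and rg: "A \<subseteq> range (circ p)" "B \<subseteq> range (circ p)"
    and A': "A' \<subseteq> A" and B': "B' \<subseteq> B"
    and cA: "N \<le> K ^ 3 * real (card A)" and cA': "N \<le> K ^ 13 * real (card A')" and cB': "N \<le> K ^ 13 * real (card B')"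
    and s: "real (card (smul m ` A + smul n ` B)) \<le> K ^ 8 * N"
    and s': "real (card (smul m' ` A' + smul n' ` B')) \<le> K ^ 8 * N"
  shows "real (card (smul (m' * n) ` B + uminus ` smul (n' * m) ` B)) \<le> K ^ 61 * N"
    and "real (card (B + uminus ` B)) \<le> K ^ 19 * N"
proof -
  have K0: "0 \<le> K" "0 \<le> K ^ i" for i using K by simp_all
  have pm: "prime (int p)" using p by simp
  have ndm: "\<not> int p dvd a * b" if "\<not> int p dvd a" "\<not> int p dvd b" for a b
    using that pm by (simp add: prime_dvd_mult_iff)
  have rg': "A' \<subseteq> range (circ p)" "B' \<subseteq> range (circ p)" and fin': "finite A'" "finite B'"
    using A' B' rg fin by (auto intro: finite_subset)
  have rgs: "smul a ` X \<subseteq> range (circ p)" if "X \<subseteq> range (circ p)" for a X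
    using that by (auto intro!: range_circ_smul)
  have rga: "X + Y \<subseteq> range (circ p)" if "X \<subseteq> range (circ p)" "Y \<subseteq> range (circ p)" for X Y
    using that by (auto elim!: set_plus_elim intro!: range_circ_add)
  note smul_images = smul_smul image_image
  have dil: "card (smul (a * b) ` X + smul (a * c) ` Y) = card (smul b ` X + smul c ` Y)"
    if "\<not> int p dvd a" "X \<subseteq> range (circ p)" "Y \<subseteq> range (circ p)" for a b c X Y
  proof -
    have "smul (a * b) ` X + smul (a * c) ` Y = smul a ` (smul b ` X + smul c ` Y)"
      by (simp add: smul_sumset smul_images)
    then show ?thesis using card_smul[OF p that(1) rga[OF rgs[OF that(2)] rgs[OF that(3)]]] by simp
  qed
  have "real (card (smul n ` B + uminus ` smul n ` B)) \<le> (K ^ 3 * K ^ 8 * K ^ 8) * N"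
  proof (rule ruzsa_triangle_real[where Z = "smul m ` A"])
    show "N \<le> K ^ 3 * real (card (smul m ` A))" using cA card_smul[OF p nd(1) rg(1)] by simp
  qed (use fin N K0 s in \<open>auto simp: add.commute\<close>)
  also have "smul n ` B + uminus ` smul n ` B = smul n ` (B + uminus ` B)"
    by (simp add: smul_sumset smul_uminus_image)
  also have "card (smul n ` (B + uminus ` B)) = card (B + uminus ` B)"
  proof (rule card_smul[OF p nd(2)])
    show "B + uminus ` B \<subseteq> range (circ p)"
      using rg by (auto elim!: set_plus_elim intro!: range_circ_diff)
  qed
  finally show BB: "real (card (B + uminus ` B)) \<le> K ^ 19 * N" by (simp flip: power_add)
  have 1: "real (card (smul (m' * n) ` B + uminus ` smul (n' * m) ` B')) \<le> (K ^ 13 * K ^ 8 * K ^ 8) * N"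
  proof (rule ruzsa_triangle_real[where Z = "smul (m' * m) ` A'"])
    show "N \<le> K ^ 13 * real (card (smul (m' * m) ` A'))"
      using cA' card_smul[OF p ndm[OF nd(3,1)] rg'(1)] by simp
    have "real (card (smul (m' * n) ` B + smul (m' * m) ` A')) = real (card (smul n ` B + smul m ` A'))"
      using dil[OF nd(3) rg(2) rg'(1)] by simp
    also have "\<dots> \<le> real (card (smul n ` B + smul m ` A))" using fin A' by (intro card_sumset_mono) auto
    also have "\<dots> \<le> K ^ 8 * N" using s by (simp add: add.commute)
    finally show "real (card (smul (m' * n) ` B + smul (m' * m) ` A')) \<le> K ^ 8 * N" .
    have "real (card (smul (n' * m) ` B' + smul (m' * m) ` A')) = real (card (smul n' ` B' + smul m' ` A'))"
      using dil[OF nd(1) rg'(2) rg'(1), of n' m'] by (simp add: mult.commute)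
    also have "\<dots> \<le> K ^ 8 * N" using s' by (simp add: add.commute)
    finally show "real (card (smul (n' * m) ` B' + smul (m' * m) ` A')) \<le> K ^ 8 * N" .
  qed (use fin fin' N K0 in auto)
  define q where "q = n' * m"
  have "real (card (smul (m' * n) ` B + uminus ` smul q ` B)) \<le> (K ^ 13 * K ^ 29 * K ^ 19) * N"
  proof (rule ruzsa_triangle_real[where Z = "uminus ` smul q ` B'"])
    show "N \<le> K ^ 13 * real (card (uminus ` smul q ` B'))"
      using cB' card_smul[OF p ndm[OF nd(4,1)] rg'(2)] by (simp add: q_def)
    show "real (card (smul (m' * n) ` B + uminus ` smul q ` B')) \<le> K ^ 29 * N"
      using 1 by (simp add: q_def flip: power_add)
    have "real (card (smul q ` B + uminus ` smul q ` B')) \<le> real (card (smul q ` B + uminus ` smul q ` B))"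
      using fin B' by (intro card_sumset_mono) auto
    also have "smul q ` B + uminus ` smul q ` B = smul q ` (B + uminus ` B)"
      by (simp add: smul_sumset smul_uminus_image)
    also have "real (card \<dots>) \<le> real (card (B + uminus ` B))" using fin by (simp add: card_image_le)
    also note BB
    finally show "real (card (smul q ` B + uminus ` smul q ` B')) \<le> K ^ 19 * N" .
  qed (use fin fin' N K0 in auto)
  then show "real (card (smul (m' * n) ` B + uminus ` smul (n' * m) ` B)) \<le> K ^ 61 * N"
    by (simp add: q_def flip: power_add)
qed

text \<open>
  Suppose that for many indices \<open>t\<close>, with distinct ratios \<open>m t / n t\<close>, the sums \<open>m t x + n t y\<close> over a dense graph
  in \<open>X \<times> Y\<close> fall into a set of size \<open>N\<close>, where \<open>N\<close> is about the square root of \<open>p\<close>. For every single \<open>t\<close>,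
  dense parts of \<open>X\<close> and \<open>Y\<close> have a small sumset; a popular index turns all of this into one set \<open>D\<close> and
  about \<open>N\<close> dilations that commensurate it, which the sum-product phenomenon excludes unless \<open>K\<close> is at least a fixed power of \<open>N\<close>.
\<close>

lemma few_rich_dilates:
  fixes K N :: real and m n :: "'b \<Rightarrow> int"
  assumes p: "prime p" and K: "4096 \<le> K" and N: "0 < N" and pN: "real p \<le> K * N\<^sup>2" and Np: "N\<^sup>2 \<le> K * real p"
    and X: "finite X" "X \<subseteq> range (circ p)" "real (card X) \<le> N"
    and Y: "finite Y" "Y \<subseteq> range (circ p)" "real (card Y) \<le> N"
    and T: "finite T" "N \<le> K * real (card T)"
    and mn: "\<And>t. t \<in> T \<Longrightarrow> \<not> int p dvd m t" "\<And>t. t \<in> T \<Longrightarrow> \<not> int p dvd n t"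
    and ratio: "\<And>t t'. t \<in> T \<Longrightarrow> t' \<in> T \<Longrightarrow> t \<noteq> t' \<Longrightarrow> \<not> int p dvd m t * n t' - m t' * n t"
    and G: "\<And>t. t \<in> T \<Longrightarrow> G t \<subseteq> X \<times> Y" "\<And>t. t \<in> T \<Longrightarrow> N\<^sup>2 \<le> K * real (card (G t))"
    and S: "\<And>t. t \<in> T \<Longrightarrow> finite (S t)" "\<And>t. t \<in> T \<Longrightarrow> real (card (S t)) \<le> N"
      "\<And>t x y. t \<in> T \<Longrightarrow> (x, y) \<in> G t \<Longrightarrow> smul (m t) x + smul (n t) y \<in> S t"
  shows "N \<le> K ^ 3105"
proof -
  have K1: "1 \<le> K" using K by simp
  have p0: "0 < p" using p prime_gt_0_nat by blast
  have Tne: "T \<noteq> {}" using T N by auto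
  then obtain t0 where t0: "t0 \<in> T" by auto
  have "card (G t0) \<le> card (X \<times> Y)" using G(1)[OF t0] X Y by (intro card_mono) auto
  then have "real (card (G t0)) \<le> real (card X) * real (card Y)"
    by (simp add: card_cartesian_product flip: of_nat_mult)
  then have XY: "N\<^sup>2 \<le> K * (real (card X) * real (card Y))"
    using G(2)[OF t0] K1 by (meson mult_left_mono order_trans zero_le_one)
  have "N * N \<le> N * (K * real (card X))"
  proof -
    have "K * (real (card X) * real (card Y)) \<le> K * (real (card X) * N)" using Y K by (intro mult_left_mono) auto
    then show ?thesis using XY by (simp add: power2_eq_square mult_ac)
  qed
  then have cX: "N \<le> K * real (card X)" by (rule mult_left_le_imp_le) (rule N)
  have "N * N \<le> N * (K * real (card Y))"
  proof -
    have "K * (real (card X) * real (card Y)) \<le> K * (N * real (card Y))" using X K by (intro mult_left_mono mult_right_mono) auto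
    then show ?thesis using XY by (simp add: power2_eq_square mult_ac)
  qed
  then have cY: "N \<le> K * real (card Y)" by (rule mult_left_le_imp_le) (rule N)
  have ne: "X \<noteq> {}" "Y \<noteq> {}" using cX cY N by auto
  have XYN: "real (card X) * real (card Y) \<le> N\<^sup>2" unfolding power2_eq_square using X Y N by (intro mult_mono) auto
  have "\<exists>A B. A \<subseteq> X \<and> B \<subseteq> Y \<and> N \<le> K ^ 3 * real (card A) \<and> N \<le> K ^ 3 * real (card B) \<and>
      real (card (smul (m t) ` A + smul (n t) ` B)) \<le> K ^ 8 * N" if t: "t \<in> T" for t
  proof -
    have "real (card X) * real (card Y) \<le> K * real (card (G t))" using XYN G(2)[OF t] by linarith
    from bsg_dilates[OF p mn(1)[OF t] mn(2)[OF t] X(1) Y(1) ne X(2) Y(2) K N cX cY G(1)[OF t] this S(1)[OF t] S(2)[OF t] S(3)[OF t]]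
    show ?thesis by metis
  qed
  then obtain A B where AB: "\<And>t. t \<in> T \<Longrightarrow> A t \<subseteq> X" "\<And>t. t \<in> T \<Longrightarrow> B t \<subseteq> Y"
    "\<And>t. t \<in> T \<Longrightarrow> N \<le> K ^ 3 * real (card (A t))" "\<And>t. t \<in> T \<Longrightarrow> N \<le> K ^ 3 * real (card (B t))"
    "\<And>t. t \<in> T \<Longrightarrow> real (card (smul (m t) ` A t + smul (n t) ` B t)) \<le> K ^ 8 * N"
    by metis
  define \<delta> where "\<delta> = 1 / K ^ 6"
  have \<delta>: "0 < \<delta>" using K by (simp add: \<delta>_def)
  have \<delta>2: "\<delta>\<^sup>2 = 1 / K ^ 12" by (simp add: \<delta>_def power_divide flip: power_mult)
  have dAB: "\<delta> * N\<^sup>2 \<le> real (card (A t)) * real (card (B t))" if t: "t \<in> T" for t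
  proof -
    have "N * N \<le> (K ^ 3 * real (card (A t))) * (K ^ 3 * real (card (B t)))"
      using AB(3,4)[OF t] N K by (intro mult_mono) auto
    also have "\<dots> = K ^ 6 * (real (card (A t)) * real (card (B t)))" by (simp add: eval_nat_numeral mult_ac)
    finally show ?thesis using K by (simp add: \<delta>_def power2_eq_square field_simps)
  qed
  obtain s where s: "s \<in> T" "\<delta>\<^sup>2 / 2 * real (card T)
      \<le> real (card {t \<in> T. \<delta>\<^sup>2 * N\<^sup>2 / 2 \<le> real (card (A t \<inter> A s)) * real (card (B t \<inter> B s))})"
    by (rule popular_rectangle[OF T(1) X(1) Y(1) Tne \<delta> N X(3) Y(3) AB(1) AB(2) dAB])
  define T' where "T' = {t \<in> T. \<delta>\<^sup>2 * N\<^sup>2 / 2 \<le> real (card (A t \<inter> A s)) * real (card (B t \<inter> B s))}"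
  have T': "T' \<subseteq> T" "finite T'" using T by (auto simp: T'_def)
  have "N \<le> K * real (card T)" by (rule T(2))
  also have "\<dots> = K * (2 * K ^ 12) * (\<delta>\<^sup>2 / 2 * real (card T))" unfolding \<delta>2 using K by simp
  also have "\<dots> \<le> K * (2 * K ^ 12) * real (card T')" using s(2) K unfolding T'_def by (intro mult_left_mono) auto
  also have "\<dots> \<le> K * (K * K ^ 12) * real (card T')" using K by (intro mult_left_mono mult_right_mono) auto
  also have "\<dots> = K ^ 14 * real (card T')" by (simp add: eval_nat_numeral mult_ac)
  finally have cT': "N \<le> K ^ 14 * real (card T')" .
  have big: "N \<le> K ^ 13 * real (card (A t \<inter> A s))" "N \<le> K ^ 13 * real (card (B t \<inter> B s))" if t: "t \<in> T'" for t
  proof -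
    have tT: "t \<in> T" using t T' by auto
    define a b where "a = real (card (A t \<inter> A s))" and "b = real (card (B t \<inter> B s))"
    have "card (A t \<inter> A s) \<le> card X" "card (B t \<inter> B s) \<le> card Y"
      using AB(1,2)[OF tT] X Y by (auto intro!: card_mono)
    then have ab: "a \<le> N" "b \<le> N" "0 \<le> a" "0 \<le> b" using X Y unfolding a_def b_def by linarith+
    have "N\<^sup>2 = (2 * K ^ 12) * (\<delta>\<^sup>2 * N\<^sup>2 / 2)" unfolding \<delta>2 using K by simp
    also have "\<dots> \<le> (2 * K ^ 12) * (a * b)" using t K by (intro mult_left_mono) (auto simp: T'_def a_def b_def)
    also have "\<dots> \<le> (K * K ^ 12) * (a * b)" using K ab by (intro mult_right_mono) auto
    finally have *: "N * N \<le> K ^ 13 * (a * b)" by (simp add: power2_eq_square flip: power_Suc)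
    have "K ^ 13 * (a * b) \<le> K ^ 13 * (a * N)" "K ^ 13 * (a * b) \<le> K ^ 13 * (N * b)"
      using ab K by (intro mult_left_mono mult_right_mono; simp)+
    then have "N * N \<le> N * (K ^ 13 * a)" "N * N \<le> N * (K ^ 13 * b)" using * by (simp_all add: mult_ac)
    then have "N \<le> K ^ 13 * a" "N \<le> K ^ 13 * b" using N by simp_all
    then show "N \<le> K ^ 13 * real (card (A t \<inter> A s))" "N \<le> K ^ 13 * real (card (B t \<inter> B s))"
      by (simp_all add: a_def b_def)
  qed
  \<comment> \<open>Relative to the popular index \<open>s\<close>, the other indices become dilations of the one set \<open>D\<close>.\<close>
  define D where "D = B s"
  have D: "finite D" "D \<subseteq> range (circ p)" "real (card D) \<le> N" "N \<le> K ^ 3 * real (card D)"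
  proof -
    have "card D \<le> card Y" using AB(2)[OF s(1)] Y by (auto simp: D_def intro: card_mono)
    then show "real (card D) \<le> N" using Y by linarith
  qed (use AB[OF s(1)] X Y in \<open>auto simp: D_def intro: finite_subset\<close>)
  have Dne: "D \<noteq> {}" using D N by auto
  have dil: "real (card (smul (m t * n s) ` D + uminus ` smul (n t * m s) ` D)) \<le> K ^ 61 * N"
       "real (card (D + uminus ` D)) \<le> K ^ 19 * N" if t: "t \<in> T'" for t
  proof -
    have tT: "t \<in> T" using t T' by auto
    have fA: "finite (A s)" "A s \<subseteq> range (circ p)" using AB(1)[OF s(1)] X by (auto intro: finite_subset)
    have "real (card (smul (m t) ` (A t \<inter> A s) + smul (n t) ` (B t \<inter> B s)))
        \<le> real (card (smul (m t) ` A t + smul (n t) ` B t))"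
      using AB(1,2)[OF tT] X Y by (intro card_sumset_mono) (auto intro: finite_subset)
    also note AB(5)[OF tT]
    finally have *: "real (card (smul (m t) ` (A t \<inter> A s) + smul (n t) ` (B t \<inter> B s))) \<le> K ^ 8 * N" .
    note dd = dilate_from_two_dilates[OF p K1 N mn(1)[OF s(1)] mn(2)[OF s(1)] mn(1)[OF tT] mn(2)[OF tT]
       fA(1) D(1) fA(2) D(2) Int_lower2[of "A t" "A s"] _ AB(3)[OF s(1)] big(1)[OF t], of "B t \<inter> B s"]
    show "real (card (smul (m t * n s) ` D + uminus ` smul (n t * m s) ` D)) \<le> K ^ 61 * N"
       "real (card (D + uminus ` D)) \<le> K ^ 19 * N"
      using dd big(2)[OF t] AB(5)[OF s(1)] * by (auto simp: D_def)
  qed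
  define L where "L = K ^ 64"
  have L1: "1 \<le> L" using K1 by (simp add: L_def)
  have KL: "K ^ i * N \<le> L * real (card D)" if "i \<le> 61" for i
  proof -
    have "K ^ i * N \<le> K ^ 61 * (K ^ 3 * real (card D))" using D K1 N that by (intro mult_mono power_increasing) auto
    then show ?thesis by (simp add: L_def flip: power_add mult.assoc)
  qed
  have "\<forall>t\<in>T. \<exists>x. x \<in> {0..<int p} \<and> int p dvd (m t * n s) * x - n t * m s"
  proof
    fix t assume t: "t \<in> T"
    have "prime (int p)" using p by simp
    then have "\<not> int p dvd m t * n s" using mn(1)[OF t] mn(2)[OF s(1)] by (simp add: prime_dvd_mult_iff)
    then obtain x where "x \<in> {0..<int p}" "int p dvd (m t * n s) * x - n t * m s"
      using solve_linear_congruence[OF p] by blast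
    then show "\<exists>x. x \<in> {0..<int p} \<and> int p dvd (m t * n s) * x - n t * m s" by blast
  qed
  then obtain \<xi> where \<xi>: "\<And>t. t \<in> T \<Longrightarrow> \<xi> t \<in> {0..<int p}"
    "\<And>t. t \<in> T \<Longrightarrow> int p dvd (m t * n s) * \<xi> t - n t * m s" by metis
  \<comment> \<open>this is where the ratios \<open>m t / n t\<close> have to be distinct\<close>
  have "inj_on \<xi> T"
  proof (rule inj_onI, rule ccontr)
    fix t t' assume t: "t \<in> T" "t' \<in> T" "\<xi> t = \<xi> t'" "t \<noteq> t'"
    have "int p dvd (m t' * n s) * ((m t * n s) * \<xi> t - n t * m s) - (m t * n s) * ((m t' * n s) * \<xi> t - n t' * m s)"
      by (rule dvd_diff[OF dvd_mult[OF \<xi>(2)[OF t(1)]] dvd_mult[OF \<xi>(2)[OF t(2), folded t(3)]]])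
    also have "\<dots> = (n s * m s) * (m t * n t' - m t' * n t)" by (simp add: algebra_simps)
    finally have "int p dvd (n s * m s) * (m t * n t' - m t' * n t)" .
    moreover have "prime (int p)" using p by simp
    ultimately show False using mn[OF s(1)] ratio[OF t(1,2,4)] by (simp add: prime_dvd_mult_iff)
  qed
  then have c\<Xi>: "card (\<xi> ` T') = card T'" using T' by (intro card_image) (rule inj_on_subset)
  show ?thesis
  proof (cases "card T' < 2")
    case True
    have "N \<le> K ^ 14 * real (card T')" by (rule cT')
    also have "\<dots> \<le> K ^ 14 * K" using True K by (intro mult_left_mono) auto
    also have "\<dots> = K ^ 15" by (simp add: eval_nat_numeral mult_ac)
    also have "\<dots> \<le> K ^ 3105" using K1 by (intro power_increasing) auto
    finally show ?thesis .
  next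
    case False
    then obtain t1 where t1: "t1 \<in> T'" by (metis card.empty equals0I zero_less_numeral)
    have "min ((real (card (\<xi> ` T')))\<^sup>2) (real p) * real (card D) \<le> L ^ 48 * ((real (card D))\<^sup>2 + real p)"
    proof (rule sum_product_phenomenon[OF p D(1) Dne D(2) L1])
      show "real (card (D + uminus ` D)) \<le> L * real (card D)" using dil(2)[OF t1] KL[of 19] by simp
      show "\<xi> ` T' \<subseteq> {0..<int p}" using \<xi>(1) T' by blast
      show "2 \<le> card (\<xi> ` T')" using False c\<Xi> by simp
      fix x assume "x \<in> \<xi> ` T'"
      then obtain t where t: "t \<in> T'" "x = \<xi> t" by auto
      then have tT: "t \<in> T" using T' by auto
      define a where "a = m t * n s"
      have "prime (int p)" using p by simp
      then have nd: "\<not> int p dvd a" using mn(1)[OF tT] mn(2)[OF s(1)] by (simp add: prime_dvd_mult_iff a_def)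
      have "smul a ` smul x ` D = smul (n t * m s) ` D"
        unfolding image_image smul_smul
        by (intro image_cong refl smul_cong[OF p0]) (use \<xi>(2)[OF tT] t D in \<open>auto simp: a_def\<close>)
      then have "smul a ` (D + uminus ` smul x ` D) = smul a ` D + uminus ` smul (n t * m s) ` D"
        by (simp add: smul_sumset smul_uminus_image)
      moreover have "card (smul a ` (D + uminus ` smul x ` D)) = card (D + uminus ` smul x ` D)"
      proof (rule card_smul[OF p nd])
        show "D + uminus ` smul x ` D \<subseteq> range (circ p)"
          using D(2) by (auto elim!: set_plus_elim intro!: range_circ_diff range_circ_smul)
      qed
      ultimately have "real (card (D + uminus ` smul x ` D)) \<le> K ^ 61 * N" using dil(1)[OF t(1)] by (simp add: a_def)
      then show "real (card (D + uminus ` smul x ` D)) \<le> L * real (card D)" using KL[of 61] by simp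
    qed
    then have main: "min ((real (card T'))\<^sup>2) (real p) * real (card D) \<le> K ^ 3072 * ((real (card D))\<^sup>2 + real p)"
      by (simp add: c\<Xi> L_def flip: power_mult)
    \<comment> \<open>Up to powers of \<open>K\<close> the left side of \<open>main\<close> has order \<open>N\<^sup>3\<close>, its right side only \<open>N\<^sup>2\<close>.\<close>
    have "N\<^sup>2 \<le> K ^ 28 * min ((real (card T'))\<^sup>2) (real p)"
    proof -
      have "N\<^sup>2 \<le> (K ^ 14 * real (card T'))\<^sup>2" using cT' N by (intro power_mono) auto
      then have 1: "N\<^sup>2 \<le> K ^ 28 * (real (card T'))\<^sup>2" by (simp add: power_mult_distrib flip: power_mult)
      have "K \<le> K ^ 28" using K1 by (intro self_le_power) auto
      then have "N\<^sup>2 \<le> K ^ 28 * real p" using Np by (meson mult_right_mono of_nat_0_le_iff order_trans)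
      with 1 show ?thesis by (simp add: min_def)
    qed
    then have "N\<^sup>2 * N \<le> (K ^ 28 * min ((real (card T'))\<^sup>2) (real p)) * (K ^ 3 * real (card D))"
      using D(4) N K1 by (intro mult_mono) auto
    also have "\<dots> = K ^ 31 * (min ((real (card T'))\<^sup>2) (real p) * real (card D))" by (simp add: mult_ac flip: power_add)
    also have "\<dots> \<le> K ^ 31 * (K ^ 3072 * ((real (card D))\<^sup>2 + real p))" using main K1 by (intro mult_left_mono) auto
    also have "\<dots> \<le> K ^ 31 * (K ^ 3072 * (K\<^sup>2 * N\<^sup>2))"
    proof (intro mult_left_mono)
      have "(real (card D))\<^sup>2 \<le> N\<^sup>2" using D(3) by (intro power_mono) auto
      then have "(real (card D))\<^sup>2 + real p \<le> N\<^sup>2 + K * N\<^sup>2" using pN by linarith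
      also have "\<dots> = (1 + K) * N\<^sup>2" by (simp add: algebra_simps)
      also have "\<dots> \<le> K\<^sup>2 * N\<^sup>2"
      proof (rule mult_right_mono)
        have "1 + K \<le> 2 * K" using K by simp
        also have "\<dots> \<le> K * K" using K by (intro mult_right_mono) auto
        finally show "1 + K \<le> K\<^sup>2" by (simp add: power2_eq_square)
      qed simp
      finally show "(real (card D))\<^sup>2 + real p \<le> K\<^sup>2 * N\<^sup>2" .
    qed (use K1 in auto)
    also have "\<dots> = N\<^sup>2 * (K ^ 31 * (K ^ 3072 * K ^ 2))" by (simp add: mult_ac)
    also have "K ^ 31 * (K ^ 3072 * K ^ 2) = K ^ 3105" by (simp flip: power_add)
    finally show ?thesis by (rule mult_left_le_imp_le) (use N in simp)
  qed
qed

section \<open>Additive energy of the parabola\<close>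

text \<open>
  The point \<open>P(y) + P(z) - P(x)\<close> modulo \<open>p\<close>, where \<open>P(x) = (x, x\<^sup>2)\<close>.
\<close>

definition parabola_key :: "nat \<Rightarrow> int \<times> int \<times> int \<Rightarrow> int \<times> int" where
  "parabola_key p = (\<lambda>(x, y, z). ((y + z - x) mod int p, (y\<^sup>2 + z\<^sup>2 - x\<^sup>2) mod int p))"

text \<open>
  The third additive energy of the points of the parabola over \<open>A\<close>.
\<close>

definition parabola_energy :: "nat \<Rightarrow> int set \<Rightarrow> nat" where
  "parabola_energy p A = collisions (parabola_key p) (A \<times> A \<times> A)"

text \<open>
  It vanishes modulo \<open>p\<close> exactly for the points of the parabola; the other keys will correspond to lines.
\<close>

definition parabola_offset :: "int \<times> int \<Rightarrow> int" where
  "parabola_offset w = snd w - (fst w)\<^sup>2"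

text \<open>
  If \<open>w = (u, v)\<close> is the key of \<open>(x, y, z)\<close>, then \<open>2(x - y)(u - y) = v - u\<^sup>2\<close>: in column \<open>y\<close>, the
  height \<open>1/(x - y)\<close> is a linear function of \<open>y\<close> that depends on \<open>w\<close> only. In this way keys become lines, and
  fibres of the key become points on these lines.
\<close>

lemma parabola_key_dvd:
  assumes "parabola_key p (x, y, z) = w"
  shows "int p dvd fst w - (y + z - x)" "int p dvd 2 * (x - y) * (fst w - y) - parabola_offset w"
proof -
  have 1: "int p dvd (y + z - x) - fst w" "int p dvd (y\<^sup>2 + z\<^sup>2 - x\<^sup>2) - snd w"
    using assms by (auto simp: parabola_key_def dvd_minus_mod)
  show 2: "int p dvd fst w - (y + z - x)" using 1(1) by (subst dvd_diff_commute)
  have "2 * (x - y) * (fst w - y) - parabola_offset w =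
     ((y\<^sup>2 + z\<^sup>2 - x\<^sup>2) - snd w) + (fst w - (y + z - x)) * (2 * (x - y) + (fst w + (y + z - x)))"
    by (simp add: parabola_offset_def power2_eq_square algebra_simps)
  then show "int p dvd 2 * (x - y) * (fst w - y) - parabola_offset w" using 1(2) 2 by simp
qed

text \<open>
  The columns in which the line of \<open>w\<close> passes through one of the points \<open>(t, 1/(x - t))\<close> with \<open>x\<close> in \<open>A\<close>.
\<close>

definition columns :: "nat \<Rightarrow> int set \<Rightarrow> int \<times> int \<Rightarrow> int set" where
  "columns p A w = {t \<in> A. \<exists>x\<in>A. int p dvd 2 * (x - t) * (fst w - t) - parabola_offset w}"

lemma fibre_le_columns:
  assumes p: "prime p" and A: "A \<subseteq> {0..<int p}" and w: "\<not> int p dvd parabola_offset w"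
  shows "card {q \<in> A \<times> A \<times> A. parabola_key p q = w} \<le> card (columns p A w)"
proof (rule card_inj_on_le[where f = "\<lambda>(x, y, z). y"])
  have finA: "finite A" using A finite_subset by blast
  then show "finite (columns p A w)" by (simp add: columns_def)
  show "(\<lambda>(x, y, z). y) ` {q \<in> A \<times> A \<times> A. parabola_key p q = w} \<subseteq> columns p A w"
    using parabola_key_dvd(2) by (fastforce simp: columns_def)
  show "inj_on (\<lambda>(x, y, z). y) {q \<in> A \<times> A \<times> A. parabola_key p q = w}"
  proof (rule inj_onI)
    fix q q' assume q: "q \<in> {q \<in> A \<times> A \<times> A. parabola_key p q = w}" "q' \<in> {q \<in> A \<times> A \<times> A. parabola_key p q = w}"
      and eq: "(\<lambda>(x, y, z). y) q = (\<lambda>(x, y, z). y) q'"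
    obtain x y z where xyz: "q = (x, y, z)" by (cases q)
    obtain x' z' where xyz': "q' = (x', y, z')" using eq by (cases q') (auto simp: xyz)
    have mem: "x \<in> A" "z \<in> A" "x' \<in> A" "z' \<in> A" using q by (auto simp: xyz xyz')
    have k: "parabola_key p (x, y, z) = w" "parabola_key p (x', y, z') = w" using q by (auto simp: xyz xyz')
    note d = parabola_key_dvd[OF k(1)] parabola_key_dvd[OF k(2)]
    have nd: "\<not> int p dvd 2 * (fst w - y)"
    proof
      assume "int p dvd 2 * (fst w - y)"
      then have "int p dvd 2 * (x - y) * (fst w - y)" by (metis dvd_mult2 mult.assoc mult.commute)
      then have "int p dvd 2 * (x - y) * (fst w - y) - (2 * (x - y) * (fst w - y) - parabola_offset w)" using d(2) by (rule dvd_diff)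
      then show False using w by simp
    qed
    have "int p dvd (2 * (x - y) * (fst w - y) - parabola_offset w) - (2 * (x' - y) * (fst w - y) - parabola_offset w)"
      using d(2,4) by (rule dvd_diff)
    then have "int p dvd (2 * (fst w - y)) * (x - x')" by (simp add: algebra_simps)
    then have "int p dvd x - x'" using prime_dvd_multD_int[OF p _ nd] by blast
    then have x: "x = x'" using residues_eqI mem A by blast
    have "int p dvd (fst w - (y + z' - x')) - (fst w - (y + z - x))" by (rule dvd_diff[OF d(3) d(1)])
    then have "int p dvd z - z'" by (simp add: x)
    then have "z = z'" using residues_eqI mem A by blast
    with x show "q = q'" by (simp add: xyz xyz')
  qed
qed

text \<open>
  A key on the parabola only arises from a cancellation of two of the three points.
\<close>

lemma flat_keys:
  assumes p: "prime p" "p \<noteq> 2" and A: "A \<subseteq> {0..<int p}" and w: "int p dvd parabola_offset w"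
    and q: "(x, y, z) \<in> A \<times> A \<times> A" "parabola_key p (x, y, z) = w"
  shows "(x = y \<and> int p dvd z - fst w) \<or> (x = z \<and> int p dvd y - fst w)"
proof -
  note d = parabola_key_dvd[OF q(2)]
  have "int p dvd (2 * (x - y) * (fst w - y) - parabola_offset w) + parabola_offset w" using d(2) w by (rule dvd_add)
  then have "int p dvd 2 * ((x - y) * (fst w - y))" by (simp only: mult.assoc diff_add_cancel)
  then have "int p dvd (x - y) * (fst w - y)" using prime_dvd_multD_int odd_prime_not_dvd_2 p by blast
  then consider "int p dvd x - y" | "int p dvd fst w - y" using prime_dvd_multD_int[OF p(1)] by blast
  then show ?thesis
  proof cases
    case 1
    then have "x = y" using residues_eqI q A by blast
    moreover have "int p dvd z - fst w" using d(1) \<open>x = y\<close> by (subst dvd_diff_commute) simp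
    ultimately show ?thesis by blast
  next
    case 2
    have "int p dvd (fst w - y) - (fst w - (y + z - x))" using 2 d(1) by (rule dvd_diff)
    then have "int p dvd z - x" by simp
    then have "z = x" using residues_eqI q A by blast
    moreover have "int p dvd y - fst w" using 2 by (subst dvd_diff_commute)
    ultimately show ?thesis by blast
  qed
qed

lemma fibre_le:
  assumes p: "prime p" "p \<noteq> 2" and A: "A \<subseteq> {0..<int p}"
  shows "card {q \<in> A \<times> A \<times> A. parabola_key p q = w} \<le> 2 * card A"
proof (cases "int p dvd parabola_offset w")
  case False
  have "card {q \<in> A \<times> A \<times> A. parabola_key p q = w} \<le> card (columns p A w)"
    by (rule fibre_le_columns[OF p(1) A False])
  also have "\<dots> \<le> card A" using A by (intro card_mono) (auto simp: columns_def intro: finite_subset)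
  finally show ?thesis by simp
next
  case True
  have finA: "finite A" using A finite_subset by blast
  define z where "z = fst w mod int p"
  have z: "u = z" if "u \<in> A" "int p dvd u - fst w" for u
  proof -
    have "u mod int p = fst w mod int p" using that by (simp add: mod_eq_dvd_iff)
    moreover have "u mod int p = u" using that A by (intro mod_pos_pos_trivial) auto
    ultimately show ?thesis by (simp add: z_def)
  qed
  have "{q \<in> A \<times> A \<times> A. parabola_key p q = w} \<subseteq> (\<lambda>x. (x, x, z)) ` A \<union> (\<lambda>x. (x, z, x)) ` A"
    using flat_keys[OF p A True] z by (fastforce simp: image_iff)
  then have "card {q \<in> A \<times> A \<times> A. parabola_key p q = w} \<le> card ((\<lambda>x. (x, x, z)) ` A \<union> (\<lambda>x. (x, z, x)) ` A)"
    using finA by (intro card_mono) auto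
  also have "\<dots> \<le> card ((\<lambda>x. (x, x, z)) ` A) + card ((\<lambda>x. (x, z, x)) ` A)" by (rule card_Un_le)
  also have "\<dots> \<le> card A + card A" using finA by (intro add_mono card_image_le)
  finally show ?thesis by simp
qed

text \<open>
  Every key has at most \<open>2|A|\<close> preimages. For \<open>|A|\<close> of order \<open>\<surd>p\<close> an approximate subfield of that size would
  attain this order of magnitude.
\<close>

lemma parabola_energy_le:
  assumes p: "prime p" "p \<noteq> 2" and A: "A \<subseteq> {0..<int p}"
  shows "real (parabola_energy p A) \<le> 2 * real (card A) ^ 4"
proof -
  have fin: "finite (A \<times> A \<times> A)" using A finite_subset by blast
  have "real (parabola_energy p A) = (\<Sum>y\<in>parabola_key p ` (A \<times> A \<times> A). (fibre_card (parabola_key p) (A \<times> A \<times> A) y)\<^sup>2)"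
    unfolding parabola_energy_def by (rule sum_fibre_card_power2[OF fin, symmetric])
  also have "\<dots> \<le> 2 * real (card A) * real (card {q \<in> A \<times> A \<times> A. parabola_key p q \<in> parabola_key p ` (A \<times> A \<times> A)})"
  proof (rule sum_power2_fibres_le[OF fin])
    show "fibre_card (parabola_key p) (A \<times> A \<times> A) w \<le> 2 * real (card A)" for w
      unfolding fibre_card_def using fibre_le[OF p A, of w] by linarith
  qed auto
  also have "{q \<in> A \<times> A \<times> A. parabola_key p q \<in> parabola_key p ` (A \<times> A \<times> A)} = A \<times> A \<times> A" by auto
  finally show ?thesis by (simp add: card_cartesian_product eval_nat_numeral)
qed

lemma flat_energy_le:
  assumes p: "prime p" "p \<noteq> 2" and A: "A \<subseteq> {0..<int p}"
  defines "W0 \<equiv> {w \<in> parabola_key p ` (A \<times> A \<times> A). int p dvd parabola_offset w}"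
  shows "(\<Sum>w\<in>W0. (fibre_card (parabola_key p) (A \<times> A \<times> A) w)\<^sup>2) \<le> 4 * real (card A) ^ 3"
proof -
  have finA: "finite A" using A finite_subset by blast
  then have fin: "finite (A \<times> A \<times> A)" by simp
  have "(\<Sum>w\<in>W0. (fibre_card (parabola_key p) (A \<times> A \<times> A) w)\<^sup>2)
      \<le> 2 * real (card A) * real (card {q \<in> A \<times> A \<times> A. parabola_key p q \<in> W0})"
  proof (rule sum_power2_fibres_le[OF fin])
    show "fibre_card (parabola_key p) (A \<times> A \<times> A) w \<le> 2 * real (card A)" for w
      unfolding fibre_card_def using fibre_le[OF p A, of w] by linarith
  qed (auto simp: W0_def)
  also have "card {q \<in> A \<times> A \<times> A. parabola_key p q \<in> W0} \<le> 2 * (card A * card A)"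
  proof -
    have "{q \<in> A \<times> A \<times> A. parabola_key p q \<in> W0} \<subseteq> (\<lambda>(x, y). (x, x, y)) ` (A \<times> A) \<union> (\<lambda>(x, y). (x, y, x)) ` (A \<times> A)"
      using flat_keys[OF p A] by (fastforce simp: W0_def image_iff)
    then have "card {q \<in> A \<times> A \<times> A. parabola_key p q \<in> W0}
        \<le> card ((\<lambda>(x, y). (x, x, y)) ` (A \<times> A) \<union> (\<lambda>(x, y). (x, y, x)) ` (A \<times> A))"
      using finA by (intro card_mono) auto
    also have "\<dots> \<le> card ((\<lambda>(x, y). (x, x, y)) ` (A \<times> A)) + card ((\<lambda>(x, y). (x, y, x)) ` (A \<times> A))" by (rule card_Un_le)
    also have "\<dots> \<le> card (A \<times> A) + card (A \<times> A)" using finA by (intro add_mono card_image_le) auto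
    finally show ?thesis by (simp add: card_cartesian_product)
  qed
  then have "2 * real (card A) * real (card {q \<in> A \<times> A \<times> A. parabola_key p q \<in> W0})
     \<le> 2 * real (card A) * (2 * (real (card A) * real (card A)))"
  proof (intro mult_left_mono)
    assume "card {q \<in> A \<times> A \<times> A. parabola_key p q \<in> W0} \<le> 2 * (card A * card A)"
    then have "real (card {q \<in> A \<times> A \<times> A. parabola_key p q \<in> W0}) \<le> real (2 * (card A * card A))"
      by (simp only: of_nat_le_iff)
    then show "real (card {q \<in> A \<times> A \<times> A. parabola_key p q \<in> W0}) \<le> 2 * (real (card A) * real (card A))"
      by simp
  qed simp
  finally show ?thesis by (simp add: eval_nat_numeral)
qed

text \<open>
  A large energy produces many lines with many columns. Fix two columns \<open>t0\<close>, \<open>t1\<close> that many of the lines meet.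
  A line is determined by its heights in these columns, so the lines form a dense graph in the product of the
  two sets of heights. For a third column \<open>t\<close>, collinearity says that
  \<open>(t1 - t) z0 + (t - t0) z1\<close> is \<open>t1 - t0\<close> times a height in column \<open>t\<close>, hence lies in a set of size \<open>|A|\<close>.
  This is the configuration excluded by \<open>few_rich_dilates\<close>; the exponent is 3 times 3105 since that result
  is applied with \<open>K\<^sup>3\<close> for \<open>K\<close>.
\<close>

lemma large_parabola_energy:
  fixes K N :: real
  assumes p: "prime p" "p \<noteq> 2" and A: "A \<subseteq> {0..<int p}" and K: "4096 \<le> K"
    and N: "N = real (card A)" "0 < N" and pN: "real p \<le> K * N\<^sup>2" and Np: "N\<^sup>2 \<le> K * real p"
    and J: "N ^ 4 \<le> K * real (parabola_energy p A)"
  shows "N \<le> K ^ 9315"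
proof (rule ccontr)
  assume "\<not> N \<le> K ^ 9315"
  moreover have K1: "1 \<le> K" using K by simp
  then have "K ^ 2 \<le> K ^ 9315" by (intro power_increasing) auto
  moreover have "4096 * K \<le> K ^ 2" using K by (simp add: power2_eq_square)
  ultimately have NK: "4096 * K \<le> N" by linarith
  have finA: "finite A" using A finite_subset by blast
  define key where "key = parabola_key p"
  define V where "V = A \<times> A \<times> A"
  define r where "r = fibre_card key V"
  define W where "W = key ` V"
  define W0 where "W0 = {w \<in> W. int p dvd parabola_offset w}"
  define W1 where "W1 = {w \<in> W. \<not> int p dvd parabola_offset w}"
  define C where "C = columns p A"
  define c where "c = (\<lambda>w. real (card (C w)))"
  have finV: "finite V" using finA by (simp add: V_def)
  have finW: "finite W" "finite W0" "finite W1" using finV by (auto simp: W_def W0_def W1_def)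
  have CA: "C w \<subseteq> A" for w by (auto simp: C_def columns_def)
  have finC: "finite (C w)" for w using CA finA finite_subset by blast
  have cV: "real (card V) = N ^ 3" by (simp add: V_def card_cartesian_product N power3_eq_cube)
  have "real (card W) \<le> N ^ 3" unfolding cV[symmetric] W_def using finV by (simp add: card_image_le)
  moreover have "card W1 \<le> card W" using finW by (intro card_mono) (auto simp: W1_def)
  ultimately have cW1: "real (card W1) \<le> N ^ 3" by linarith
  have "(\<Sum>w\<in>W. (r w)\<^sup>2) = real (parabola_energy p A)"
    unfolding W_def r_def parabola_energy_def key_def V_def using finV by (intro sum_fibre_card_power2) (simp add: V_def)
  then have "N ^ 4 / K \<le> (\<Sum>w\<in>W. (r w)\<^sup>2)" using J K by (simp add: divide_le_eq mult.commute)
  also have "\<dots> = (\<Sum>w\<in>W - W1. (r w)\<^sup>2) + (\<Sum>w\<in>W1. (r w)\<^sup>2)"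
    using finW by (intro sum.subset_diff) (auto simp: W1_def)
  also have "W - W1 = W0" by (auto simp: W0_def W1_def)
  also have "(\<Sum>w\<in>W0. (r w)\<^sup>2) \<le> 4 * N ^ 3"
    unfolding W0_def W_def r_def key_def V_def N by (rule flat_energy_le[OF p A])
  also have "4 * N ^ 3 \<le> N ^ 4 / (2 * K)"
  proof -
    have "8 * K * N ^ 3 \<le> N * N ^ 3" using NK K N by (intro mult_right_mono) auto
    then show ?thesis using K by (simp add: field_simps eval_nat_numeral)
  qed
  finally have "N ^ 4 / K - N ^ 4 / (2 * K) \<le> (\<Sum>w\<in>W1. (r w)\<^sup>2)" by simp
  moreover have "N ^ 4 / K - N ^ 4 / (2 * K) = N ^ 4 / (2 * K)" using K by (simp add: field_simps)
  ultimately have r2: "N ^ 4 / (2 * K) \<le> (\<Sum>w\<in>W1. (r w)\<^sup>2)" by simp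
  \<comment> \<open>Cauchy-Schwarz passes to the third moment, which is what a choice of three columns needs.\<close>
  have r0: "0 \<le> r w" for w by (simp add: r_def fibre_card_def)
  have "(\<Sum>w\<in>W1. r w) \<le> (\<Sum>w\<in>W. r w)" using finW r0 by (intro sum_mono2) (auto simp: W1_def)
  also have "\<dots> = N ^ 3" using sum_fibre_card[OF finV, of key] by (simp add: W_def r_def cV)
  finally have r1: "(\<Sum>w\<in>W1. r w) \<le> N ^ 3" .
  have "(N ^ 4 / (2 * K))\<^sup>2 \<le> (\<Sum>w\<in>W1. (r w)\<^sup>2)\<^sup>2" using r2 K N by (intro power_mono) auto
  also have "\<dots> \<le> (\<Sum>w\<in>W1. r w) * (\<Sum>w\<in>W1. (r w) ^ 3)" using r0 by (intro power2_sum_power2_le)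
  also have "\<dots> \<le> N ^ 3 * (\<Sum>w\<in>W1. (r w) ^ 3)" using r1 r0 by (intro mult_right_mono sum_nonneg) auto
  also have "\<dots> \<le> N ^ 3 * (\<Sum>w\<in>W1. (c w) ^ 3)"
  proof (intro mult_left_mono sum_mono power_mono)
    fix w assume "w \<in> W1"
    then have "\<not> int p dvd parabola_offset w" by (simp add: W1_def)
    from fibre_le_columns[OF p(1) A this] show "r w \<le> c w"
      by (simp add: r_def c_def C_def fibre_card_def key_def V_def)
  qed (use r0 N in auto)
  finally have "N ^ 3 * (N ^ 5 / (4 * K\<^sup>2)) \<le> N ^ 3 * (\<Sum>w\<in>W1. (c w) ^ 3)"
    by (simp add: power_divide power_mult_distrib flip: power_mult power_add)
  then have c3: "N ^ 5 / (4 * K\<^sup>2) \<le> (\<Sum>w\<in>W1. (c w) ^ 3)"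
    by (rule mult_left_le_imp_le) (use N in simp)
  define D where "D = (\<lambda>w. distinct_triples (C w))"
  have "(\<Sum>w\<in>W1. (c w) ^ 3) \<le> (\<Sum>w\<in>W1. 2 * real (card (D w)) + 216)"
    unfolding c_def D_def using finC by (intro sum_mono power3_card_le_distinct_triples)
  also have "\<dots> = 2 * (\<Sum>w\<in>W1. real (card (D w))) + 216 * real (card W1)"
    by (simp add: sum.distrib sum_distrib_left)
  also have "216 * real (card W1) \<le> N ^ 5 / (8 * K\<^sup>2)"
  proof -
    have "(4096 * K)\<^sup>2 \<le> N\<^sup>2" using NK K by (intro power_mono) auto
    then have "16777216 * K\<^sup>2 \<le> N\<^sup>2" by (simp add: power_mult_distrib)
    moreover have "0 \<le> K\<^sup>2" by simp
    ultimately have "1728 * K\<^sup>2 \<le> N\<^sup>2" by linarith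
    then have "1728 * K\<^sup>2 * N ^ 3 \<le> N\<^sup>2 * N ^ 3" using N by (intro mult_right_mono) auto
    then have "1728 * K\<^sup>2 * N ^ 3 \<le> N ^ 5" by (simp flip: power_add)
    then have "216 * N ^ 3 \<le> N ^ 5 / (8 * K\<^sup>2)" using K by (simp add: field_simps)
    then show ?thesis using cW1 by linarith
  qed
  finally have "N ^ 5 / (4 * K\<^sup>2) - N ^ 5 / (8 * K\<^sup>2) \<le> 2 * (\<Sum>w\<in>W1. real (card (D w)))" using c3 by linarith
  moreover have "N ^ 5 / (4 * K\<^sup>2) - N ^ 5 / (8 * K\<^sup>2) = 2 * (N ^ 5 / (16 * K\<^sup>2))" using K by (simp add: field_simps)
  ultimately have sumD: "N ^ 5 / (16 * K\<^sup>2) \<le> (\<Sum>w\<in>W1. real (card (D w)))" by linarith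
  define g where "g = (\<lambda>q t. real (card {w \<in> W1. (q, t) \<in> D w}))"
  have DA: "D w \<subseteq> (A \<times> A) \<times> A" for w using CA[of w] by (auto simp: D_def distinct_triples_def)
  have "(\<Sum>w\<in>W1. real (card (D w))) = (\<Sum>w\<in>W1. \<Sum>q\<in>A \<times> A. real (card {t \<in> A. (q, t) \<in> D w}))"
    using finA by (intro sum.cong refl card_eq_sum_fibres DA) auto
  also have "\<dots> = (\<Sum>q\<in>A \<times> A. \<Sum>w\<in>W1. real (card {t \<in> A. (q, t) \<in> D w}))" by (rule sum.swap)
  also have "\<dots> = (\<Sum>q\<in>A \<times> A. \<Sum>t\<in>A. g q t)" unfolding g_def by (intro sum.cong refl double_count finW finA)
  finally have "N ^ 5 / (16 * K\<^sup>2) \<le> (\<Sum>q\<in>A \<times> A. \<Sum>t\<in>A. g q t)" using sumD by simp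
  moreover have "(\<Sum>q\<in>A \<times> A. N ^ 3 / (16 * K\<^sup>2)) = N ^ 5 / (16 * K\<^sup>2)"
    by (simp add: card_cartesian_product N eval_nat_numeral)
  ultimately have "(\<Sum>q\<in>A \<times> A. N ^ 3 / (16 * K\<^sup>2)) \<le> (\<Sum>q\<in>A \<times> A. \<Sum>t\<in>A. g q t)"
    by (simp only:)
  moreover have "A \<times> A \<noteq> {}" "finite (A \<times> A)" using N finA by auto
  \<comment> \<open>two columns \<open>t0\<close>, \<open>t1\<close> through which many rich lines pass, together with a third column\<close>
  ultimately obtain q where q: "q \<in> A \<times> A" "N ^ 3 / (16 * K\<^sup>2) \<le> (\<Sum>t\<in>A. g q t)"
    using ex_ge_average by blast
  obtain t0 t1 where t01: "q = (t0, t1)" by (cases q)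
  have t0A: "t0 \<in> A" and t1A: "t1 \<in> A" using q t01 by auto
  define Wt where "Wt = (\<lambda>t. {w \<in> W1. (q, t) \<in> D w})"
  have Wt: "w \<in> W1 \<and> t0 \<in> C w \<and> t1 \<in> C w \<and> t \<in> C w \<and> t0 \<noteq> t1 \<and> t0 \<noteq> t \<and> t1 \<noteq> t" if "w \<in> Wt t" for w t
    using that by (auto simp: Wt_def D_def distinct_triples_def t01)
  have finWt: "finite (Wt t)" for t using finW by (simp add: Wt_def)
  have gWt: "g q t = real (card (Wt t))" for t by (simp add: g_def Wt_def)
  have "0 < N ^ 3 / (16 * K\<^sup>2)" using N K by simp
  then have "0 < (\<Sum>t\<in>A. g q t)" using q(2) by linarith
  then obtain t' where "t' \<in> A" "g q t' \<noteq> 0" by (metis less_irrefl sum.neutral)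
  then have "Wt t' \<noteq> {}" using gWt by auto
  then have t01ne: "t0 \<noteq> t1" using Wt by blast
  \<comment> \<open>a modular inverse, and the height \<open>h w t\<close> at which the line of \<open>w\<close> meets column \<open>t\<close>\<close>
  have "\<forall>a. \<exists>b. \<not> int p dvd a \<longrightarrow> int p dvd a * b - 1"
    using solve_linear_congruence[OF p(1)] by blast
  then have "\<exists>iv. \<forall>a. \<not> int p dvd a \<longrightarrow> int p dvd a * iv a - 1"
    by (rule choice)
  then obtain iv where iv: "\<And>a. \<not> int p dvd a \<Longrightarrow> int p dvd a * iv a - 1" by blast
  have p0: "0 < p" using p(1) prime_gt_0_nat by blast
  have pm: "prime (int p)" using p(1) by simp
  define h where "h = (\<lambda>w t. circ p (2 * (fst w - t) * iv (parabola_offset w)))"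
  define Z where "Z = (\<lambda>t. (\<lambda>x. circ p (iv (x - t))) ` A)"
  have hZ: "h w t \<in> Z t" if w: "w \<in> W1" and t: "t \<in> C w" for w t
  proof -
    obtain x where x: "x \<in> A" "int p dvd 2 * (x - t) * (fst w - t) - parabola_offset w"
      using t by (auto simp: C_def columns_def)
    have nw: "\<not> int p dvd parabola_offset w" using w by (simp add: W1_def)
    define k where "k = iv (parabola_offset w)"
    define l where "l = iv (x - t)"
    have k: "int p dvd parabola_offset w * k - 1" unfolding k_def by (rule iv[OF nw])
    have nx: "\<not> int p dvd x - t"
    proof
      assume "int p dvd x - t"
      then have "int p dvd 2 * (x - t) * (fst w - t)" by (rule dvd_mult2[OF dvd_mult])
      then have "int p dvd 2 * (x - t) * (fst w - t) - (2 * (x - t) * (fst w - t) - parabola_offset w)" using x(2) by (rule dvd_diff)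
      then show False using nw by simp
    qed
    have l: "int p dvd (x - t) * l - 1" unfolding l_def by (rule iv[OF nx])
    have "2 * (fst w - t) * k - l = (2 * (x - t) * (fst w - t) - parabola_offset w) * (k * l)
        - ((x - t) * l - 1) * (2 * (fst w - t) * k) + (parabola_offset w * k - 1) * l"
      by (simp add: algebra_simps)
    also have "int p dvd \<dots>"
      by (rule dvd_add[OF dvd_diff[OF dvd_mult2[OF x(2)] dvd_mult2[OF l]] dvd_mult2[OF k]])
    finally have "h w t = circ p l" unfolding h_def k_def[symmetric] using circ_eq_iff[OF p0] by blast
    then show ?thesis using x(1) by (auto simp: Z_def l_def)
  qed
  \<comment> \<open>collinearity of the heights in three columns\<close>
  have hlin: "smul (t1 - t) (h w t0) + smul (t - t0) (h w t1) = smul (t1 - t0) (h w t)" for w t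
    unfolding h_def smul_circ circ_add[symmetric] by (rule arg_cong[where f = "circ p"]) (simp add: algebra_simps)
  \<comment> \<open>two points determine a line\<close>
  have hinj: "inj_on (\<lambda>w. (h w t0, h w t1)) W1"
  proof (rule inj_onI)
    fix w w' assume w: "w \<in> W1" "w' \<in> W1" and eq: "(h w t0, h w t1) = (h w' t0, h w' t1)"
    obtain u v where uv: "w = (u, v)" by (cases w)
    obtain u' v' where uv': "w' = (u', v')" by (cases w')
    have nw: "\<not> int p dvd parabola_offset w" "\<not> int p dvd parabola_offset w'" using w by (auto simp: W1_def)
    define k k' where "k = iv (parabola_offset w)" and "k' = iv (parabola_offset w')"
    have k: "int p dvd parabola_offset w * k - 1" "int p dvd parabola_offset w' * k' - 1" unfolding k_def k'_def by (intro iv nw)+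
    have e0: "int p dvd 2 * (u - t0) * k - 2 * (u' - t0) * k'" and e1: "int p dvd 2 * (u - t1) * k - 2 * (u' - t1) * k'"
      using eq circ_eq_iff[OF p0] by (auto simp: h_def uv uv' k_def k'_def)
    have n2: "\<not> int p dvd 2" using odd_prime_not_dvd_2 p by blast
    have nt: "\<not> int p dvd t1 - t0" using residues_eqI[of p t1 t0] t0A t1A A t01ne by blast
    have "int p dvd (2 * (u - t0) * k - 2 * (u' - t0) * k') - (2 * (u - t1) * k - 2 * (u' - t1) * k')"
      using e0 e1 by (rule dvd_diff)
    also have "\<dots> = 2 * ((t1 - t0) * (k - k'))" by (simp add: algebra_simps)
    finally have kk: "int p dvd k - k'" using prime_dvd_multD_int[OF p(1)] n2 nt by blast
    have nk: "\<not> int p dvd k"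
    proof
      assume "int p dvd k"
      then have "int p dvd parabola_offset w * k - (parabola_offset w * k - 1)" by (rule dvd_diff[OF dvd_mult k(1)])
      then have "int p dvd 1" by simp
      then show False using not_prime_unit pm by blast
    qed
    have "int p dvd (2 * (u - t0) * k - 2 * (u' - t0) * k') - (k - k') * (2 * (u' - t0))"
      by (rule dvd_diff[OF e0 dvd_mult2[OF kk]])
    also have "\<dots> = 2 * (k * (u - u'))" by (simp add: algebra_simps)
    finally have "int p dvd u - u'" using prime_dvd_multD_int[OF p(1)] n2 nk by blast
    moreover have Wr: "u \<in> {0..<int p}" "u' \<in> {0..<int p}" "v \<in> {0..<int p}" "v' \<in> {0..<int p}"
      using w p0 by (auto simp: W1_def W_def key_def parabola_key_def uv uv')
    ultimately have u: "u = u'" using residues_eqI by blast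
    have "int p dvd (parabola_offset w * k - 1) * parabola_offset w' - (parabola_offset w' * k' - 1) * parabola_offset w - (k - k') * (parabola_offset w * parabola_offset w')"
      by (rule dvd_diff[OF dvd_diff[OF dvd_mult2[OF k(1)] dvd_mult2[OF k(2)]] dvd_mult2[OF kk]])
    also have "\<dots> = parabola_offset w - parabola_offset w'" by (simp add: algebra_simps)
    finally have "int p dvd v - v'" by (simp add: parabola_offset_def uv uv' u)
    then have "v = v'" using residues_eqI Wr by blast
    with u show "w = w'" by (simp add: uv uv')
  qed
  have finZ: "finite (Z t)" for t using finA by (simp add: Z_def)
  have cZ: "real (card (Z t)) \<le> N" for t unfolding Z_def N using finA by (simp add: card_image_le)
  have rZ: "Z t \<subseteq> range (circ p)" for t by (auto simp: Z_def)
  define G where "G = (\<lambda>t. (\<lambda>w. (h w t0, h w t1)) ` Wt t)"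
  have GZ: "G t \<subseteq> Z t0 \<times> Z t1" for t using hZ Wt by (auto simp: G_def)
  have cG: "card (G t) = card (Wt t)" for t
    unfolding G_def by (intro card_image inj_on_subset[OF hinj]) (auto simp: Wt_def)
  have gN: "g q t \<le> N\<^sup>2" for t
  proof -
    have "card (G t) \<le> card (Z t0 \<times> Z t1)" using GZ finZ by (intro card_mono) auto
    then have "real (card (G t)) \<le> real (card (Z t0)) * real (card (Z t1))"
      by (simp add: card_cartesian_product flip: of_nat_mult)
    also have "\<dots> \<le> N * N" using cZ N by (intro mult_mono) auto
    finally show ?thesis by (simp add: gWt cG power2_eq_square)
  qed
  define T where "T = {t \<in> A. N\<^sup>2 / (32 * K\<^sup>2) \<le> g q t}"
  have T: "T \<subseteq> A" "finite T" using finA by (auto simp: T_def)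
  have "(\<Sum>t\<in>A. g q t) = (\<Sum>t\<in>A - T. g q t) + (\<Sum>t\<in>T. g q t)" using T finA by (intro sum.subset_diff) auto
  also have "(\<Sum>t\<in>T. g q t) \<le> (\<Sum>t\<in>T. N\<^sup>2)" using gN by (intro sum_mono)
  also have "(\<Sum>t\<in>A - T. g q t) \<le> (\<Sum>t\<in>A - T. N\<^sup>2 / (32 * K\<^sup>2))" by (intro sum_mono) (auto simp: T_def)
  also have "\<dots> \<le> (\<Sum>t\<in>A. N\<^sup>2 / (32 * K\<^sup>2))" using finA by (intro sum_mono2) auto
  finally have "N ^ 3 / (16 * K\<^sup>2) \<le> N * (N\<^sup>2 / (32 * K\<^sup>2)) + real (card T) * N\<^sup>2"
    using q(2) by (simp add: N)
  moreover have "N ^ 3 / (16 * K\<^sup>2) = N\<^sup>2 * (N / (32 * K\<^sup>2)) + N * (N\<^sup>2 / (32 * K\<^sup>2))"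
    using K by (simp add: field_simps eval_nat_numeral)
  ultimately have "N\<^sup>2 * (N / (32 * K\<^sup>2)) \<le> real (card T) * N\<^sup>2" by linarith
  then have "N\<^sup>2 * (N / (32 * K\<^sup>2)) \<le> N\<^sup>2 * real (card T)" by (simp only: mult.commute)
  then have cT: "N / (32 * K\<^sup>2) \<le> real (card T)" by (rule mult_left_le_imp_le) (use N in simp)
  have K3: "32 * K\<^sup>2 \<le> K ^ 3" using K by (simp add: power2_eq_square power3_eq_cube)
  have KK3: "K \<le> K ^ 3" using K1 by (intro self_le_power) auto
  have "N \<le> (K ^ 3) ^ 3105"
  proof (rule few_rich_dilates[OF p(1), where m = "\<lambda>t. t1 - t" and n = "\<lambda>t. t - t0" and G = G
        and S = "\<lambda>t. smul (t1 - t0) ` Z t" and X = "Z t0" and Y = "Z t1" and T = T])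
    show "4096 \<le> K ^ 3" using K KK3 by linarith
    show "real p \<le> K ^ 3 * N\<^sup>2" using pN KK3 by (meson mult_right_mono order_trans zero_le_power2)
    show "N\<^sup>2 \<le> K ^ 3 * real p" using Np KK3 by (meson mult_right_mono order_trans of_nat_0_le_iff)
    have "N \<le> (32 * K\<^sup>2) * real (card T)" using cT K by (simp add: divide_le_eq mult.commute)
    also have "\<dots> \<le> K ^ 3 * real (card T)" using K3 by (intro mult_right_mono) auto
    finally show "N \<le> K ^ 3 * real (card T)" .
    show "real (card (smul (t1 - t0) ` Z t)) \<le> N" for t
      using cZ[of t] card_image_le[OF finZ[of t], of "smul (t1 - t0)"] by linarith
    fix t assume t: "t \<in> T"
    have gt: "N\<^sup>2 / (32 * K\<^sup>2) \<le> g q t" using t by (simp add: T_def)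
    have "0 < N\<^sup>2 / (32 * K\<^sup>2)" using N K by simp
    then have "Wt t \<noteq> {}" using gt gWt by auto
    then have ne: "t0 \<noteq> t" "t1 \<noteq> t" using Wt by blast+
    show "\<not> int p dvd t1 - t" "\<not> int p dvd t - t0" using residues_eqI t0A t1A t T A ne by (metis subsetD)+
    have "N\<^sup>2 \<le> (32 * K\<^sup>2) * real (card (G t))" using gt K by (simp add: gWt cG divide_le_eq mult.commute)
    also have "\<dots> \<le> K ^ 3 * real (card (G t))" using K3 by (intro mult_right_mono) auto
    finally show "N\<^sup>2 \<le> K ^ 3 * real (card (G t))" .
    show "smul (t1 - t) x + smul (t - t0) y \<in> smul (t1 - t0) ` Z t" if xy: "(x, y) \<in> G t" for x y
    proof -
      obtain w where w: "w \<in> Wt t" "x = h w t0" "y = h w t1" using xy by (auto simp: G_def)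
      then have "smul (t1 - t) x + smul (t - t0) y = smul (t1 - t0) (h w t)" using hlin by simp
      then show ?thesis using hZ Wt[OF w(1)] by auto
    qed
    fix t' assume t': "t' \<in> T" "t \<noteq> t'"
    have "(t1 - t) * (t' - t0) - (t1 - t') * (t - t0) = (t1 - t0) * (t' - t)" by (simp add: algebra_simps)
    moreover have "\<not> int p dvd t1 - t0" "\<not> int p dvd t' - t"
      using residues_eqI t0A t1A t t' T A t01ne by (metis subsetD)+
    ultimately show "\<not> int p dvd (t1 - t) * (t' - t0) - (t1 - t') * (t - t0)"
      using prime_dvd_mult_iff[OF pm] by simp
  qed (use N finZ cZ rZ T GZ in auto)
  then show False using \<open>\<not> N \<le> K ^ 9315\<close> by (simp flip: power_mult)
qed

text \<open>
  A larger energy would contradict the estimate for large energies with \<open>K\<close> a small power of \<open>p\<close>: that power exceeds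
  the constants, yet its 9315-th power stays well below the square root of \<open>p\<close>.
\<close>

lemma parabola_energy_at_half:
  fixes L1 L :: real
  assumes p: "prime p" "p \<noteq> 2" and A: "A \<subseteq> {0..<int p}" and L1: "0 < L1"
    and X: "4096 \<le> X" "1 / L1 \<le> X" "1 / L1\<^sup>2 \<le> X" "L\<^sup>2 \<le> X" and pX: "X ^ 20000 \<le> real p"
    and cA: "L1 * real p powr (1 / 2) \<le> real (card A)" "real (card A) \<le> L * real p powr (1 / 2)"
  shows "real (parabola_energy p A) \<le> real (card A) ^ 4 * real p powr (- (1 / 20000))"
proof (rule ccontr)
  assume not: "\<not> ?thesis"
  define K where "K = real p powr (1 / 20000)"
  have "prime p" using p by simp
  then have p1: "1 < real p" using prime_gt_1_nat by simp
  have K20000: "K ^ 20000 = real p" unfolding K_def using p1 by (simp add: powr_realpow[symmetric] powr_powr)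
  have K0: "0 < K" using p1 by (simp add: K_def)
  have "X \<le> K"
  proof (rule ccontr)
    assume "\<not> X \<le> K"
    then have "K ^ 20000 < X ^ 20000" using K0 by (intro power_strict_mono) auto
    then show False using pX K20000 by simp
  qed
  define N where "N = real (card A)"
  define s where "s = real p powr (1 / 2)"
  have s2: "s\<^sup>2 = real p" unfolding s_def using p1 by (simp add: powr_half_sqrt)
  have s0: "0 < s" using p1 by (simp add: s_def)
  have N: "L1 * s \<le> N" "N \<le> L * s" using cA by (auto simp: N_def s_def)
  have N0: "0 < N" using N L1 s0 by (smt (verit) mult_pos_pos)
  have pN: "real p \<le> K * N\<^sup>2"
  proof -
    have "(L1 * s)\<^sup>2 \<le> N\<^sup>2" using N L1 s0 by (intro power_mono) auto
    then have "L1\<^sup>2 * real p \<le> N\<^sup>2" by (simp add: power_mult_distrib s2)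
    then have "real p \<le> (1 / L1\<^sup>2) * N\<^sup>2" using L1 by (simp add: field_simps)
    also have "\<dots> \<le> K * N\<^sup>2" using X(3) \<open>X \<le> K\<close> by (intro mult_right_mono) auto
    finally show ?thesis .
  qed
  have Np: "N\<^sup>2 \<le> K * real p"
  proof -
    have "N\<^sup>2 \<le> (L * s)\<^sup>2" using N N0 by (intro power_mono) auto
    also have "\<dots> = L\<^sup>2 * real p" by (simp add: power_mult_distrib s2)
    also have "\<dots> \<le> K * real p" using X(4) \<open>X \<le> K\<close> by (intro mult_right_mono) auto
    finally show ?thesis .
  qed
  have J: "N ^ 4 \<le> K * real (parabola_energy p A)"
  proof -
    have "real p powr (- (1 / 20000)) = 1 / K" by (simp add: K_def powr_minus_divide)
    then have "N ^ 4 * (1 / K) < real (parabola_energy p A)" using not by (simp add: N_def)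
    then show ?thesis using K0 by (simp add: field_simps)
  qed
  have N9315: "N \<le> K ^ 9315"
    by (rule large_parabola_energy[OF p A _ N_def N0 pN Np J]) (use X(1) \<open>X \<le> K\<close> in simp)
  \<comment> \<open>\<open>N\<close> is of order \<open>s\<close>, which is far larger than \<open>K ^ 9315\<close>\<close>
  have "K ^ 10000 = s"
  proof -
    have "(K ^ 10000)\<^sup>2 = s\<^sup>2" using K20000 s2 by (simp flip: power_mult)
    then show ?thesis by (rule power2_eq_imp_eq) (use K0 s0 in auto)
  qed
  have "s \<le> (1 / L1) * N" using N(1) L1 by (simp add: field_simps)
  also have "\<dots> \<le> K * K ^ 9315" using X(2) \<open>X \<le> K\<close> N9315 N0 K0 by (intro mult_mono) auto
  also have "\<dots> = K ^ 9316" by (simp flip: power_Suc)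
  also have "\<dots> < K ^ 10000" using X(1) \<open>X \<le> K\<close> by (intro power_strict_increasing) auto
  finally show False using \<open>K ^ 10000 = s\<close> by simp
qed

section \<open>Bilinear exponential sums\<close>

lemma sum_times_sum_eq_sum_pairs:
  fixes f :: "'b \<Rightarrow> complex" and g :: "'c \<Rightarrow> complex"
  shows "(\<Sum>i\<in>I. f i) * (\<Sum>j\<in>J. g j) = (\<Sum>q\<in>I \<times> J. f (fst q) * g (snd q))"
  unfolding sum_product sum.cartesian_product by (intro sum.cong refl) auto

definition unit_char :: "nat \<Rightarrow> int \<Rightarrow> complex" where
  "unit_char p k = cis (2 * pi * of_int k / of_nat p)"

lemma norm_unit_char [simp]: "cmod (unit_char p k) = 1"
  by (simp add: unit_char_def)

lemma unit_char_0 [simp]: "unit_char p 0 = 1"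
  by (simp add: unit_char_def)

lemma unit_char_add: "unit_char p (a + b) = unit_char p a * unit_char p b"
  by (simp add: unit_char_def cis_mult add_divide_distrib distrib_left)

lemma cnj_unit_char: "cnj (unit_char p a) = unit_char p (- a)"
  by (simp add: unit_char_def cis_cnj)

lemma unit_char_eq_1_iff:
  assumes "0 < p"
  shows "unit_char p k = 1 \<longleftrightarrow> int p dvd k"
proof
  assume "unit_char p k = 1"
  then have "cos (2 * pi * of_int k / of_nat p) = 1" by (simp add: unit_char_def complex_eq_iff)
  then obtain m :: int where "2 * pi * of_int k / of_nat p = of_int m * 2 * pi" unfolding cos_one_2pi_int by auto
  then have "real_of_int k = real_of_int (int p * m)" using assms by (simp add: field_simps)
  then have "k = int p * m" by (simp only: of_int_eq_iff)
  then show "int p dvd k" by simp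
next
  assume "int p dvd k"
  then obtain m where m: "k = int p * m" by auto
  have "2 * pi * of_int k / of_nat p = 2 * pi * of_int m" using assms by (simp add: m)
  then have "unit_char p k = cis (2 * pi * of_int m)" unfolding unit_char_def by (rule arg_cong)
  also have "\<dots> = 1" by (rule cis_multiple_2pi) simp
  finally show "unit_char p k = 1" .
qed

lemma unit_char_cong:
  assumes "0 < p" "int p dvd a - b"
  shows "unit_char p a = unit_char p b"
proof -
  have "unit_char p a = unit_char p (b + (a - b))" by simp
  also have "\<dots> = unit_char p b" unfolding unit_char_add using assms unit_char_eq_1_iff by simp
  finally show ?thesis .
qed

lemma unit_char_orthogonality:
  assumes "0 < p"
  shows "(\<Sum>u\<in>{0..<int p}. unit_char p (u * k)) = (if int p dvd k then of_nat p else 0)"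
proof (cases "int p dvd k")
  case True
  then have "unit_char p (u * k) = 1" for u using unit_char_eq_1_iff[OF assms] by simp
  then show ?thesis using True by simp
next
  case False
  define z where "z = unit_char p k"
  have z1: "z \<noteq> 1" using False unit_char_eq_1_iff[OF assms] by (simp add: z_def)
  have zn: "unit_char p (int n * k) = z ^ n" for n
    by (induction n) (simp_all add: z_def distrib_right unit_char_add)
  have "{0..<int p} = int ` {0..<p}" by (simp add: image_int_atLeastLessThan)
  then have "(\<Sum>u\<in>{0..<int p}. unit_char p (u * k)) = (\<Sum>n\<in>{0..<p}. z ^ n)"
    by (simp add: sum.reindex zn)
  also have "\<dots> = 0"
  proof -
    have "z ^ p = 1" using zn[of p] unit_char_eq_1_iff[OF assms, of "int p * k"] by simp
    then have "(1 - z) * (\<Sum>n<p. z ^ n) = 0" by (simp add: one_diff_power_eq[symmetric])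
    then show ?thesis using z1 by (simp add: atLeast0LessThan)
  qed
  finally show ?thesis using False by simp
qed

definition dot :: "int \<times> int \<Rightarrow> int \<times> int \<Rightarrow> int" where
  "dot w v = fst w * fst v + snd w * snd v"

definition reduce2 :: "nat \<Rightarrow> int \<times> int \<Rightarrow> int \<times> int" where
  "reduce2 p v = (fst v mod int p, snd v mod int p)"

abbreviation box :: "nat \<Rightarrow> (int \<times> int) set" where
  "box p \<equiv> {0..<int p} \<times> {0..<int p}"

lemma reduce2_eq_iff: "reduce2 p v = reduce2 p w \<longleftrightarrow> int p dvd fst v - fst w \<and> int p dvd snd v - snd w"
  by (simp add: reduce2_def mod_eq_dvd_iff)

lemma unit_char_dot_orthogonality:
  assumes "0 < p"
  shows "(\<Sum>w\<in>box p. unit_char p (dot w v)) = (if int p dvd fst v \<and> int p dvd snd v then (of_nat p)\<^sup>2 else 0)"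
proof -
  have "(\<Sum>w\<in>box p. unit_char p (dot w v))
      = (\<Sum>a\<in>{0..<int p}. \<Sum>b\<in>{0..<int p}. unit_char p (a * fst v) * unit_char p (b * snd v))"
    by (simp add: sum.cartesian_product dot_def unit_char_add case_prod_beta)
  also have "\<dots> = (\<Sum>a\<in>{0..<int p}. unit_char p (a * fst v)) * (\<Sum>b\<in>{0..<int p}. unit_char p (b * snd v))"
    by (simp add: sum_product)
  finally show ?thesis by (simp add: unit_char_orthogonality[OF assms] power2_eq_square)
qed

text \<open>
  Expanding the square, orthogonality keeps only the pairs with equal frequencies modulo \<open>p\<close>.
\<close>

lemma parseval_collisions:
  assumes p: "0 < p" and fin: "finite I" and d: "\<And>i. i \<in> I \<Longrightarrow> cmod (d i) \<le> 1"
  shows "(\<Sum>w\<in>box p. (cmod (\<Sum>i\<in>I. d i * unit_char p (dot w (\<theta> i))))\<^sup>2)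
           \<le> (real p)\<^sup>2 * real (collisions (\<lambda>i. reduce2 p (\<theta> i)) I)"
proof -
  define S where "S = (\<Sum>w\<in>box p. (cmod (\<Sum>i\<in>I. d i * unit_char p (dot w (\<theta> i))))\<^sup>2)"
  define E where "E = {(i, j). i \<in> I \<and> j \<in> I \<and> reduce2 p (\<theta> i) = reduce2 p (\<theta> j)}"
  have E: "E \<subseteq> I \<times> I" by (auto simp: E_def)
  define v where "v = (\<lambda>q. (fst (\<theta> (fst q)) - fst (\<theta> (snd q)), snd (\<theta> (fst q)) - snd (\<theta> (snd q))))"
  have "complex_of_real S = (\<Sum>w\<in>box p. (\<Sum>i\<in>I. d i * unit_char p (dot w (\<theta> i))) * cnj (\<Sum>i\<in>I. d i * unit_char p (dot w (\<theta> i))))"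
    by (simp only: S_def of_real_sum complex_norm_square)
  also have "\<dots> = (\<Sum>w\<in>box p. \<Sum>q\<in>I \<times> I. d (fst q) * cnj (d (snd q)) * unit_char p (dot w (v q)))"
  proof (rule sum.cong[OF refl])
    fix w
    have *: "d i * unit_char p (dot w (\<theta> i)) * cnj (d j * unit_char p (dot w (\<theta> j)))
        = d i * cnj (d j) * unit_char p (dot w (v (i, j)))" for i j
    proof -
      have "dot w (v (i, j)) = dot w (\<theta> i) + - dot w (\<theta> j)" by (simp add: dot_def v_def algebra_simps)
      then show ?thesis by (simp only: unit_char_add complex_cnj_mult cnj_unit_char) (simp add: mult_ac)
    qed
    show "(\<Sum>i\<in>I. d i * unit_char p (dot w (\<theta> i))) * cnj (\<Sum>i\<in>I. d i * unit_char p (dot w (\<theta> i)))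
        = (\<Sum>q\<in>I \<times> I. d (fst q) * cnj (d (snd q)) * unit_char p (dot w (v q)))"
      unfolding cnj_sum sum_times_sum_eq_sum_pairs * prod.collapse ..
  qed
  also have "\<dots> = (\<Sum>q\<in>I \<times> I. \<Sum>w\<in>box p. d (fst q) * cnj (d (snd q)) * unit_char p (dot w (v q)))"
    by (rule sum.swap)
  also have "\<dots> = (\<Sum>q\<in>I \<times> I. d (fst q) * cnj (d (snd q)) * (\<Sum>w\<in>box p. unit_char p (dot w (v q))))"
    by (simp add: sum_distrib_left)
  also have "\<dots> = (\<Sum>q\<in>I \<times> I. if q \<in> E then d (fst q) * cnj (d (snd q)) * (of_nat p)\<^sup>2 else 0)"
    unfolding unit_char_dot_orthogonality[OF p]
    by (intro sum.cong refl) (auto simp: E_def v_def reduce2_eq_iff)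
  also have "\<dots> = (\<Sum>q\<in>E. d (fst q) * cnj (d (snd q)) * (of_nat p)\<^sup>2)"
    using E fin by (simp add: sum.If_cases Int_absorb1)
  finally have eq: "complex_of_real S = (\<Sum>q\<in>E. d (fst q) * cnj (d (snd q)) * (of_nat p)\<^sup>2)" .
  have "S \<le> cmod (complex_of_real S)" by simp
  also have "\<dots> \<le> (\<Sum>q\<in>E. cmod (d (fst q) * cnj (d (snd q)) * (of_nat p)\<^sup>2))" unfolding eq by (rule norm_sum)
  also have "\<dots> \<le> (\<Sum>q\<in>E. (real p)\<^sup>2)"
  proof (rule sum_mono)
    fix q assume "q \<in> E"
    then have "fst q \<in> I" "snd q \<in> I" using E by auto
    then have "cmod (d (fst q)) * cmod (d (snd q)) \<le> 1 * 1" using d by (intro mult_mono) auto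
    then show "cmod (d (fst q) * cnj (d (snd q)) * (of_nat p)\<^sup>2) \<le> (real p)\<^sup>2"
      by (simp add: norm_mult norm_power mult_left_le_one_le)
  qed
  also have "\<dots> = (real p)\<^sup>2 * real (card E)" by simp
  finally show ?thesis by (simp add: S_def E_def collisions_def)
qed

text \<open>
  The inner sum depends on \<open>\<phi> x\<close> modulo \<open>p\<close> only. Two applications of Cauchy-Schwarz separate the
  multiplicities of these values from the fourth moment of the inner sum, which is a collision count by Parseval.
\<close>

lemma bilinear_sum_bound:
  assumes p: "0 < p" and finX: "finite X" and finY: "finite Y" and c: "\<And>y. y \<in> Y \<Longrightarrow> cmod (c y) \<le> 1"
  shows "(\<Sum>x\<in>X. cmod (\<Sum>y\<in>Y. c y * unit_char p (dot (\<phi> x) (\<psi> y)))) ^ 4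
    \<le> (real (card X))\<^sup>2 * real (collisions (\<lambda>x. reduce2 p (\<phi> x)) X) *
      ((real p)\<^sup>2 * real (collisions (\<lambda>q. reduce2 p (fst (\<psi> (fst q)) + fst (\<psi> (snd q)), snd (\<psi> (fst q)) + snd (\<psi> (snd q)))) (Y \<times> Y)))"
proof -
  define H where "H = (\<lambda>w. cmod (\<Sum>y\<in>Y. c y * unit_char p (dot w (\<psi> y))))"
  have H0: "0 \<le> H w" for w by (simp add: H_def)
  define \<kappa> where "\<kappa> = (\<lambda>x. reduce2 p (\<phi> x))"
  define r where "r = fibre_card \<kappa> X"
  have r0: "0 \<le> r w" for w by (simp add: r_def fibre_card_def)
  have H\<kappa>: "H (\<phi> x) = H (\<kappa> x)" for x
  proof -
    have "unit_char p (dot (\<phi> x) (\<psi> y)) = unit_char p (dot (\<kappa> x) (\<psi> y))" for y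
    proof (rule unit_char_cong[OF p])
      have "dot (\<phi> x) (\<psi> y) - dot (\<kappa> x) (\<psi> y) = (fst (\<phi> x) - fst (\<phi> x) mod int p) * fst (\<psi> y)
          + (snd (\<phi> x) - snd (\<phi> x) mod int p) * snd (\<psi> y)"
        by (simp add: dot_def \<kappa>_def reduce2_def algebra_simps)
      also have "int p dvd \<dots>" by (intro dvd_add dvd_mult2 dvd_minus_mod)
      finally show "int p dvd dot (\<phi> x) (\<psi> y) - dot (\<kappa> x) (\<psi> y)" .
    qed
    then show ?thesis by (simp add: H_def)
  qed
  define W where "W = \<kappa> ` X"
  have W: "W \<subseteq> box p" "finite W" using p finX by (auto simp: W_def \<kappa>_def reduce2_def)
  have "(\<Sum>x\<in>X. H (\<phi> x)) = (\<Sum>x\<in>X. H (\<kappa> x))" by (simp add: H\<kappa>)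
  also have "\<dots> = (\<Sum>w\<in>W. r w * H w)"
    unfolding sum.image_gen[OF finX, of "\<lambda>x. H (\<kappa> x)" \<kappa>] W_def[symmetric]
    by (intro sum.cong refl) (simp add: r_def fibre_card_def)
  finally have 1: "(\<Sum>x\<in>X. H (\<phi> x)) = (\<Sum>w\<in>W. r w * H w)" .
  have "(\<Sum>w\<in>W. sqrt (r w) * (sqrt (r w) * H w))\<^sup>2 \<le> (\<Sum>w\<in>W. (sqrt (r w))\<^sup>2) * (\<Sum>w\<in>W. (sqrt (r w) * H w)\<^sup>2)"
    by (rule Cauchy_Schwarz_ineq_sum)
  then have "(\<Sum>w\<in>W. r w * H w)\<^sup>2 \<le> (\<Sum>w\<in>W. r w) * (\<Sum>w\<in>W. r w * (H w)\<^sup>2)"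
    using r0 by (simp add: power_mult_distrib flip: mult.assoc)
  also have "(\<Sum>w\<in>W. r w) = real (card X)" unfolding W_def r_def by (rule sum_fibre_card[OF finX])
  finally have 2: "(\<Sum>w\<in>W. r w * H w)\<^sup>2 \<le> real (card X) * (\<Sum>w\<in>W. r w * (H w)\<^sup>2)" .
  have "(\<Sum>w\<in>W. r w * (H w)\<^sup>2)\<^sup>2 \<le> (\<Sum>w\<in>W. (r w)\<^sup>2) * (\<Sum>w\<in>W. ((H w)\<^sup>2)\<^sup>2)"
    by (rule Cauchy_Schwarz_ineq_sum)
  also have "(\<Sum>w\<in>W. (r w)\<^sup>2) = real (collisions \<kappa> X)" unfolding W_def r_def by (rule sum_fibre_card_power2[OF finX])
  finally have 3: "(\<Sum>w\<in>W. r w * (H w)\<^sup>2)\<^sup>2 \<le> real (collisions \<kappa> X) * (\<Sum>w\<in>W. ((H w)\<^sup>2)\<^sup>2)" .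
  define \<theta> where "\<theta> = (\<lambda>q. (fst (\<psi> (fst q)) + fst (\<psi> (snd q)), snd (\<psi> (fst q)) + snd (\<psi> (snd q))))"
  have H2: "(H w)\<^sup>2 = cmod (\<Sum>q\<in>Y \<times> Y. (c (fst q) * c (snd q)) * unit_char p (dot w (\<theta> q)))" for w
  proof -
    have *: "(c y * unit_char p (dot w (\<psi> y))) * (c y' * unit_char p (dot w (\<psi> y')))
        = (c y * c y') * unit_char p (dot w (\<theta> (y, y')))" for y y'
    proof -
      have "dot w (\<theta> (y, y')) = dot w (\<psi> y) + dot w (\<psi> y')" by (simp add: dot_def \<theta>_def algebra_simps)
      then show ?thesis by (simp only: unit_char_add mult_ac)
    qed
    have "(\<Sum>y\<in>Y. c y * unit_char p (dot w (\<psi> y))) * (\<Sum>y\<in>Y. c y * unit_char p (dot w (\<psi> y)))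
      = (\<Sum>q\<in>Y \<times> Y. (c (fst q) * unit_char p (dot w (\<psi> (fst q)))) * (c (snd q) * unit_char p (dot w (\<psi> (snd q)))))"
      by (rule sum_times_sum_eq_sum_pairs)
    also have "\<dots> = (\<Sum>q\<in>Y \<times> Y. (c (fst q) * c (snd q)) * unit_char p (dot w (\<theta> q)))"
      by (intro sum.cong refl) (simp only: * prod.collapse)
    finally have "(\<Sum>y\<in>Y. c y * unit_char p (dot w (\<psi> y))) * (\<Sum>y\<in>Y. c y * unit_char p (dot w (\<psi> y)))
      = (\<Sum>q\<in>Y \<times> Y. (c (fst q) * c (snd q)) * unit_char p (dot w (\<theta> q)))" .
    then show ?thesis by (simp add: H_def power2_eq_square flip: norm_mult)
  qed
  have "(\<Sum>w\<in>W. ((H w)\<^sup>2)\<^sup>2) \<le> (\<Sum>w\<in>box p. ((H w)\<^sup>2)\<^sup>2)" using W by (intro sum_mono2) auto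
  also have "\<dots> \<le> (real p)\<^sup>2 * real (collisions (\<lambda>q. reduce2 p (\<theta> q)) (Y \<times> Y))"
    unfolding H2
  proof (rule parseval_collisions[OF p])
    fix q assume "q \<in> Y \<times> Y"
    then have "cmod (c (fst q)) * cmod (c (snd q)) \<le> 1 * 1" using c by (intro mult_mono) auto
    then show "cmod (c (fst q) * c (snd q)) \<le> 1" by (simp add: norm_mult)
  qed (use finY in simp)
  finally have 4: "(\<Sum>w\<in>W. ((H w)\<^sup>2)\<^sup>2) \<le> (real p)\<^sup>2 * real (collisions (\<lambda>q. reduce2 p (\<theta> q)) (Y \<times> Y))" .
  have "(\<Sum>x\<in>X. H (\<phi> x)) ^ 4 = ((\<Sum>w\<in>W. r w * H w)\<^sup>2)\<^sup>2" by (simp add: 1 flip: power_mult)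
  also have "\<dots> \<le> (real (card X) * (\<Sum>w\<in>W. r w * (H w)\<^sup>2))\<^sup>2" using 2 by (intro power_mono) auto
  also have "\<dots> = (real (card X))\<^sup>2 * (\<Sum>w\<in>W. r w * (H w)\<^sup>2)\<^sup>2" by (simp add: power_mult_distrib)
  also have "\<dots> \<le> (real (card X))\<^sup>2 * (real (collisions \<kappa> X) * (\<Sum>w\<in>W. ((H w)\<^sup>2)\<^sup>2))"
    using 3 by (intro mult_left_mono) auto
  also have "\<dots> \<le> (real (card X))\<^sup>2 * (real (collisions \<kappa> X) * ((real p)\<^sup>2 * real (collisions (\<lambda>q. reduce2 p (\<theta> q)) (Y \<times> Y))))"
    using 4 by (intro mult_left_mono) auto
  finally show ?thesis by (simp add: H_def \<kappa>_def \<theta>_def mult.assoc)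
qed

section \<open>Sums over the parabola and a polynomial curve\<close>

lemma finite_filter_residues: "finite {x \<in> {0..<int p}. P x}"
  by (rule finite_subset[of _ "{0..<int p}"]) auto

lemma card_roots_mod_prime_le:
  fixes f :: "int poly"
  assumes p: "prime p" and "\<not> int p dvd lead_coeff f"
  shows "card {x \<in> {0..<int p}. int p dvd poly f x} \<le> degree f"
  using assms(2)
proof (induction "degree f" arbitrary: f)
  case 0
  then obtain c where c: "f = [:c:]" by (metis degree_eq_zeroE)
  then have "{x \<in> {0..<int p}. int p dvd poly f x} = {}" using 0 by simp
  then show ?case by (simp only: card.empty)
next
  case (Suc n)
  define R where "R = (\<lambda>f. {x \<in> {0..<int p}. int p dvd poly f x})"
  have fin: "finite (R f)" for f unfolding R_def by (rule finite_filter_residues)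
  show ?case
  proof (cases "R f = {}")
    case True
    then have "card (R f) = 0" by simp
    then show ?thesis unfolding R_def by simp
  next
    case False
    then obtain r where r: "r \<in> {0..<int p}" "int p dvd poly f r" by (auto simp: R_def)
    \<comment> \<open>split off the root; the quotient has the same leading coefficient\<close>
    define q where "q = synthetic_div f r"
    have f: "f = [:- r, 1:] * q + [:poly f r:]"
      unfolding q_def using synthetic_div_correct'[of r f] by simp
    have dq: "degree q = n" using Suc(2) by (simp add: q_def degree_synthetic_div)
    have "coeff f (Suc n) = coeff q n"
    proof -
      have "coeff f (Suc n) = coeff ([:- r, 1:] * q + [:poly f r:]) (Suc n)" using f by simp
      also have "\<dots> = coeff q n - r * coeff q (Suc n)" by simp
      also have "coeff q (Suc n) = 0" using dq by (simp add: coeff_eq_0)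
      finally show ?thesis by simp
    qed
    then have "\<not> int p dvd lead_coeff q" using Suc(2,3) dq by simp
    then have IH: "card (R q) \<le> n" using Suc(1)[of q] dq by (simp add: R_def)
    have "R f \<subseteq> insert r (R q)"
    proof
      fix x assume x: "x \<in> R f"
      have "poly f x = (x - r) * poly q x + poly f r" by (subst f) (simp add: algebra_simps)
      then have "(x - r) * poly q x = poly f x - poly f r" by simp
      then have "int p dvd (x - r) * poly q x" using x r by (simp add: R_def)
      then have "int p dvd x - r \<or> int p dvd poly q x" using prime_dvd_multD_int[OF p] by blast
      then show "x \<in> insert r (R q)" using x r residues_eqI[of p x r] by (auto simp: R_def)
    qed
    then have "card (R f) \<le> card (insert r (R q))" using fin by (intro card_mono) auto
    also have "\<dots> \<le> Suc (card (R q))" using fin by (simp add: card_insert_le_m1 card_insert_if)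
    finally show ?thesis using IH Suc(2) by (simp add: R_def)
  qed
qed

text \<open>
  In the top two degrees the shifted polynomial agrees with its first-order Taylor expansion.
\<close>

lemma coeff_pcompose_shift:
  fixes g :: "int poly"
  assumes "degree g \<le> Suc m"
  shows "coeff (pcompose g [:\<delta>, 1:]) m = coeff g m + int (Suc m) * \<delta> * coeff g (Suc m)"
  using assms
proof (induction g arbitrary: m)
  case 0
  then show ?case by simp
next
  case (pCons c q)
  show ?case
  proof (cases "q = 0")
    case True
    then show ?thesis by (simp add: pcompose_pCons)
  next
    case False
    then have dq: "degree q \<le> m" using pCons.prems by simp
    have pc: "pcompose (pCons c q) [:\<delta>, 1:] = [:c:] + [:\<delta>, 1:] * pcompose q [:\<delta>, 1:]"
      by (simp add: pcompose_pCons)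
    have top: "coeff (pcompose q [:\<delta>, 1:]) m = coeff q m"
      using pCons.IH[of m] dq coeff_eq_0[of q "Suc m"] by simp
    show ?thesis
    proof (cases m)
      case 0
      then show ?thesis using top by (simp add: pc)
    next
      case (Suc k)
      then have "coeff (pcompose q [:\<delta>, 1:]) k = coeff q k + int (Suc k) * \<delta> * coeff q (Suc k)"
        using pCons.IH[of k] dq by simp
      then show ?thesis using top by (simp add: pc Suc algebra_simps)
    qed
  qed
qed

text \<open>
  The difference \<open>g(x + \<delta>) - g(x)\<close> has degree exactly one less than \<open>g\<close>. That degree is positive, so the
  constant \<open>e\<close> does not affect the leading coefficient.
\<close>

lemma card_shift_roots_le:
  fixes g :: "int poly"
  assumes p: "prime p" and g: "2 \<le> degree g" "\<not> int p dvd lead_coeff g" "\<not> int p dvd int (degree g)"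
    and \<delta>: "\<not> int p dvd \<delta>"
  shows "card {x \<in> {0..<int p}. int p dvd poly g (x + \<delta>) - poly g x - e} \<le> degree g - 1"
proof -
  obtain m where m: "degree g = Suc (Suc m)" using g(1) by (metis add_2_eq_Suc le_Suc_ex)
  define f where "f = pcompose g [:\<delta>, 1:] - g - [:e:]"
  have poly: "poly f x = poly g (x + \<delta>) - poly g x - e" for x
    by (simp add: f_def poly_pcompose add.commute)
  have c1: "coeff f (Suc m) = int (degree g) * \<delta> * lead_coeff g"
    using coeff_pcompose_shift[of g "Suc m" \<delta>] by (simp add: f_def m)
  then have nd: "\<not> int p dvd coeff f (Suc m)"
    using g \<delta> p by (simp add: prime_dvd_mult_iff)
  have "coeff f k = 0" if "Suc m < k" for k
  proof -
    have "coeff f k = coeff (pcompose g [:\<delta>, 1:]) k - coeff g k" using that by (cases k) (auto simp: f_def)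
    also have "\<dots> = 0" using coeff_pcompose_shift[of g k \<delta>] coeff_eq_0[of g "Suc k"] that m by simp
    finally show ?thesis .
  qed
  then have "degree f \<le> Suc m" by (intro degree_le) auto
  moreover have "coeff f (Suc m) \<noteq> 0" using nd by auto
  then have "Suc m \<le> degree f" by (rule le_degree)
  ultimately have d: "degree f = Suc m" by simp
  show ?thesis using card_roots_mod_prime_le[OF p, of f] nd by (simp add: d poly m)
qed

text \<open>
  The curve \<open>(y, g(y))\<close> has the smallest possible additive energy up to a constant: eliminating one variable from
  \<open>y1 + y2 = y3 + y4\<close>, the second equation is a polynomial equation for \<open>y2\<close> unless \<open>y1 = y3\<close>.
\<close>

lemma curve_energy_le:
  fixes g :: "int poly"
  assumes p: "prime p" and g: "2 \<le> degree g" "\<not> int p dvd lead_coeff g" "\<not> int p dvd int (degree g)"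
    and ab: "\<not> int p dvd a" "\<not> int p dvd b" and B: "B \<subseteq> {0..<int p}"
  shows "collisions (\<lambda>q. reduce2 p (a * fst q + a * snd q, b * poly g (fst q) + b * poly g (snd q))) (B \<times> B)
      \<le> degree g * (card B)\<^sup>2"
proof -
  define E where "E = {(q, q'). q \<in> B \<times> B \<and> q' \<in> B \<times> B \<and>
    reduce2 p (a * fst q + a * snd q, b * poly g (fst q) + b * poly g (snd q)) =
    reduce2 p (a * fst q' + a * snd q', b * poly g (fst q') + b * poly g (snd q'))}"
  \<comment> \<open>the possible values of \<open>y2\<close> once \<open>y1\<close> and \<open>y3\<close> are fixed; \<open>y4\<close> is then determined\<close>
  define R where "R = (\<lambda>(u, v). if u = v then B else
     {x \<in> {0..<int p}. int p dvd poly g (x + (u - v)) - poly g x - (poly g u - poly g v)})"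
  have finB: "finite B" using B finite_subset by blast
  have E: "int p dvd (y1 + y2) - (y3 + y4)" "int p dvd (poly g y1 + poly g y2) - (poly g y3 + poly g y4)"
    "y1 \<in> B" "y2 \<in> B" "y3 \<in> B" "y4 \<in> B"
    if "((y1, y2), (y3, y4)) \<in> E" for y1 y2 y3 y4
  proof -
    have "int p dvd a * ((y1 + y2) - (y3 + y4))" "int p dvd b * ((poly g y1 + poly g y2) - (poly g y3 + poly g y4))"
      using that by (auto simp: E_def reduce2_eq_iff algebra_simps)
    then show "int p dvd (y1 + y2) - (y3 + y4)" "int p dvd (poly g y1 + poly g y2) - (poly g y3 + poly g y4)"
      using prime_dvd_multD_int[OF p] ab by blast+
  qed (use that in \<open>auto simp: E_def\<close>)
  define f :: "(int \<times> int) \<times> (int \<times> int) \<Rightarrow> (int \<times> int) \<times> int"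
    where "f = (\<lambda>((y1, y2), (y3, y4)). ((y1, y3), y2))"
  have "inj_on f E"
  proof (rule inj_onI)
    fix u v assume u: "u \<in> E" and v: "v \<in> E" and eq: "f u = f v"
    obtain y1 y2 y3 y4 where y: "u = ((y1, y2), (y3, y4))" by (metis surj_pair)
    obtain y4' where y': "v = ((y1, y2), (y3, y4'))" using eq by (cases v) (auto simp: f_def y)
    have "int p dvd ((y1 + y2) - (y3 + y4')) - ((y1 + y2) - (y3 + y4))"
      by (rule dvd_diff[OF E(1)[OF v[unfolded y']] E(1)[OF u[unfolded y]]])
    then have "int p dvd y4 - y4'" by simp
    moreover have "y4 \<in> B" "y4' \<in> B" using E(6)[OF u[unfolded y]] E(6)[OF v[unfolded y']] .
    ultimately show "u = v" using residues_eqI B y y' by blast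
  qed
  moreover have "f ` E \<subseteq> (SIGMA q:B \<times> B. R q)"
  proof (rule image_subsetI)
    fix u assume u: "u \<in> E"
    obtain y1 y2 y3 y4 where y: "u = ((y1, y2), (y3, y4))" by (metis surj_pair)
    note e = E[OF u[unfolded y]]
    have "int p dvd poly g (y2 + (y1 - y3)) - poly g y4"
    proof -
      have "poly g (y2 + (y1 - y3)) mod int p = poly g y4 mod int p"
      proof -
        have "[y2 + (y1 - y3) = y4] (mod int p)" using e(1) by (simp add: cong_iff_dvd_diff algebra_simps)
        then have "[poly g (y2 + (y1 - y3)) = poly g y4] (mod int p)"
          by (induction g) (auto intro!: cong_add cong_mult)
        then show ?thesis by (simp add: cong_def)
      qed
      then show ?thesis by (simp add: mod_eq_dvd_iff)
    qed
    then have "int p dvd (poly g (y2 + (y1 - y3)) - poly g y4) - ((poly g y1 + poly g y2) - (poly g y3 + poly g y4))"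
      using e(2) by (rule dvd_diff)
    then have "int p dvd poly g (y2 + (y1 - y3)) - poly g y2 - (poly g y1 - poly g y3)"
      by (simp add: algebra_simps)
    then show "f u \<in> (SIGMA q:B \<times> B. R q)" using e B by (auto simp: f_def y R_def)
  qed
  moreover have finR: "finite (R q)" for q
    unfolding R_def using finB finite_filter_residues by (auto simp only: split: prod.splits if_splits)
  ultimately have "card E \<le> card (SIGMA q:B \<times> B. R q)" using finB by (intro card_inj_on_le[of f]) auto
  also have "\<dots> = (\<Sum>q\<in>B \<times> B. card (R q))" using finB finR by (intro card_SigmaI) auto
  also have "\<dots> = (\<Sum>u\<in>B. \<Sum>v\<in>B. card (R (u, v)))" by (simp add: sum.cartesian_product)
  also have "\<dots> \<le> (\<Sum>u\<in>B. \<Sum>v\<in>B. (if u = v then card B else 0) + (degree g - 1))"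
  proof (intro sum_mono)
    fix u v assume uv: "u \<in> B" "v \<in> B"
    show "card (R (u, v)) \<le> (if u = v then card B else 0) + (degree g - 1)"
    proof (cases "u = v")
      case False
      then have "\<not> int p dvd u - v" using uv B residues_eqI by blast
      then show ?thesis using False card_shift_roots_le[OF p g] by (simp add: R_def)
    qed (simp add: R_def)
  qed
  also have "\<dots> = card B * card B + card B * card B * (degree g - 1)"
    using finB by (simp add: sum.distrib distrib_left mult.assoc)
  also have "\<dots> = degree g * (card B)\<^sup>2" using g(1) by (cases "degree g") (auto simp: power2_eq_square algebra_simps)
  finally show ?thesis by (simp add: collisions_def E_def)
qed

text \<open>
  Up to a unimodular factor, the cube of the inner modulus is a sum over triples of points of the parabola. The
  bilinear estimate applies to it, and this is how the third energy enters; the power mean inequality passes from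
  the sum of the moduli to the sum of their cubes.
\<close>

lemma parabola_curve_sum_bound:
  fixes g :: "int poly"
  assumes p: "prime p" and g: "2 \<le> degree g" "\<not> int p dvd lead_coeff g" "\<not> int p dvd int (degree g)"
    and ab: "\<not> int p dvd a" "\<not> int p dvd b" and A: "A \<subseteq> {0..<int p}" and B: "B \<subseteq> {0..<int p}"
  shows "(\<Sum>y\<in>B. cmod (\<Sum>x\<in>A. unit_char p (a * x * y + b * x\<^sup>2 * poly g y))) ^ 12
    \<le> real (degree g) * real (card A) ^ 6 * real (card B) ^ 10 * (real p)\<^sup>2 * real (parabola_energy p A)"
proof -
  have p0: "0 < p" using p prime_gt_0_nat by blast
  have fin: "finite A" "finite B" using A B finite_subset by blast+
  define \<psi> where "\<psi> = (\<lambda>y. (a * y, b * poly g y))"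
  define f where "f = (\<lambda>y. \<Sum>x\<in>A. unit_char p (dot (x, x\<^sup>2) (\<psi> y)))"
  define \<phi> where "\<phi> = (\<lambda>q :: int \<times> int \<times> int. (fst (snd q) + snd (snd q) - fst q, (fst (snd q))\<^sup>2 + (snd (snd q))\<^sup>2 - (fst q)\<^sup>2))"
  \<comment> \<open>the unimodular factor that turns \<open>f\<^sup>2 * cnj f\<close> into \<open>|f|\<^sup>3\<close>\<close>
  define c where "c = (\<lambda>y. cnj (sgn (f y)))"
  have c1: "cmod (c y) \<le> 1" for y by (simp add: c_def norm_sgn)
  have f3: "complex_of_real (cmod (f y) ^ 3) = (\<Sum>q\<in>A \<times> A \<times> A. c y * unit_char p (dot (\<phi> q) (\<psi> y)))" for y
  proof -
    have "f y * c y = complex_of_real (cmod (f y))"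
    proof (cases "f y = 0")
      case False
      have "f y * c y = f y * cnj (f y) / complex_of_real (cmod (f y))" by (simp add: c_def sgn_eq)
      also have "\<dots> = complex_of_real (cmod (f y))" using False
        by (simp add: complex_norm_square[symmetric] power2_eq_square)
      finally show ?thesis .
    qed (simp add: c_def)
    moreover have "f y * cnj (f y) = complex_of_real (cmod (f y)) ^ 2" by (simp add: complex_norm_square[symmetric])
    ultimately have "complex_of_real (cmod (f y) ^ 3) = c y * (cnj (f y) * (f y * f y))"
      by (simp add: power2_eq_square power3_eq_cube mult_ac)
    also have "cnj (f y) * (f y * f y) = (\<Sum>q\<in>A \<times> A \<times> A. unit_char p (dot (\<phi> q) (\<psi> y)))"
    proof -
      have "cnj (f y) * (f y * f y) = (\<Sum>q\<in>A \<times> A \<times> A. cnj (unit_char p (dot (fst q, (fst q)\<^sup>2) (\<psi> y))) *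
          (unit_char p (dot (fst (snd q), (fst (snd q))\<^sup>2) (\<psi> y)) * unit_char p (dot (snd (snd q), (snd (snd q))\<^sup>2) (\<psi> y))))"
        unfolding f_def cnj_sum sum_times_sum_eq_sum_pairs ..
      also have "\<dots> = (\<Sum>q\<in>A \<times> A \<times> A. unit_char p (dot (\<phi> q) (\<psi> y)))"
      proof (rule sum.cong[OF refl])
        fix q :: "int \<times> int \<times> int"
        have "dot (\<phi> q) (\<psi> y) = - dot (fst q, (fst q)\<^sup>2) (\<psi> y) +
           (dot (fst (snd q), (fst (snd q))\<^sup>2) (\<psi> y) + dot (snd (snd q), (snd (snd q))\<^sup>2) (\<psi> y))"
          by (simp add: dot_def \<phi>_def algebra_simps)
        then show "cnj (unit_char p (dot (fst q, (fst q)\<^sup>2) (\<psi> y))) *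
          (unit_char p (dot (fst (snd q), (fst (snd q))\<^sup>2) (\<psi> y)) * unit_char p (dot (snd (snd q), (snd (snd q))\<^sup>2) (\<psi> y)))
          = unit_char p (dot (\<phi> q) (\<psi> y))" by (simp only: unit_char_add cnj_unit_char)
      qed
      finally show ?thesis .
    qed
    finally show ?thesis by (simp add: sum_distrib_left)
  qed
  define Q where "Q = (\<Sum>q\<in>A \<times> A \<times> A. cmod (\<Sum>y\<in>B. c y * unit_char p (dot (\<phi> q) (\<psi> y))))"
  define M where "M = (\<Sum>y\<in>B. cmod (f y))"
  have "(\<Sum>y\<in>B. cmod (f y) ^ 3) = cmod (complex_of_real (\<Sum>y\<in>B. cmod (f y) ^ 3))"
    by (simp only: norm_of_real) (simp add: sum_nonneg)
  also have "complex_of_real (\<Sum>y\<in>B. cmod (f y) ^ 3) = (\<Sum>y\<in>B. \<Sum>q\<in>A \<times> A \<times> A. c y * unit_char p (dot (\<phi> q) (\<psi> y)))"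
    by (simp only: of_real_sum f3)
  also have "\<dots> = (\<Sum>q\<in>A \<times> A \<times> A. \<Sum>y\<in>B. c y * unit_char p (dot (\<phi> q) (\<psi> y)))" by (rule sum.swap)
  also have "cmod \<dots> \<le> Q" unfolding Q_def by (rule norm_sum)
  finally have fQ: "(\<Sum>y\<in>B. cmod (f y) ^ 3) \<le> Q" .
  have "(\<lambda>q. reduce2 p (\<phi> q)) = parabola_key p"
    by (simp add: fun_eq_iff reduce2_def \<phi>_def parabola_key_def)
  then have J: "collisions (\<lambda>q. reduce2 p (\<phi> q)) (A \<times> A \<times> A) = parabola_energy p A"
    by (simp add: parabola_energy_def)
  have "Q ^ 4 \<le> (real (card (A \<times> A \<times> A)))\<^sup>2 * real (collisions (\<lambda>q. reduce2 p (\<phi> q)) (A \<times> A \<times> A)) *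
      ((real p)\<^sup>2 * real (collisions (\<lambda>q. reduce2 p (fst (\<psi> (fst q)) + fst (\<psi> (snd q)), snd (\<psi> (fst q)) + snd (\<psi> (snd q)))) (B \<times> B)))"
    unfolding Q_def using fin c1 by (intro bilinear_sum_bound[OF p0]) auto
  also have "\<dots> \<le> (real (card (A \<times> A \<times> A)))\<^sup>2 * real (parabola_energy p A) * ((real p)\<^sup>2 * real (degree g * (card B)\<^sup>2))"
    unfolding J
  proof (intro mult_left_mono)
    show "real (collisions (\<lambda>q. reduce2 p (fst (\<psi> (fst q)) + fst (\<psi> (snd q)), snd (\<psi> (fst q)) + snd (\<psi> (snd q)))) (B \<times> B))
       \<le> real (degree g * (card B)\<^sup>2)"
      using curve_energy_le[OF p g ab B] by (simp only: \<psi>_def fst_conv snd_conv of_nat_le_iff)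
  qed auto
  finally have Q4: "Q ^ 4 \<le> real (card A) ^ 6 * real (parabola_energy p A) * ((real p)\<^sup>2 * (real (degree g) * (real (card B))\<^sup>2))"
    by (simp add: card_cartesian_product power_mult_distrib eval_nat_numeral mult_ac)
  have "M ^ 3 \<le> (real (card B))\<^sup>2 * (\<Sum>y\<in>B. cmod (f y) ^ 3)" unfolding M_def by (rule sum_power3_le) simp
  also have "\<dots> \<le> (real (card B))\<^sup>2 * Q" using fQ by (intro mult_left_mono) auto
  finally have M3: "M ^ 3 \<le> (real (card B))\<^sup>2 * Q" .
  have M0: "0 \<le> M" by (simp add: M_def sum_nonneg)
  have "M ^ 12 = (M ^ 3) ^ 4" by (simp flip: power_mult)
  also have "\<dots> \<le> ((real (card B))\<^sup>2 * Q) ^ 4" using M3 M0 by (intro power_mono) auto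
  also have "\<dots> = real (card B) ^ 8 * Q ^ 4" by (simp add: power_mult_distrib flip: power_mult)
  also have "\<dots> \<le> real (card B) ^ 8 * (real (card A) ^ 6 * real (parabola_energy p A) * ((real p)\<^sup>2 * (real (degree g) * (real (card B))\<^sup>2)))"
    using Q4 by (intro mult_left_mono) auto
  also have "\<dots> = real (degree g) * real (card A) ^ 6 * real (card B) ^ 10 * (real p)\<^sup>2 * real (parabola_energy p A)"
    by (simp add: mult_ac flip: power_add)
  finally have "M ^ 12 \<le> real (degree g) * real (card A) ^ 6 * real (card B) ^ 10 * (real p)\<^sup>2 * real (parabola_energy p A)" .
  moreover have "f y = (\<Sum>x\<in>A. unit_char p (a * x * y + b * x\<^sup>2 * poly g y))" for y
    unfolding f_def \<psi>_def dot_def by (intro sum.cong refl arg_cong[where f = "unit_char p"]) (simp add: mult_ac)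
  ultimately show ?thesis by (simp add: M_def)
qed

section \<open>The triple sum\<close>

lemma add_char_eq_unit_char: "add_char p r u = unit_char p (r * u)"
  by (simp add: add_char_def unit_char_def cis_conv_exp mult_ac)

lemma norm_sum_unit_char_le: "cmod (\<Sum>y\<in>B. \<Sum>x\<in>A. unit_char p (f x y)) \<le> real (card A) * real (card B)"
proof -
  have "cmod (\<Sum>y\<in>B. \<Sum>x\<in>A. unit_char p (f x y)) \<le> (\<Sum>y\<in>B. \<Sum>x\<in>A. cmod (unit_char p (f x y)))"
    by (intro order_trans[OF norm_sum] sum_mono norm_sum)
  then show ?thesis by (simp add: mult.commute)
qed

lemma char_sum_eq:
  assumes "0 < p"
  shows "char_sum p F A B C r = (\<Sum>z\<in>C. \<Sum>y\<in>B. \<Sum>x\<in>A. unit_char p (r * eval3 F x y z))"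
proof -
  have "char_sum p F A B C r = (\<Sum>x\<in>A. \<Sum>y\<in>B. \<Sum>z\<in>C. add_char p r (eval3_mod p F x y z))"
    unfolding char_sum_def by (simp add: sum.cartesian_product)
  also have "\<dots> = (\<Sum>x\<in>A. \<Sum>y\<in>B. \<Sum>z\<in>C. unit_char p (r * eval3 F x y z))"
  proof (intro sum.cong refl)
    fix x y z
    have "int p dvd r * (eval3 F x y z - eval3 F x y z mod int p)" by (intro dvd_mult dvd_minus_mod)
    then have "int p dvd r * eval3 F x y z - r * (eval3 F x y z mod int p)" by (simp add: right_diff_distrib)
    then show "add_char p r (eval3_mod p F x y z) = unit_char p (r * eval3 F x y z)"
      unfolding add_char_eq_unit_char eval3_mod_def using unit_char_cong[OF assms] by metis
  qed
  also have "\<dots> = (\<Sum>y\<in>B. \<Sum>x\<in>A. \<Sum>z\<in>C. unit_char p (r * eval3 F x y z))" by (rule sum.swap)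
  also have "\<dots> = (\<Sum>y\<in>B. \<Sum>z\<in>C. \<Sum>x\<in>A. unit_char p (r * eval3 F x y z))"
    by (intro sum.cong refl sum.swap)
  also have "\<dots> = (\<Sum>z\<in>C. \<Sum>y\<in>B. \<Sum>x\<in>A. unit_char p (r * eval3 F x y z))" by (rule sum.swap)
  finally show ?thesis .
qed

lemma char_sum_trivial:
  assumes "0 < p"
  shows "cmod (char_sum p F A B C r) \<le> real (card A) * real (card B) * real (card C)"
proof -
  have "cmod (char_sum p F A B C r) \<le> (\<Sum>z\<in>C. cmod (\<Sum>y\<in>B. \<Sum>x\<in>A. unit_char p (r * eval3 F x y z)))"
    unfolding char_sum_eq[OF assms] by (rule norm_sum)
  also have "\<dots> \<le> (\<Sum>z\<in>C. real (card A) * real (card B))" by (intro sum_mono norm_sum_unit_char_le)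
  finally show ?thesis by (simp add: mult_ac)
qed

text \<open>
  The primes that preserve the degrees of \<open>a\<close>, \<open>b\<close>, \<open>g\<close> and of the differences of \<open>g\<close>.
\<close>

definition good_prime :: "int poly \<Rightarrow> int poly \<Rightarrow> int poly \<Rightarrow> nat \<Rightarrow> bool" where
  "good_prime a b g p \<longleftrightarrow> prime p \<and> p \<noteq> 2 \<and> \<not> int p dvd lead_coeff a \<and> \<not> int p dvd lead_coeff b \<and>
     \<not> int p dvd lead_coeff g \<and> \<not> int p dvd int (degree g)"

lemma good_prime_if_large:
  assumes "prime p" "a \<noteq> 0" "b \<noteq> 0" "2 \<le> degree g"
    and large: "2 + \<bar>lead_coeff a\<bar> + \<bar>lead_coeff b\<bar> + \<bar>lead_coeff g\<bar> + int (degree g) < int p"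
  shows "good_prime a b g p"
proof -
  have nd: "\<not> int p dvd k" if "k \<noteq> 0" "\<bar>k\<bar> < int p" for k
    using that zdvd_imp_le[of "int p" "\<bar>k\<bar>"] by auto
  have "g \<noteq> 0" using assms by auto
  then show ?thesis unfolding good_prime_def using assms large
    by (intro conjI nd) auto
qed

text \<open>
  For fixed \<open>z\<close> the polynomial \<open>h\<close> only contributes a unimodular weight depending on \<open>y\<close>. The coefficients of
  the remaining phase are nonzero modulo \<open>p\<close> except for boundedly many \<open>z\<close>, which are estimated trivially.
\<close>

lemma char_sum_le:
  fixes a b g :: "int poly" and h :: "int poly poly"
  defines "F \<equiv> in_z a * var_x * var_y + in_z b * var_x ^ 2 * in_y g + in_yz h"
  assumes good: "good_prime a b g p" and g: "2 \<le> degree g" and r: "\<not> int p dvd r"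
    and A: "A \<subseteq> {0..<int p}" and B: "B \<subseteq> {0..<int p}" and C: "C \<subseteq> {0..<int p}" and Y: "0 \<le> Y"
    and bound: "real (degree g) * real (card A) ^ 6 * real (card B) ^ 10 * (real p)\<^sup>2 * real (parabola_energy p A) \<le> Y ^ 12"
  shows "cmod (char_sum p F A B C r) \<le> real (card C) * Y + real (degree a + degree b) * (real (card A) * real (card B))"
proof -
  have p: "prime p" using good by (simp add: good_prime_def)
  then have p0: "0 < p" using prime_gt_0_nat by blast
  have finC: "finite C" using C finite_subset by blast
  define S where "S = (\<lambda>z. \<Sum>y\<in>B. \<Sum>x\<in>A. unit_char p (r * eval3 F x y z))"
  \<comment> \<open>for these \<open>z\<close> one of the two coefficients of the inner phase vanishes\<close>
  define Bad where "Bad = {z \<in> C. int p dvd poly a z \<or> int p dvd poly b z}"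
  have Bad: "Bad \<subseteq> C" "finite Bad" using finC by (auto simp: Bad_def)
  have "Bad \<subseteq> {x \<in> {0..<int p}. int p dvd poly a x} \<union> {x \<in> {0..<int p}. int p dvd poly b x}"
    using C by (auto simp: Bad_def)
  then have "card Bad \<le> card ({x \<in> {0..<int p}. int p dvd poly a x} \<union> {x \<in> {0..<int p}. int p dvd poly b x})"
    by (rule card_mono[OF finite_UnI[OF finite_filter_residues finite_filter_residues]])
  also have "\<dots> \<le> card {x \<in> {0..<int p}. int p dvd poly a x} + card {x \<in> {0..<int p}. int p dvd poly b x}"
    by (rule card_Un_le)
  also have "\<dots> \<le> degree a + degree b"
    using good by (intro add_mono card_roots_mod_prime_le[OF p]) (auto simp: good_prime_def)
  finally have cBad: "card Bad \<le> degree a + degree b" .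
  have SY: "cmod (S z) \<le> Y" if z: "z \<in> C - Bad" for z
  proof -
    define a' b' where "a' = r * poly a z" and "b' = r * poly b z"
    have nd: "\<not> int p dvd a'" "\<not> int p dvd b'"
      using z r prime_dvd_multD_int[OF p, of r "poly a z"] prime_dvd_multD_int[OF p, of r "poly b z"]
      unfolding Bad_def a'_def b'_def by blast+
    define M where "M = (\<Sum>y\<in>B. cmod (\<Sum>x\<in>A. unit_char p (a' * x * y + b' * x\<^sup>2 * poly g y)))"
    have "M ^ 12 \<le> Y ^ 12"
      using parabola_curve_sum_bound[OF p g _ _ nd A B] good bound by (simp add: M_def good_prime_def)
    have "M \<le> Y"
    proof (rule ccontr)
      assume "\<not> M \<le> Y"
      then have "Y ^ 12 < M ^ 12" using Y by (intro power_strict_mono) auto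
      with \<open>M ^ 12 \<le> Y ^ 12\<close> show False by simp
    qed
    have "S z = (\<Sum>y\<in>B. (\<Sum>x\<in>A. unit_char p (a' * x * y + b' * x\<^sup>2 * poly g y)) * unit_char p (r * poly (poly h [:y:]) z))"
      unfolding S_def sum_distrib_right unit_char_add[symmetric] F_def eval3_admissible_form
      by (intro sum.cong refl arg_cong[where f = "unit_char p"]) (simp add: a'_def b'_def algebra_simps)
    then have "cmod (S z) \<le> (\<Sum>y\<in>B. cmod ((\<Sum>x\<in>A. unit_char p (a' * x * y + b' * x\<^sup>2 * poly g y)) * unit_char p (r * poly (poly h [:y:]) z)))"
      by (simp only: norm_sum)
    then have "cmod (S z) \<le> M" by (simp add: M_def norm_mult)
    with \<open>M \<le> Y\<close> show ?thesis by simp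
  qed
  have "cmod (char_sum p F A B C r) \<le> (\<Sum>z\<in>C. cmod (S z))"
    unfolding char_sum_eq[OF p0] S_def by (rule norm_sum)
  also have "\<dots> = (\<Sum>z\<in>C - Bad. cmod (S z)) + (\<Sum>z\<in>Bad. cmod (S z))"
    using Bad finC by (intro sum.subset_diff) auto
  also have "\<dots> \<le> (\<Sum>z\<in>C - Bad. Y) + (\<Sum>z\<in>Bad. real (card A) * real (card B))"
    using SY unfolding S_def by (intro add_mono sum_mono norm_sum_unit_char_le) auto
  also have "\<dots> = real (card (C - Bad)) * Y + real (card Bad) * (real (card A) * real (card B))" by simp
  also have "\<dots> \<le> real (card C) * Y + real (degree a + degree b) * (real (card A) * real (card B))"
  proof (intro add_mono mult_right_mono)
    show "real (card (C - Bad)) \<le> real (card C)"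
      unfolding of_nat_le_iff using finC by (intro card_mono) auto
    show "real (card Bad) \<le> real (degree a + degree b)"
      unfolding of_nat_le_iff by (rule cBad)
  qed (use Y in auto)
  finally show ?thesis .
qed

text \<open>
  With \<open>\<eta> = 0\<close> this is what the elementary energy bound gives, and its exponent is smaller than
  \<open>(22\<alpha> + 1)/8\<close> as soon as \<open>\<alpha> > 1/2\<close>.
\<close>

lemma char_sum_power_saving:
  fixes a b g :: "int poly" and h :: "int poly poly" and L \<alpha> \<eta> :: real
  defines "F \<equiv> in_z a * var_x * var_y + in_z b * var_x ^ 2 * in_y g + in_yz h"
  assumes good: "good_prime a b g p" and g: "2 \<le> degree g" and r: "\<not> int p dvd r"
    and A: "A \<subseteq> {0..<int p}" and B: "B \<subseteq> {0..<int p}" and C: "C \<subseteq> {0..<int p}"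
    and L: "1 \<le> L" and \<alpha>: "0 < \<alpha>" and \<eta>: "\<eta> \<le> 1"
    and cards: "real (card A) \<le> L * real p powr \<alpha>" "real (card B) \<le> L * real p powr \<alpha>" "real (card C) \<le> L * real p powr \<alpha>"
    and energy: "real (parabola_energy p A) \<le> 2 * real (card A) ^ 4 * real p powr (- \<eta>)"
  shows "cmod (char_sum p F A B C r) \<le> L ^ 3 * real (2 * degree g + degree a + degree b) * real p powr ((32 * \<alpha> + 2 - \<eta>) / 12)"
proof -
  have p: "prime p" using good by (simp add: good_prime_def)
  have p1: "1 \<le> real p" using prime_ge_1_nat[OF p] by simp
  define n where "n = real (degree g)"
  have n: "2 \<le> n" using g by (simp add: n_def)
  define P where "P = real p powr \<alpha>"
  have P0: "0 < P" using p1 by (simp add: P_def)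
  have Pk: "P ^ k = real p powr (real k * \<alpha>)" for k
    using p1 by (simp add: P_def powr_realpow[symmetric] powr_powr mult.commute)
  define w where "w = (20 * \<alpha> + 2 - \<eta>) / 12"
  define Y where "Y = 2 * n * L\<^sup>2 * real p powr w"
  have Y0: "0 \<le> Y" using n by (simp add: Y_def)
  have Y12: "Y ^ 12 = (2 * n * L\<^sup>2) ^ 12 * real p powr (20 * \<alpha> + 2 - \<eta>)"
  proof -
    have "(real p powr w) ^ 12 = real p powr (20 * \<alpha> + 2 - \<eta>)"
    proof -
      have "(real p powr w) ^ 12 = real p powr (w * 12)"
        using p1 by (simp add: powr_realpow[symmetric] powr_powr)
      also have "w * 12 = 20 * \<alpha> + 2 - \<eta>" by (simp add: w_def)
      finally show ?thesis .
    qed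
    then show ?thesis by (simp only: Y_def power_mult_distrib)
  qed
  have "n * real (card A) ^ 6 * real (card B) ^ 10 * (real p)\<^sup>2 * real (parabola_energy p A)
      \<le> n * real (card A) ^ 6 * real (card B) ^ 10 * (real p)\<^sup>2 * (2 * real (card A) ^ 4 * real p powr (- \<eta>))"
    using energy n by (intro mult_left_mono) auto
  also have "\<dots> = (2 * n) * (real (card A) ^ 10 * real (card B) ^ 10) * ((real p)\<^sup>2 * real p powr (- \<eta>))"
    by (simp add: mult_ac flip: power_add)
  also have "\<dots> \<le> (2 * n) * ((L * P) ^ 10 * (L * P) ^ 10) * ((real p)\<^sup>2 * real p powr (- \<eta>))"
    using cards n P0 L by (intro mult_right_mono mult_left_mono mult_mono power_mono) (auto simp: P_def)
  also have "\<dots> = (2 * n * L ^ 20) * (P ^ 20 * ((real p)\<^sup>2 * real p powr (- \<eta>)))"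
    by (simp add: power_mult_distrib mult_ac flip: power_add)
  also have "P ^ 20 * ((real p)\<^sup>2 * real p powr (- \<eta>)) = real p powr (20 * \<alpha> + 2 - \<eta>)"
  proof -
    have "(real p)\<^sup>2 = real p powr 2" using p1 by simp
    then have "P ^ 20 * ((real p)\<^sup>2 * real p powr (- \<eta>)) = real p powr (20 * \<alpha>) * (real p powr 2 * real p powr (- \<eta>))"
      by (simp add: Pk)
    also have "\<dots> = real p powr (20 * \<alpha> + 2 - \<eta>)"
      by (simp only: powr_add[symmetric]) (simp add: algebra_simps)
    finally show ?thesis .
  qed
  also have "(2 * n * L ^ 20) * real p powr (20 * \<alpha> + 2 - \<eta>) \<le> Y ^ 12"
    unfolding Y12
  proof (rule mult_right_mono)
    have "2 * n * L ^ 20 \<le> (2 * n) ^ 12 * L ^ 24"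
      using n L by (intro mult_mono self_le_power power_increasing) auto
    then show "2 * n * L ^ 20 \<le> (2 * n * L\<^sup>2) ^ 12" by (simp add: power_mult_distrib flip: power_mult)
  qed simp
  finally have "n * real (card A) ^ 6 * real (card B) ^ 10 * (real p)\<^sup>2 * real (parabola_energy p A) \<le> Y ^ 12" .
  then have "cmod (char_sum p F A B C r) \<le> real (card C) * Y + real (degree a + degree b) * (real (card A) * real (card B))"
    unfolding F_def n_def by (intro char_sum_le[OF good g r A B C Y0])
  also have "\<dots> \<le> (L * P) * Y + real (degree a + degree b) * ((L * P) * (L * P))"
    using cards Y0 P0 L by (intro add_mono mult_mono) (auto simp: P_def)
  also have "(L * P) * Y = 2 * n * L ^ 3 * real p powr ((32 * \<alpha> + 2 - \<eta>) / 12)"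
  proof -
    have "P * real p powr w = real p powr ((32 * \<alpha> + 2 - \<eta>) / 12)"
      unfolding P_def powr_add[symmetric] by (simp add: w_def field_simps)
    then show ?thesis by (simp add: Y_def eval_nat_numeral mult_ac)
  qed
  also have "(L * P) * (L * P) \<le> L ^ 3 * real p powr ((32 * \<alpha> + 2 - \<eta>) / 12)"
  proof -
    have "P * P = real p powr (2 * \<alpha>)" using Pk[of 2] by (simp add: power2_eq_square)
    also have "\<dots> \<le> real p powr ((32 * \<alpha> + 2 - \<eta>) / 12)" using p1 \<eta> \<alpha> by (intro powr_mono) auto
    finally have *: "P * P \<le> real p powr ((32 * \<alpha> + 2 - \<eta>) / 12)" .
    have "(L * P) * (L * P) = L\<^sup>2 * (P * P)" by (simp add: power2_eq_square mult_ac)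
    also have "\<dots> \<le> L ^ 3 * real p powr ((32 * \<alpha> + 2 - \<eta>) / 12)"
      using L P0 * by (intro mult_mono power_increasing) auto
    finally show ?thesis .
  qed
  then have "2 * n * L ^ 3 * real p powr ((32 * \<alpha> + 2 - \<eta>) / 12) + real (degree a + degree b) * ((L * P) * (L * P))
      \<le> 2 * n * L ^ 3 * real p powr ((32 * \<alpha> + 2 - \<eta>) / 12) + real (degree a + degree b) * (L ^ 3 * real p powr ((32 * \<alpha> + 2 - \<eta>) / 12))"
    by (intro add_left_mono mult_left_mono) auto
  also have "\<dots> = L ^ 3 * real (2 * degree g + degree a + degree b) * real p powr ((32 * \<alpha> + 2 - \<eta>) / 12)"
    by (simp add: n_def algebra_simps)
  finally show ?thesis .
qed

theorem theorem10:
  shows "\<exists>\<gamma> :: real \<Rightarrow> real.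
    (\<forall>\<alpha>. 0 < \<alpha> \<and> \<alpha> < 1 \<longrightarrow> 0 < \<gamma> \<alpha>) \<and>
    (\<forall>(F :: zpoly3) (L1 :: real) (L2 :: real).
       admissible F \<and> 0 < L1 \<and> L1 \<le> L2 \<longrightarrow>
       (\<exists>K :: real. 0 < K \<and>
         (\<forall>(\<alpha> :: real) (p :: nat) (A :: int set) (B :: int set) (C :: int set).
            0 < \<alpha> \<and> \<alpha> < 1 \<and> prime p \<and>
            A \<subseteq> Fp p \<and> B \<subseteq> Fp p \<and> C \<subseteq> Fp p \<and>
            (\<forall>X \<in> {A, B, C}. L1 * real p powr \<alpha> \<le> real (card X) \<and>
                              real (card X) \<le> L2 * real p powr \<alpha>) \<longrightarrow>
            Max ((\<lambda>r. cmod (char_sum p F A B C r)) ` (Fp p - {0}))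
              \<le> K * real p powr (((22 - \<gamma> \<alpha> / 2) * \<alpha> + 1) / 8))))"
proof -
  \<comment> \<open>Each branch makes the claimed exponent \<open>E \<alpha>\<close> equal to the one that is proved: \<open>3\<alpha>\<close> below one half,
    \<open>(16\<alpha> + 1)/6\<close> above it, and \<open>3/2 - 1/240000\<close> at it.\<close>
  define \<gamma> :: "real \<Rightarrow> real" where
    "\<gamma> = (\<lambda>\<alpha>. if \<alpha> < 1 / 2 then 2 * (1 - 2 * \<alpha>) / \<alpha> else if \<alpha> = 1 / 2 then 1 / 7500 else 2 / 3 * (2 - 1 / \<alpha>))"
  define E where "E = (\<lambda>\<alpha>. ((22 - \<gamma> \<alpha> / 2) * \<alpha> + 1) / 8)"
  have E_low: "E \<alpha> = 3 * \<alpha>" if "0 < \<alpha>" "\<alpha> < 1 / 2" for \<alpha>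
    using that by (simp add: E_def \<gamma>_def field_simps)
  have E_half: "E (1 / 2) = (32 * (1 / 2) + 2 - 1 / 20000) / 12"
    by (simp add: E_def \<gamma>_def)
  have E_high: "E \<alpha> = (32 * \<alpha> + 2 - 0) / 12" if "1 / 2 < \<alpha>" for \<alpha>
    using that by (simp add: E_def \<gamma>_def field_simps)
  have \<gamma>_pos: "0 < \<gamma> \<alpha>" if "0 < \<alpha>" for \<alpha> using that by (auto simp: \<gamma>_def field_simps)
  have E_pos: "0 \<le> E \<alpha>" if "0 < \<alpha>" for \<alpha>
  proof -
    consider "\<alpha> < 1 / 2" | "\<alpha> = 1 / 2" | "1 / 2 < \<alpha>" by linarith
    then show ?thesis
    proof cases
      case 1
      then show ?thesis using that E_low by simp
    next
      case 2
      show ?thesis unfolding 2 E_half by simp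
    next
      case 3
      show ?thesis unfolding E_high[OF 3] using that by simp
    qed
  qed
  have "\<exists>K :: real. 0 < K \<and>
         (\<forall>(\<alpha> :: real) (p :: nat) (A :: int set) (B :: int set) (C :: int set).
            0 < \<alpha> \<and> \<alpha> < 1 \<and> prime p \<and>
            A \<subseteq> Fp p \<and> B \<subseteq> Fp p \<and> C \<subseteq> Fp p \<and>
            (\<forall>X \<in> {A, B, C}. L1 * real p powr \<alpha> \<le> real (card X) \<and>
                              real (card X) \<le> L2 * real p powr \<alpha>) \<longrightarrow>
            Max ((\<lambda>r. cmod (char_sum p F A B C r)) ` (Fp p - {0})) \<le> K * real p powr E \<alpha>)"
    if F: "admissible F" and L1: "0 < L1" and L12: "L1 \<le> L2" for F :: zpoly3 and L1 L2 :: real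
  proof -
    obtain a b g :: "int poly" and h :: "int poly poly" where ab: "a \<noteq> 0" "b \<noteq> 0" and g: "2 \<le> degree g"
      and F_eq: "F = in_z a * var_x * var_y + in_z b * var_x ^ 2 * in_y g + in_yz h"
      using F unfolding admissible_def by - (elim exE conjE, rule that, assumption+)
    define L where "L = max 1 L2"
    have L: "1 \<le> L" "L2 \<le> L" by (auto simp: L_def)
    define X where "X = max (max 4096 (1 / L1)) (max (1 / L1\<^sup>2) (L\<^sup>2))"
    have X: "4096 \<le> X" "1 / L1 \<le> X" "1 / L1\<^sup>2 \<le> X" "L\<^sup>2 \<le> X"
      by (simp_all add: X_def le_max_iff_disj)
    \<comment> \<open>Primes up to \<open>p1\<close> are absorbed by the constant; \<open>p1\<close> depends on \<open>F\<close>, \<open>L1\<close> and \<open>L2\<close> only.\<close>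
    define p1 where "p1 = X ^ 20000 + 2 + \<bar>real_of_int (lead_coeff a)\<bar> + \<bar>real_of_int (lead_coeff b)\<bar>
      + \<bar>real_of_int (lead_coeff g)\<bar> + real (degree g)"
    have X0: "0 \<le> X ^ 20000" by (rule zero_le_power) (use X(1) in linarith)
    have p1: "1 \<le> p1" using X0 unfolding p1_def by linarith
    define D where "D = real (2 * degree g + degree a + degree b)"
    have D: "1 \<le> D" using g by (simp add: D_def)
    define K where "K = L ^ 3 * D * p1 ^ 3"
    have K: "0 < K" "L ^ 3 \<le> K" "L ^ 3 * D \<le> K" "L ^ 3 * p1 ^ 3 \<le> K"
    proof -
      have "1 \<le> L ^ 3" "1 \<le> p1 ^ 3" using L p1 by simp_all
      note one = this
      have "L ^ 3 * D * 1 \<le> L ^ 3 * D * p1 ^ 3" using one D L by (intro mult_left_mono) auto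
      then show 1: "L ^ 3 * D \<le> K" by (simp add: K_def)
      have "L ^ 3 * 1 \<le> L ^ 3 * D" using D L by (intro mult_left_mono) auto
      with 1 show 2: "L ^ 3 \<le> K" by simp
      then show "0 < K" using one by linarith
      have "(L ^ 3 * p1 ^ 3) * 1 \<le> (L ^ 3 * p1 ^ 3) * D"
        using D L p1 by (intro mult_left_mono mult_nonneg_nonneg zero_le_power) auto
      then show "L ^ 3 * p1 ^ 3 \<le> K" by (simp add: K_def mult_ac)
    qed
    have main: "cmod (char_sum p F A B C r) \<le> K * real p powr E \<alpha>"
      if \<alpha>: "0 < \<alpha>" "\<alpha> < 1" and p: "prime p" and A: "A \<subseteq> {0..<int p}" and B: "B \<subseteq> {0..<int p}" and C: "C \<subseteq> {0..<int p}"
        and low: "L1 * real p powr \<alpha> \<le> real (card A)"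
        and up: "real (card A) \<le> L2 * real p powr \<alpha>" "real (card B) \<le> L2 * real p powr \<alpha>" "real (card C) \<le> L2 * real p powr \<alpha>"
        and r: "r \<in> {0..<int p}" "r \<noteq> 0" for \<alpha> p A B C r
    proof -
      have pp: "1 \<le> real p" using prime_ge_1_nat[OF p] by simp
      have p0: "0 < p" using p prime_gt_0_nat by blast
      have nr: "\<not> int p dvd r" using r zdvd_imp_le[of "int p" r] by auto
      define P where "P = real p powr \<alpha>"
      have P0: "0 < P" using pp by (simp add: P_def)
      have upL: "x \<le> L * P" if "x \<le> L2 * P" for x
        using that L(2) P0 by (meson less_imp_le mult_right_mono order_trans)
      have cards: "real (card A) \<le> L * P" "real (card B) \<le> L * P" "real (card C) \<le> L * P"
        using up upL by (auto simp: P_def)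
      have "real (card A) * real (card B) * real (card C) \<le> (L * P) * (L * P) * (L * P)"
        using cards P0 L by (intro mult_mono) auto
      then have triv: "cmod (char_sum p F A B C r) \<le> L ^ 3 * P ^ 3"
        using char_sum_trivial[OF p0, of F A B C r] by (simp add: power3_eq_cube mult_ac)
      have P3: "P ^ 3 = real p powr (3 * \<alpha>)"
        using pp by (simp add: P_def powr_realpow[symmetric] powr_powr mult.commute)
      consider "\<alpha> < 1 / 2" | "real p \<le> p1" | "1 / 2 \<le> \<alpha>" "p1 < real p" by linarith
      then show ?thesis
      proof cases
        case 1
        have "L ^ 3 * P ^ 3 \<le> K * real p powr E \<alpha>" unfolding P3 E_low[OF \<alpha>(1) 1] using K by (intro mult_right_mono) auto
        with triv show ?thesis by linarith
      next
        case 2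
        have "P \<le> real p powr 1" unfolding P_def using \<alpha> pp by (intro powr_mono) auto
        then have "P ^ 3 \<le> p1 ^ 3" using 2 pp P0 by (intro power_mono) auto
        then have "L ^ 3 * P ^ 3 \<le> L ^ 3 * p1 ^ 3" using L by (intro mult_left_mono) auto
        also have "\<dots> \<le> K * 1" using K by simp
        also have "\<dots> \<le> K * real p powr E \<alpha>" using K E_pos[OF \<alpha>(1)] pp by (intro mult_left_mono ge_one_powr_ge_zero) auto
        finally show ?thesis using triv by linarith
      next
        case 3
        have "2 + \<bar>real_of_int (lead_coeff a)\<bar> + \<bar>real_of_int (lead_coeff b)\<bar>
            + \<bar>real_of_int (lead_coeff g)\<bar> + real (degree g) < real p"
          using 3(2) X0 unfolding p1_def by linarith
        then have "real_of_int (2 + \<bar>lead_coeff a\<bar> + \<bar>lead_coeff b\<bar> + \<bar>lead_coeff g\<bar> + int (degree g)) < real_of_int (int p)"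
          by simp
        then have "2 + \<bar>lead_coeff a\<bar> + \<bar>lead_coeff b\<bar> + \<bar>lead_coeff g\<bar> + int (degree g) < int p"
          by (simp only: of_int_less_iff)
        then have good: "good_prime a b g p" using good_prime_if_large[OF p ab g] by blast
        have p2: "p \<noteq> 2" using good by (simp add: good_prime_def)
        have KD: "L ^ 3 * D * real p powr E \<alpha> \<le> K * real p powr E \<alpha>" using K by (intro mult_right_mono) auto
        show ?thesis
        proof (cases "\<alpha> = 1 / 2")
          case True
          have "real (parabola_energy p A) \<le> real (card A) ^ 4 * real p powr (- (1 / 20000))"
          proof (rule parabola_energy_at_half[OF p p2 A L1 X])
            show "X ^ 20000 \<le> real p" using 3(2) unfolding p1_def by linarith
          qed (use low cards(1) in \<open>auto simp: True P_def\<close>)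
          also have "\<dots> \<le> 2 * real (card A) ^ 4 * real p powr (- (1 / 20000))" by (intro mult_right_mono) auto
          finally have "cmod (char_sum p F A B C r) \<le> L ^ 3 * D * real p powr ((32 * \<alpha> + 2 - 1 / 20000) / 12)"
            unfolding F_eq D_def using cards
            by (intro char_sum_power_saving[OF good g nr A B C L(1) \<alpha>(1)]) (auto simp: P_def)
          also have "(32 * \<alpha> + 2 - 1 / 20000) / 12 = E \<alpha>" unfolding True E_half ..
          finally show ?thesis using KD by linarith
        next
          case False
          have "real (parabola_energy p A) \<le> 2 * real (card A) ^ 4 * real p powr (- 0)"
            using parabola_energy_le[OF p p2 A] pp by simp
          then have "cmod (char_sum p F A B C r) \<le> L ^ 3 * D * real p powr ((32 * \<alpha> + 2 - 0) / 12)"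
            unfolding F_eq D_def using cards
            by (intro char_sum_power_saving[OF good g nr A B C L(1) \<alpha>(1)]) (auto simp: P_def)
          also have "(32 * \<alpha> + 2 - 0) / 12 = E \<alpha>" using E_high[of \<alpha>] 3 False by simp
          finally show ?thesis using KD by linarith
        qed
      qed
    qed
    show ?thesis
    proof (intro exI[of _ K] conjI allI impI)
      show "0 < K" by (rule K)
      fix \<alpha> :: real and p :: nat and A B C :: "int set"
      assume asm: "0 < \<alpha> \<and> \<alpha> < 1 \<and> prime p \<and>
            A \<subseteq> Fp p \<and> B \<subseteq> Fp p \<and> C \<subseteq> Fp p \<and>
            (\<forall>X \<in> {A, B, C}. L1 * real p powr \<alpha> \<le> real (card X) \<and>
                              real (card X) \<le> L2 * real p powr \<alpha>)"
      have Fp: "Fp p = {0..<int p}" by (auto simp: residue_ring_def)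
      have p: "prime p" using asm by blast
      have "1 \<in> {0..<int p} - {0}" using prime_gt_1_nat[OF p] by simp
      then have ne: "{0..<int p} - {0} \<noteq> {}" by blast
      have "cmod (char_sum p F A B C r) \<le> K * real p powr E \<alpha>" if "r \<in> {0..<int p} - {0}" for r
        using asm that unfolding Fp by (intro main) auto
      then show "Max ((\<lambda>r. cmod (char_sum p F A B C r)) ` (Fp p - {0})) \<le> K * real p powr E \<alpha>"
        unfolding Fp using ne by (subst Max_le_iff) auto
    qed
  qed
  then show ?thesis using \<gamma>_pos unfolding E_def by (intro exI[of _ \<gamma>]) blast
qed

end
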